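(* Let $f:\mathbb{A}\to\mathbb{A}$ be a symplectic twist diffeomorphism. Then $f$ is $C^0$-integrable with the dynamics on each leaf of the invariant foliation conjugated to a rotation if and only if $f$ has an invariant $C^0$-foliation into graphs that is exact symplectically homeomorphic to the standard foliation. In this case, $f$ admits global $C^0$ Arnol'd-Liouville coordinates.
   Context: $\mathbb{T}=\mathbb{R}/\mathbb{Z}$, $\mathbb{A}=\mathbb{T}\times\mathbb{R}$ with coordinates $(\theta,r)$ and symplectic form $\omega=-d(r\,d\theta)$. A symplectic twist diffeomorphism is a $C^1$ diffeomorphism $f:\mathbb{A}\to\mathbb{A}$ isotopic to the identity, with $f^*\omega=\omega$, and with the twist property: for any lift $F=(F_1,F_2):\mathbb{R}^2\to\mathbb{R}^2$ of $f$ and any $\tilde\theta\in\mathbb{R}$, the map $r\mapsto F_1(\tilde\theta,r)$ is an increasing $C^1$ diffeomorphism from $\mathbb{R}$ onto $\mathbb{R}$. A $C^0$ foliation of $\mathbb{A}$ into graphs is a partition of $\mathbb{A}$ into graphs of continuous functions $\eta_c:\mathbb{T}\to\mathbb{R}$, $c\in\mathbb{R}$, normalized by $\int_{\mathbb{T}}\eta_c=c$, such that $(\theta,c)\mapsto(\theta,\eta_c(\theta))$ is a homeomorphism of $\mathbb{A}$. A foliation is invariant under $f$ if every leaf is mapped onto itself by $f$. $f$ is $C^0$-integrable if it has an invariant $C^0$-foliation into graphs. The standard foliation has leaves $\mathbb{T}\times\{c\}$. A diffeomorphism $\phi:\mathbb{A}\to\mathbb{A}$ is exact symplectic if $\phi^*(r\,d\theta)-r\,d\theta$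 is exact; an exact symplectic homeomorphism is a homeomorphism that is a limit, for the $C^0$ compact-open topology, of a sequence of exact symplectic diffeomorphisms. A foliation is exact symplectically homeomorphic to the standard foliation if it is the image of the standard foliation by an exact symplectic homeomorphism of $\mathbb{A}$. A symplectic homeomorphism of $\mathbb{A}$ is a homeomorphism that is a $C^0$ compact-open limit of symplectic diffeomorphisms (here equivalently, an orientation and Lebesgue measure preserving homeomorphism). $C^0$ Arnol'd-Liouville coordinates for $f$ are given by a symplectic homeomorphism $\Phi:\mathbb{A}\to\mathbb{A}$ such that the standard foliation is invariant by $\Phi^{-1}\circ f\circ\Phi$ and $\Phi^{-1}\circ f\circ\Phi(x,c)=(x+\rho(c),c)$ for some continuous $\rho:\mathbb{R}\to\mathbb{R}$. *)

theory Defs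
  imports "HOL-Analysis.Analysis" "HOL-Library.Disjoint_Sets"
begin

section \<open>The circle \<open>\<real>/\<int>\<close>\<close>

quotient_type circle = real / "\<lambda>x y. x - y \<in> \<int>"
proof (rule equivpI)
  show "reflp (\<lambda>x y::real. x - y \<in> \<int>)"
    by (auto simp: reflp_def)
  show "symp (\<lambda>x y::real. x - y \<in> \<int>)"
    unfolding symp_def by (metis Ints_minus minus_diff_eq)
  show "transp (\<lambda>x y::real. x - y \<in> \<int>)"
    unfolding transp_def by (metis Ints_add diff_add_cancel add_diff_eq)
qed

lift_definition to_circle :: "real \<Rightarrow> circle" is "\<lambda>x. x" .

instantiation circle :: ab_group_add
begin

lift_definition zero_circle :: circle is 0 .

lift_definition plus_circle :: "circle \<Rightarrow> circle \<Rightarrow> circle" is "(+)"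
  by (metis Ints_add add_diff_add)

lift_definition uminus_circle :: "circle \<Rightarrow> circle" is uminus
  by (metis Ints_minus minus_diff_minus)

lift_definition minus_circle :: "circle \<Rightarrow> circle \<Rightarrow> circle" is "(-)"
proof -
  fix a b c d :: real
  assume "a - b \<in> \<int>" "c - d \<in> \<int>"
  then have "(a - b) - (c - d) \<in> \<int>" by (rule Ints_diff)
  then show "a - c - (b - d) \<in> \<int>" by (simp add: algebra_simps)
qed

instance
  by standard (transfer; simp)+

end

lemma abs_diff_round_minimal: "k \<in> \<int> \<Longrightarrow> \<bar>z - of_int (round z)\<bar> \<le> \<bar>z - k\<bar>" for z k :: real
  by (metis Ints_cases round_diff_minimal)

lemma abs_diff_round_shift:
  fixes z w :: real
  assumes "z - w \<in> \<int>"
  shows "\<bar>z - of_int (round z)\<bar> = \<bar>w - of_int (round w)\<bar>"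
proof -
  have "\<bar>z - of_int (round z)\<bar> \<le> \<bar>w - of_int (round w)\<bar>" if "z - w \<in> \<int>" for z w :: real
    using abs_diff_round_minimal[of "(z - w) + of_int (round w)" z] that by simp
  moreover have "w - z \<in> \<int>"
    using assms by (metis Ints_minus minus_diff_eq)
  ultimately show ?thesis
    using assms by (meson order_antisym)
qed

instantiation circle :: metric_space
begin

text \<open>The quotient metric: the distance from \<open>x - y\<close> to the nearest integer.\<close>

lift_definition dist_circle :: "circle \<Rightarrow> circle \<Rightarrow> real"
  is "\<lambda>x y. \<bar>(x - y) - of_int (round (x - y))\<bar>"
proof (rule abs_diff_round_shift)
  fix a b c d :: real
  assume "a - b \<in> \<int>" "c - d \<in> \<int>"
  then have "(a - b) - (c - d) \<in> \<int>" by (rule Ints_diff)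
  then show "a - c - (b - d) \<in> \<int>" by (simp add: algebra_simps)
qed

definition uniformity_circle :: "(circle \<times> circle) filter"
  where "uniformity_circle = (INF e\<in>{0 <..}. principal {(x, y). dist x y < e})"

definition open_circle :: "circle set \<Rightarrow> bool"
  where "open_circle U \<longleftrightarrow> (\<forall>x\<in>U. \<forall>\<^sub>F (x', y) in uniformity. x' = x \<longrightarrow> y \<in> U)"

instance
proof
  show "uniformity = (INF e\<in>{0 <..}. principal {(x :: circle, y). dist x y < e})"
    by (rule uniformity_circle_def)
  show "open U \<longleftrightarrow> (\<forall>x\<in>U. \<forall>\<^sub>F (x', y) in uniformity. x' = x \<longrightarrow> y \<in> U)" for U :: "circle set"
    by (rule open_circle_def)
  show "dist x y = 0 \<longleftrightarrow> x = y" for x y :: circle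
    by transfer (metis Ints_cases Ints_of_int abs_eq_0 eq_iff_diff_eq_0 round_of_int)
  show "dist x y \<le> dist x z + dist y z" for x y z :: circle
  proof transfer
    fix x y z :: real
    let ?k = "of_int (round (x - z)) - of_int (round (y - z)) :: real"
    have "\<bar>(x - y) - of_int (round (x - y))\<bar> \<le> \<bar>(x - y) - ?k\<bar>"
      by (rule abs_diff_round_minimal) simp
    then show "\<bar>(x - y) - of_int (round (x - y))\<bar>
        \<le> \<bar>(x - z) - of_int (round (x - z))\<bar> + \<bar>(y - z) - of_int (round (y - z))\<bar>"
      by linarith
  qed
qed

end

lemma to_circle_eq_iff: "to_circle x = to_circle y \<longleftrightarrow> x - y \<in> \<int>"
  by transfer simp

lemma surj_to_circle: "surj to_circle"
  unfolding surj_def by transfer (metis Ints_0 diff_self)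

lemma dist_to_circle_le: "dist (to_circle x) (to_circle y) \<le> dist x y"
  unfolding dist_real_def by transfer (use abs_diff_round_minimal[of 0] in force)

lemma dist_to_circle_attained: "\<exists>y'. to_circle y' = to_circle y \<and> dist x y' = dist (to_circle x) (to_circle y)"
proof (intro exI conjI)
  show "to_circle (y + of_int (round (x - y))) = to_circle y"
    by (simp add: to_circle_eq_iff)
  show "dist x (y + of_int (round (x - y))) = dist (to_circle x) (to_circle y)"
    unfolding dist_real_def by transfer (simp add: algebra_simps)
qed

text \<open>The metric topology is the quotient topology of \<open>\<real>/\<int>\<close>.\<close>

lemma open_circle_iff: "open U \<longleftrightarrow> open (to_circle -` U)" for U :: "circle set"
proof
  assume "open U"
  moreover have "continuous_on UNIV to_circle"
    unfolding continuous_on_iff by (meson dist_to_circle_le le_less_trans)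
  ultimately show "open (to_circle -` U)"
    by (rule open_vimage)
next
  assume *: "open (to_circle -` U)"
  show "open U"
    unfolding open_dist
  proof
    fix q assume "q \<in> U"
    obtain x where x: "q = to_circle x"
      using surj_to_circle by (metis surjD)
    from * \<open>q \<in> U\<close> obtain e where e: "e > 0" "\<And>y. dist y x < e \<Longrightarrow> to_circle y \<in> U"
      unfolding open_dist x by auto
    have "p \<in> U" if "dist p q < e" for p
    proof -
      obtain y where y: "p = to_circle y"
        using surj_to_circle by (metis surjD)
      obtain y' where "to_circle y' = p" "dist x y' = dist q p"
        using dist_to_circle_attained[of y x] unfolding x y by blast
      then show "p \<in> U"
        using e(2)[of y'] that by (simp add: dist_commute)
    qed
    then show "\<exists>e>0. \<forall>p. dist p q < e \<longrightarrow> p \<in> U"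
      using e(1) by blast
  qed
qed


section \<open>Maps of the annulus\<close>

type_synonym annulus = "circle \<times> real"

definition annulus_proj :: "real \<times> real \<Rightarrow> annulus"
  where "annulus_proj = map_prod to_circle id"

definition is_lift :: "(annulus \<Rightarrow> annulus) \<Rightarrow> (real \<times> real \<Rightarrow> real \<times> real) \<Rightarrow> bool"
  where "is_lift f F \<longleftrightarrow> continuous_on UNIV F \<and> annulus_proj \<circ> F = f \<circ> annulus_proj"

definition C1 :: "('a::real_normed_vector \<Rightarrow> 'b::real_normed_vector) \<Rightarrow> bool"
  where "C1 g \<longleftrightarrow> (\<exists>g' :: 'a \<Rightarrow> 'a \<Rightarrow>\<^sub>L 'b.
    (\<forall>x. (g has_derivative blinfun_apply (g' x)) (at x)) \<and> continuous_on UNIV g')"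

definition C1_diffeo :: "('a::real_normed_vector \<Rightarrow> 'b::real_normed_vector) \<Rightarrow> bool"
  where "C1_diffeo g \<longleftrightarrow> bij g \<and> C1 g \<and> C1 (inv g)"

text \<open>
  The smooth structure of the annulus is the one for which \<open>annulus_proj\<close> is a local
  diffeomorphism. Since the plane is simply connected, every continuous map of the annulus has a
  lift, and it is \<open>C\<^sup>1\<close> exactly when such a lift is.
\<close>

definition annulus_C1 :: "(annulus \<Rightarrow> annulus) \<Rightarrow> bool"
  where "annulus_C1 f \<longleftrightarrow> (\<exists>F. is_lift f F \<and> C1 F)"

definition annulus_C1_diffeo :: "(annulus \<Rightarrow> annulus) \<Rightarrow> bool"
  where "annulus_C1_diffeo f \<longleftrightarrow> bij f \<and> annulus_C1 f \<and> annulus_C1 (inv f)"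

definition annulus_homeo :: "(annulus \<Rightarrow> annulus) \<Rightarrow> bool"
  where "annulus_homeo f \<longleftrightarrow> (\<exists>g. homeomorphism UNIV UNIV f g)"

definition isotopic_to_id :: "(annulus \<Rightarrow> annulus) \<Rightarrow> bool"
  where "isotopic_to_id f \<longleftrightarrow> (\<exists>H :: real \<Rightarrow> annulus \<Rightarrow> annulus.
    continuous_on ({0..1} \<times> UNIV) (\<lambda>(t, x). H t x) \<and>
    (\<forall>t\<in>{0..1}. annulus_homeo (H t)) \<and> H 0 = id \<and> H 1 = f)"

text \<open>
  Differential forms on the annulus are written in the coordinates \<open>(\<theta>, r)\<close> of the universal
  cover, the first argument being the base point. The form \<open>r d\<theta>\<close> is \<open>liouville_form\<close>, and
  \<open>\<omega> = - d(r d\<theta>) = d\<theta> \<and> dr\<close> is \<open>area_form\<close>.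
  Two lifts of a map differ by an integer translation of \<open>\<theta>\<close>, so pullbacks computed with lifts
  do not depend on the choice of the lift.
\<close>

definition liouville_form :: "real \<times> real \<Rightarrow> real \<times> real \<Rightarrow> real"
  where "liouville_form x u = snd x * fst u"

definition area_form :: "real \<times> real \<Rightarrow> real \<times> real \<Rightarrow> real \<times> real \<Rightarrow> real"
  where "area_form x u v = fst u * snd v - snd u * fst v"

definition symplectic_diffeo :: "(annulus \<Rightarrow> annulus) \<Rightarrow> bool"
  where "symplectic_diffeo f \<longleftrightarrow> annulus_C1_diffeo f \<and>
    (\<forall>F. is_lift f F \<longrightarrow> (\<forall>x u v.
      area_form (F x) (frechet_derivative F (at x) u) (frechet_derivative F (at x) v)
        = area_form x u v))"

text \<open>
  The function \<open>S\<close> is a primitive of \<open>f\<^sup>* (r d\<theta>) - r d\<theta>\<close>; being defined on the annulus, it is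
  1-periodic in \<open>\<theta>\<close> when read on the cover.
\<close>

definition exact_symplectic_diffeo :: "(annulus \<Rightarrow> annulus) \<Rightarrow> bool"
  where "exact_symplectic_diffeo f \<longleftrightarrow> annulus_C1_diffeo f \<and>
    (\<forall>F. is_lift f F \<longrightarrow> (\<exists>S :: annulus \<Rightarrow> real. \<forall>x.
      ((S \<circ> annulus_proj) has_derivative
        (\<lambda>u. liouville_form (F x) (frechet_derivative F (at x) u) - liouville_form x u)) (at x)))"

definition twist :: "(annulus \<Rightarrow> annulus) \<Rightarrow> bool"
  where "twist f \<longleftrightarrow> (\<forall>F. is_lift f F \<longrightarrow> (\<forall>\<theta>.
    strict_mono (\<lambda>r. fst (F (\<theta>, r))) \<and> C1_diffeo (\<lambda>r. fst (F (\<theta>, r)))))"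

definition symplectic_twist_diffeo :: "(annulus \<Rightarrow> annulus) \<Rightarrow> bool"
  where "symplectic_twist_diffeo f \<longleftrightarrow> symplectic_diffeo f \<and> isotopic_to_id f \<and> twist f"

text \<open>
  The annulus is a metric space, so convergence of continuous maps in the compact-open topology
  is uniform convergence on compact sets.
\<close>

definition compact_open_limit ::
    "(nat \<Rightarrow> annulus \<Rightarrow> annulus) \<Rightarrow> (annulus \<Rightarrow> annulus) \<Rightarrow> bool"
  where "compact_open_limit \<phi> \<Phi> \<longleftrightarrow> (\<forall>K. compact K \<longrightarrow> uniform_limit K \<phi> \<Phi> sequentially)"

definition symplectic_homeo :: "(annulus \<Rightarrow> annulus) \<Rightarrow> bool"
  where "symplectic_homeo \<Phi> \<longleftrightarrow> annulus_homeo \<Phi> \<and>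
    (\<exists>\<phi>. (\<forall>n. symplectic_diffeo (\<phi> n)) \<and> compact_open_limit \<phi> \<Phi>)"

definition exact_symplectic_homeo :: "(annulus \<Rightarrow> annulus) \<Rightarrow> bool"
  where "exact_symplectic_homeo \<Phi> \<longleftrightarrow> annulus_homeo \<Phi> \<and>
    (\<exists>\<phi>. (\<forall>n. exact_symplectic_diffeo (\<phi> n)) \<and> compact_open_limit \<phi> \<Phi>)"


section \<open>Foliations into graphs\<close>

definition leaf :: "(real \<Rightarrow> circle \<Rightarrow> real) \<Rightarrow> real \<Rightarrow> annulus set"
  where "leaf \<eta> c = {(\<theta>, \<eta> c \<theta>) | \<theta>. True}"

definition leaves :: "(real \<Rightarrow> circle \<Rightarrow> real) \<Rightarrow> annulus set set"
  where "leaves \<eta> = range (leaf \<eta>)"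

definition C0_foliation :: "(real \<Rightarrow> circle \<Rightarrow> real) \<Rightarrow> bool"
  where "C0_foliation \<eta> \<longleftrightarrow>
    (\<forall>c. continuous_on UNIV (\<eta> c)) \<and>
    (\<forall>c. integral {0..1} (\<lambda>x. \<eta> c (to_circle x)) = c) \<and>
    partition_on UNIV (leaves \<eta>) \<and>
    annulus_homeo (\<lambda>(\<theta>, c). (\<theta>, \<eta> c \<theta>))"

definition standard_foliation :: "real \<Rightarrow> circle \<Rightarrow> real"
  where "standard_foliation c \<theta> = c"

definition invariant_foliation ::
    "(annulus \<Rightarrow> annulus) \<Rightarrow> (real \<Rightarrow> circle \<Rightarrow> real) \<Rightarrow> bool"
  where "invariant_foliation f \<eta> \<longleftrightarrow> (\<forall>c. f ` leaf \<eta> c = leaf \<eta> c)"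

definition conj_to_rotation_on :: "annulus set \<Rightarrow> (annulus \<Rightarrow> annulus) \<Rightarrow> bool"
  where "conj_to_rotation_on L f \<longleftrightarrow> (\<exists>(h :: circle \<Rightarrow> annulus) h' \<alpha>.
    homeomorphism UNIV L h h' \<and> (\<forall>\<theta>. f (h \<theta>) = h (\<theta> + \<alpha>)))"

definition integrable_with_rotations :: "(annulus \<Rightarrow> annulus) \<Rightarrow> bool"
  where "integrable_with_rotations f \<longleftrightarrow> (\<exists>\<eta>. C0_foliation \<eta> \<and> invariant_foliation f \<eta> \<and>
    (\<forall>L\<in>leaves \<eta>. conj_to_rotation_on L f))"

definition exact_symplectically_standard :: "(real \<Rightarrow> circle \<Rightarrow> real) \<Rightarrow> bool"
  where "exact_symplectically_standard \<eta> \<longleftrightarrow> (\<exists>\<Phi>. exact_symplectic_homeo \<Phi> \<and>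
    (`) \<Phi> ` leaves standard_foliation = leaves \<eta>)"

definition C0_Arnold_Liouville :: "(annulus \<Rightarrow> annulus) \<Rightarrow> bool"
  where "C0_Arnold_Liouville f \<longleftrightarrow> (\<exists>\<Phi>. symplectic_homeo \<Phi> \<and>
    invariant_foliation (inv \<Phi> \<circ> f \<circ> \<Phi>) standard_foliation \<and>
    (\<exists>\<rho> :: real \<Rightarrow> real. continuous_on UNIV \<rho> \<and>
      (\<forall>x c. (inv \<Phi> \<circ> f \<circ> \<Phi>) (x, c) = (x + to_circle (\<rho> c), c))))"

end

theory Submission
  imports Defs "HOL-Analysis.Kronecker_Approximation_Theorem"
begin

text \<open>
  Throughout, \<open>e c\<close> is the lift of the leaf \<open>\<eta> c\<close> to a periodic function, \<open>F\<close> a lift of \<open>f\<close>, and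
  \<open>g c t = fst (F (t, e c t))\<close> the lifted dynamics on the leaf.

  Let a symplectic homeomorphism \<open>\<Phi>\<close> map the horizontal circles to the leaves of an invariant
  foliation. Then \<open>inv \<Phi> \<circ> f \<circ> \<Phi>\<close> maps each horizontal circle to itself. A limit of area preserving
  homeomorphisms still preserves the area of boxes (\<open>measure_limit_image_box\<close>), so this map also
  preserves the area over an arc between neighbouring circles. Hence it preserves length on each circle and is a
  rotation there (\<open>symplectic_homeo_conjugates_to_rotations\<close>). An exact symplectic diffeomorphism
  preserves area (\<open>exact_imp_symplectic_derivative\<close>), so this covers one implication of the
  equivalence, and it gives the Arnol'd-Liouville coordinates as soon as \<open>\<Phi>\<close> exists.

  For the converse, let \<open>w t c\<close> be the integral of \<open>e c\<close> over \<open>[0, t]\<close>. If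
  \<open>w\<close> is continuously differentiable in \<open>c\<close> as well, with a derivative \<open>h c t\<close> that is increasing in
  \<open>t\<close>, then \<open>w\<close> is a generating function: \<open>dw = r dt + x dc\<close> for \<open>r = e c t\<close> and \<open>x = h c t\<close>, so that
  the map \<open>(x, c) \<mapsto> (t, r)\<close>, which carries horizontal lines to leaves, satisfies
  \<open>r dt - c dx = d (w - c x)\<close> in the sense of limits. Indeed, averaging \<open>w\<close> over small squares makes
  \<open>e\<close> and \<open>h\<close> continuously differentiable and keeps the mixed derivative positive, and then the
  formula is that of an exact symplectic diffeomorphism (\<open>smoothed_exact_diffeo\<close>). These
  diffeomorphisms converge to the required homeomorphism
  (\<open>exact_symplectic_homeo_of_generating_function\<close>).

  What remains is the heart of the proof (\<open>area_C1\<close>): the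
  normalised area \<open>(w t c' - w t c) / (c' - c)\<close> between two leaves converges as \<open>c'\<close> tends to \<open>c\<close>, and
  the limit depends continuously on \<open>c\<close>. The input is the inequality \<open>flux\<close>: the region between two
  leaves over an interval is mapped without loss of area, and by the twist the image lies over the
  interval spanned by the extreme leaves.

  On a leaf with irrational rotation number, where the dynamics is conjugated to a translation, \<open>flux\<close>
  says that the normalised area is almost an invariant measure. Averaging over an orbit segment whose
  length is the denominator of a good rational approximation shows that in the conjugating
  coordinate it is close to Lebesgue measure, for any two leaves near the given one
  (\<open>irrational_leaf\<close>).

  On a leaf with rational rotation number all points are periodic, since the leaf is conjugated to a
  rotation. An iterate \<open>G\<close> of \<open>F\<close>, up to an integer translation, fixes the leaf pointwise. Its
  derivative at a point of the leaf fixes a vector and preserves area, so it is a shear; the iterates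
  of \<open>F\<close> still twist, so \<open>G\<close> moves a point at vertical distance \<open>\<delta>\<close> from the leaf by about \<open>b t * \<delta>\<close>
  with \<open>b t > 0\<close> (\<open>shear\<close>). The powers of \<open>G\<close> and of its inverse are increasing on every leaf, and
  this forces the slopes of nearby leaves to those of the fixed one (\<open>flat\<close>). So a vertical segment
  from the fixed leaf to a nearby one sweeps out a triangle of area about \<open>b t * \<delta>\<^sup>2 / 2\<close>. By
  \<open>flux_bounds\<close> that area is the same for all \<open>t\<close>, hence \<open>\<delta>\<close> is asymptotically proportional to
  \<open>1 / sqrt (b t)\<close> (\<open>height_limit\<close>), and the derivative exists at the leaf. It is continuous there
  because the derivative at a nearby leaf semiconjugates the dynamics on that leaf to a translation,
  while in the coordinate \<open>B\<close> with density proportional to \<open>1 / sqrt (b t)\<close> this dynamics already is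
  almost a translation (\<open>semiconjugacy_limit\<close>).
\<close>

section \<open>Lifts to the universal cover\<close>

lemma integer_valued_imp_constant:
  fixes q :: "'a::topological_space \<Rightarrow> real"
  assumes "connected S" "continuous_on S q" "\<And>x. x \<in> S \<Longrightarrow> q x \<in> \<int>" "x \<in> S" "y \<in> S"
  shows "q x = q y"
proof -
  have "q constant_on S"
  proof (rule continuous_discrete_range_constant[OF assms(1,2)])
    fix x assume x: "x \<in> S"
    have "1 \<le> norm (q y - q x)" if "y \<in> S" "q y \<noteq> q x" for y
      using assms(3)[OF x] assms(3)[OF that(1)] that(2) Ints_nonzero_abs_ge1[of "q y - q x"]
      by (simp add: Ints_diff)
    then show "\<exists>e>0. \<forall>y. y \<in> S \<and> q y \<noteq> q x \<longrightarrow> e \<le> norm (q y - q x)"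
      by (intro exI[of _ 1]) auto
  qed
  then show ?thesis using assms(4,5) by (auto simp: constant_on_def)
qed

lemma to_circle_add: "to_circle (x + y) = to_circle x + to_circle y"
  by transfer simp

lemma to_circle_add_int [simp]: "to_circle (x + of_int k) = to_circle x"
  by (simp add: to_circle_eq_iff)

lemma to_circle_add_1 [simp]: "to_circle (x + 1) = to_circle x"
  by (simp add: to_circle_eq_iff)

lemma continuous_on_to_circle: "continuous_on S to_circle"
  unfolding continuous_on_iff by (meson dist_to_circle_le le_less_trans)

lemma annulus_proj_eq [simp]: "annulus_proj (x, r) = (to_circle x, r)"
  by (simp add: annulus_proj_def)

lemma fst_annulus_proj: "fst (annulus_proj z) = to_circle (fst z)"
  and snd_annulus_proj: "snd (annulus_proj z) = snd z"
  by (simp_all add: annulus_proj_def)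

lemma continuous_on_annulus_proj: "continuous_on S annulus_proj"
proof -
  have "continuous_on S (\<lambda>z::real \<times> real. (to_circle (fst z), snd z))"
    by (intro continuous_intros continuous_on_compose2[OF continuous_on_to_circle[of UNIV]]) auto
  also have "(\<lambda>z. (to_circle (fst z), snd z)) = annulus_proj"
    by (auto simp: fun_eq_iff)
  finally show ?thesis .
qed

lemma surj_annulus_proj: "surj annulus_proj"
  unfolding surj_def annulus_proj_def using surj_to_circle
  by (metis map_prod_surj_on surj_id surjD map_prod_surj)

lemma annulus_proj_shift [simp]: "annulus_proj (z + (of_int k, 0)) = annulus_proj z"
  by (cases z) simp

lemma annulus_proj_shift_1 [simp]: "annulus_proj (z + (1, 0)) = annulus_proj z"
  by (cases z) simp

lemma annulus_proj_eq_iff: "annulus_proj z = annulus_proj z' \<longleftrightarrow> (\<exists>k::int. z' = z + (of_int k, 0))"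
proof
  assume "annulus_proj z = annulus_proj z'"
  then have "fst z' - fst z \<in> \<int>" "snd z' = snd z"
    by (auto simp: annulus_proj_def map_prod_def split_beta) (metis to_circle_eq_iff)
  then show "\<exists>k::int. z' = z + (of_int k, 0)"
    by (metis (no_types, lifting) Ints_cases add.commute add.right_neutral diff_add_cancel fst_add fst_conv prod.expand snd_add snd_conv)
qed auto

lemma dist_annulus_proj_attained:
  "\<exists>z'. annulus_proj z' = p \<and> dist z z' = dist (annulus_proj z) p"
proof -
  obtain x where x: "fst p = to_circle x"
    using surj_to_circle by (metis surjD)
  obtain x' where x': "to_circle x' = fst p" "dist (fst z) x' = dist (to_circle (fst z)) (fst p)"
    using dist_to_circle_attained[of x "fst z"] x by auto
  show ?thesis
    by (rule exI[of _ "(x', snd p)"]) (use x' in \<open>simp add: dist_prod_def fst_annulus_proj snd_annulus_proj\<close>)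
qed

lemma dist_annulus_proj_le: "dist (annulus_proj z) (annulus_proj z') \<le> dist z z'"
  unfolding dist_prod_def fst_annulus_proj snd_annulus_proj
  by (intro real_sqrt_le_mono add_right_mono power_mono dist_to_circle_le) auto

text \<open>Both covering maps are quotient maps, so continuity may be tested on the cover.\<close>

lemma continuous_on_annulusI:
  fixes f :: "annulus \<Rightarrow> 'b::metric_space"
  assumes "continuous_on UNIV (f \<circ> annulus_proj)"
  shows "continuous_on UNIV f"
  unfolding continuous_on_iff
proof (intro ballI allI impI)
  fix p :: annulus and e :: real
  assume e: "0 < e"
  obtain z where z: "p = annulus_proj z" using surj_annulus_proj by (metis surjD)
  obtain d where d: "d > 0" "\<And>z'. dist z' z < d \<Longrightarrow> dist ((f \<circ> annulus_proj) z') ((f \<circ> annulus_proj) z) < e"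
    using assms e unfolding continuous_on_iff by (metis UNIV_I)
  have "dist (f p') (f p) < e" if "dist p' p < d" for p'
    using dist_annulus_proj_attained[of p' z] d(2) that z
    by (metis comp_apply dist_commute)
  then show "\<exists>d>0. \<forall>x'\<in>UNIV. dist x' p < d \<longrightarrow> dist (f x') (f p) < e"
    using d(1) by blast
qed

lemma continuous_on_circleI:
  fixes f :: "circle \<Rightarrow> 'b::metric_space"
  assumes "continuous_on UNIV (f \<circ> to_circle)"
  shows "continuous_on UNIV f"
proof -
  have "continuous_on UNIV (\<lambda>p. (f \<circ> to_circle) (fst p))"
    by (rule continuous_on_compose2[OF assms]) (auto intro!: continuous_intros)
  moreover have "(\<lambda>p. (f \<circ> to_circle) (fst p)) = (\<lambda>p::annulus. f (fst p)) \<circ> annulus_proj"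
    by (auto simp: fst_annulus_proj)
  ultimately have "continuous_on UNIV (\<lambda>p::annulus. f (fst p))"
    by (metis continuous_on_annulusI)
  then have "continuous_on UNIV (\<lambda>x. (\<lambda>p::annulus. f (fst p)) (x, 0))"
    by (rule continuous_on_compose2) (auto intro!: continuous_intros)
  then show ?thesis by simp
qed

lift_definition circle_cis :: "circle \<Rightarrow> complex" is "\<lambda>x. cis (2 * pi * x)"
proof -
  fix x y :: real assume "x - y \<in> \<int>"
  then obtain k where "x = y + of_int k" by (metis Ints_cases add.commute diff_add_cancel)
  then show "cis (2 * pi * x) = cis (2 * pi * y)"
    by (simp add: distrib_left flip: cis_mult)
qed

lemma circle_cis_to_circle: "circle_cis (to_circle x) = cis (2 * pi * x)"
  by transfer simp

lemma continuous_on_circle_cis: "continuous_on UNIV circle_cis"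
  by (rule continuous_on_circleI)
    (auto simp: comp_def circle_cis_to_circle intro!: continuous_intros)

text \<open>Composed with \<open>circle_cis\<close>, the map has a continuous complex logarithm on a convex set, and the
  imaginary part of the logarithm is the lift up to a factor.\<close>

lemma circle_lift_exists:
  fixes p :: "'a::real_normed_vector \<Rightarrow> circle"
  assumes "convex S" "continuous_on S p"
  obtains q where "continuous_on S q" "\<And>x. x \<in> S \<Longrightarrow> to_circle (q x) = p x"
proof -
  have nz: "circle_cis u \<noteq> 0" for u
    by transfer simp
  have "continuous_on S (\<lambda>x. circle_cis (p x))"
    by (rule continuous_on_compose2[OF continuous_on_circle_cis assms(2)]) auto
  then obtain g where g: "continuous_on S g" "\<And>x. x \<in> S \<Longrightarrow> circle_cis (p x) = exp (g x)"
    using continuous_logarithm_on_contractible[of S "\<lambda>x. circle_cis (p x)"] nz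
      convex_imp_contractible[OF assms(1)] by auto
  show ?thesis
  proof (rule that[of "\<lambda>x. Im (g x) / (2 * pi)"])
    show "continuous_on S (\<lambda>x. Im (g x) / (2 * pi))"
      by (auto intro!: continuous_intros g(1))
    fix x assume x: "x \<in> S"
    obtain t where t: "p x = to_circle t" using surj_to_circle by (metis surjD)
    have eq: "cis (2 * pi * t) = exp (g x)"
      using g(2)[OF x] by (simp add: t circle_cis_to_circle)
    then have "norm (exp (g x)) = 1" by (metis norm_cis)
    then have "Re (g x) = 0" by simp
    then have "exp (g x) = cis (Im (g x))" by (simp add: exp_eq_polar)
    then have "cis (Im (g x)) = cis (2 * pi * t)" using eq by simp
    then obtain k :: int where "Im (g x) = 2 * pi * t + 2 * pi * k"
      unfolding complex_eq_iff cis.simps using sin_cos_eq_iff[of "Im (g x)" "2 * pi * t"] by auto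
    then have "Im (g x) / (2 * pi) = t + k" by (simp add: field_simps)
    then show "to_circle (Im (g x) / (2 * pi)) = p x" by (simp add: t)
  qed
qed

lemma is_lift_continuous: "is_lift f F \<Longrightarrow> continuous_on UNIV F"
  by (simp add: is_lift_def)

lemma is_lift_apply: "is_lift f F \<Longrightarrow> annulus_proj (F z) = f (annulus_proj z)"
  unfolding is_lift_def by (metis comp_apply)

lemma is_liftI: "continuous_on UNIV F \<Longrightarrow> (\<And>z. annulus_proj (F z) = f (annulus_proj z)) \<Longrightarrow> is_lift f F"
  unfolding is_lift_def by (auto simp: fun_eq_iff)

lemma is_lift_id: "is_lift id id"
  by (rule is_liftI) (auto simp: continuous_on_id)

lemma is_lift_comp: "is_lift f F \<Longrightarrow> is_lift g G \<Longrightarrow> is_lift (f \<circ> g) (F \<circ> G)"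
  by (rule is_liftI)
    (auto simp: is_lift_apply comp_def intro: continuous_on_compose2 is_lift_continuous)

lemma is_lift_shift: "is_lift f F \<Longrightarrow> is_lift f (\<lambda>z. F z + (of_int k, 0))"
  by (rule is_liftI) (simp_all add: is_lift_apply is_lift_continuous continuous_on_add)

lemma is_lift_continuous_imp: "is_lift f F \<Longrightarrow> continuous_on UNIV f"
proof (rule continuous_on_annulusI)
  assume F: "is_lift f F"
  then have "f \<circ> annulus_proj = annulus_proj \<circ> F" by (simp add: is_lift_def)
  then show "continuous_on UNIV (f \<circ> annulus_proj)"
    using continuous_on_compose[OF is_lift_continuous[OF F] continuous_on_annulus_proj] by simp
qed

lemma lift_exists:
  assumes "continuous_on UNIV f"
  obtains F where "is_lift f F"
proof -
  have c: "continuous_on UNIV (\<lambda>z. f (annulus_proj z))"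
    by (rule continuous_on_compose2[OF assms continuous_on_annulus_proj]) auto
  obtain q where q: "continuous_on UNIV q" "\<And>z. to_circle (q z) = fst (f (annulus_proj z))"
    using circle_lift_exists[of UNIV "\<lambda>z. fst (f (annulus_proj z))"] c continuous_on_fst by auto
  show ?thesis
    by (rule that[of "\<lambda>z. (q z, snd (f (annulus_proj z)))"], rule is_liftI)
      (auto intro!: continuous_on_Pair q(1) continuous_on_snd c simp: q(2))
qed

lemma lift_unique:
  assumes "is_lift f F" "is_lift f F'"
  obtains k :: int where "\<And>z. F' z = F z + (of_int k, 0)"
proof -
  have "\<exists>k::int. F' z = F z + (of_int k, 0)" for z
    using assms by (metis annulus_proj_eq_iff is_lift_apply)
  then obtain k :: "real \<times> real \<Rightarrow> int" where k: "\<And>z. F' z = F z + (of_int (k z), 0)" by metis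
  have "fst (F' z) - fst (F z) = of_int (k z)" for z by (simp add: k)
  moreover have "fst (F' z) - fst (F z) = fst (F' 0) - fst (F 0)" for z
  proof (rule integer_valued_imp_constant[of UNIV "\<lambda>z. fst (F' z) - fst (F z)"])
    show "continuous_on UNIV (\<lambda>z. fst (F' z) - fst (F z))"
      by (intro continuous_intros is_lift_continuous[OF assms(1)] is_lift_continuous[OF assms(2)])
  qed (auto simp: k)
  ultimately have "k z = k 0" for z by (metis of_int_eq_iff)
  then show ?thesis using that k by metis
qed

text \<open>The two lifts compose to a lift of the identity, which is an integer translation; correcting by it
  makes them inverse to each other.\<close>

lemma lift_inverse:
  assumes "bij f" "is_lift f F" "is_lift (inv f) F''"
  obtains F' where "is_lift (inv f) F'" "\<And>z. F (F' z) = z" "\<And>z. F' (F z) = z"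
proof -
  have "is_lift id (F'' \<circ> F)"
    using is_lift_comp[OF assms(3,2)] assms(1) by (simp add: bij_is_inj)
  then obtain k :: int where k: "\<And>z. F'' (F z) = z + (of_int k, 0)"
    using lift_unique[OF is_lift_id] by (metis comp_apply id_apply)
  define F' where "F' = (\<lambda>z. F'' z + (of_int (- k), 0))"
  have F': "is_lift (inv f) F'" unfolding F'_def by (rule is_lift_shift[OF assms(3)])
  have 1: "F' (F z) = z" for z by (simp add: F'_def k add.assoc flip: zero_prod_def)
  have "is_lift id (F \<circ> F')"
    using is_lift_comp[OF assms(2) F'] assms(1) by (metis bij_is_surj surj_iff)
  then obtain m :: int where m: "\<And>z. F (F' z) = z + (of_int m, 0)"
    using lift_unique[OF is_lift_id] by (metis comp_apply id_apply)
  have "F 0 = F 0 + (of_int m, 0)" using m[of "F 0"] 1 by simp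
  then have "F (F' z) = z" for z using m[of z] by (simp add: prod_eq_iff)
  then show ?thesis using that F' 1 by blast
qed

lemma lift_degree:
  assumes "is_lift f F"
  obtains d :: int where "\<And>z. F (z + (1, 0)) = F z + (of_int d, 0)"
proof -
  have "is_lift f (\<lambda>z. F (z + (1, 0)))"
    by (rule is_liftI)
      (auto simp: is_lift_apply[OF assms] intro!: continuous_intros continuous_on_compose2[OF is_lift_continuous[OF assms]])
  then show ?thesis using lift_unique[OF assms] that by blast
qed

lemma annulus_homeo_iff:
  "annulus_homeo f \<longleftrightarrow> bij f \<and> continuous_on UNIV f \<and> continuous_on UNIV (inv f)"
proof
  assume "annulus_homeo f"
  then obtain g where g: "homeomorphism UNIV UNIV f g" by (auto simp: annulus_homeo_def)
  then have b: "bij f" unfolding homeomorphism_def by (metis UNIV_I bijI' surjD)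
  moreover have "g = inv f"
    using g unfolding homeomorphism_def by (metis UNIV_I b bij_inv_eq_iff ext)
  ultimately show "bij f \<and> continuous_on UNIV f \<and> continuous_on UNIV (inv f)"
    using g by (auto simp: homeomorphism_def)
next
  assume "bij f \<and> continuous_on UNIV f \<and> continuous_on UNIV (inv f)"
  then show "annulus_homeo f"
    unfolding annulus_homeo_def homeomorphism_def
    by (metis (no_types, lifting) UNIV_I bij_betw_imp_surj bij_imp_bij_inv bij_inv_eq_iff)
qed

lemma annulus_homeo_lift:
  assumes "annulus_homeo f" "is_lift f F"
  obtains F' where "is_lift (inv f) F'" "\<And>z. F (F' z) = z" "\<And>z. F' (F z) = z"
  using assms lift_exists lift_inverse unfolding annulus_homeo_iff by metis

text \<open>The integer by which a lift displaces a full turn is constant along an isotopy.\<close>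

lemma isotopic_to_id_lift_shift:
  assumes "isotopic_to_id f" "is_lift f F"
  shows "F (z + (1, 0)) = F z + (1, 0)"
proof -
  obtain H where H: "continuous_on ({0..1} \<times> UNIV) (\<lambda>(t::real, x). H t x)" "H 0 = id" "H 1 = f"
    using assms(1) by (auto simp: isotopic_to_id_def)
  let ?S = "{0..1::real} \<times> (UNIV :: (real \<times> real) set)"
  have S: "convex ?S" by (intro convex_Times) auto
  have c: "continuous_on ?S (\<lambda>y. (\<lambda>(t, x). H t x) (fst y, annulus_proj (snd y)))"
    by (rule continuous_on_compose2[OF H(1)])
      (auto intro!: continuous_intros continuous_on_compose2[OF continuous_on_annulus_proj])
  obtain q where q: "continuous_on ?S q"
      "\<And>y. y \<in> ?S \<Longrightarrow> to_circle (q y) = fst (H (fst y) (annulus_proj (snd y)))"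
    using circle_lift_exists[of ?S "\<lambda>y. fst ((\<lambda>(t, x). H t x) (fst y, annulus_proj (snd y)))"]
      S continuous_on_fst[OF c] by auto
  let ?D = "\<lambda>y. q (fst y, snd y + (1, 0)) - q y"
  have D: "?D y = ?D y'" if "y \<in> ?S" "y' \<in> ?S" for y y'
  proof (rule integer_valued_imp_constant[of ?S])
    show "continuous_on ?S ?D"
      by (intro continuous_intros q(1) continuous_on_compose2[OF q(1)]) auto
    show "?D y \<in> \<int>" if "y \<in> ?S" for y
    proof -
      have "to_circle (q (fst y, snd y + (1, 0))) = to_circle (q y)"
        using that q(2)[of y] q(2)[of "(fst y, snd y + (1, 0))"] by (auto simp: mem_Times_iff)
      then show ?thesis by (simp add: to_circle_eq_iff)
    qed
  qed (use that S convex_connected in auto)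
  let ?L = "\<lambda>t z. (q (t, z), snd (H t (annulus_proj z)))"
  have L: "is_lift (H t) (?L t)" if "t \<in> {0..1}" for t
  proof (rule is_liftI)
    show "annulus_proj (?L t z) = H t (annulus_proj z)" for z
      using q(2)[of "(t, z)"] that by simp
    have "continuous_on UNIV (\<lambda>z. (\<lambda>y. (\<lambda>(t, x). H t x) (fst y, annulus_proj (snd y))) (t, z))"
      by (rule continuous_on_compose2[OF c]) (use that in \<open>auto intro!: continuous_intros\<close>)
    moreover have "continuous_on UNIV (\<lambda>z. q (t, z))"
      by (rule continuous_on_compose2[OF q(1)]) (use that in \<open>auto intro!: continuous_intros\<close>)
    ultimately show "continuous_on UNIV (?L t)"
      by (auto intro!: continuous_on_Pair continuous_on_snd)
  qed
  obtain k :: int where k: "\<And>z. ?L 0 z = z + (of_int k, 0)"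
    using lift_unique[OF is_lift_id L[of 0, unfolded H(2)]] H(2) by (auto simp del: split_paired_All)
  obtain m :: int where m: "\<And>z. ?L 1 z = F z + (of_int m, 0)"
    using lift_unique[OF assms(2) L[of 1, unfolded H(3)]] H(3) by (auto simp del: split_paired_All)
  obtain d :: int where d: "\<And>z. F (z + (1, 0)) = F z + (of_int d, 0)"
    using lift_degree[OF assms(2)] by blast
  have "q (0, z) = fst z + k" for z using k[of z] by (simp add: prod_eq_iff)
  then have "?D (0, 0) = 1" by simp
  then have "?D (1, 0) = 1" using D[of "(0,0)" "(1,0)"] by simp
  moreover have "q (1, z) = fst (F z) + m" for z using m[of z] by (simp add: prod_eq_iff)
  ultimately have "of_int d = (1::real)" using d[of 0] by simp
  then show ?thesis using d[of z] by simp
qed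

lemma shift_int:
  fixes F :: "real \<times> real \<Rightarrow> real \<times> real"
  assumes "\<And>z. F (z + (1, 0)) = F z + (1, 0)"
  shows "F (z + (of_int k, 0)) = F z + (of_int k, 0)"
proof (induction k rule: int_induct[where k = 0])
  case base then show ?case by (simp flip: zero_prod_def)
next
  case (step1 i)
  have "F (z + (of_int (i + 1), 0)) = F (z + (of_int i, 0) + (1, 0))" by (simp add: add.assoc)
  also have "\<dots> = F z + (of_int i, 0) + (1, 0)" by (simp only: assms step1)
  finally show ?case by (simp add: add.assoc)
next
  case (step2 i)
  have "F (z + (of_int i, 0)) = F (z + (of_int (i - 1), 0) + (1, 0))" by (simp add: add.assoc)
  also have "\<dots> = F (z + (of_int (i - 1), 0)) + (1, 0)" by (simp only: assms)
  finally have "F (z + (of_int (i - 1), 0)) = F z + (of_int i, 0) - (1, 0)" using step2 by simp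
  then show ?case by (simp add: prod_eq_iff)
qed

text \<open>Homeomorphisms of the annulus are constructed from formulas in the plane by this converse of
  \<open>annulus_homeo_lift\<close>.\<close>

lemma descend_homeo:
  fixes F F' :: "real \<times> real \<Rightarrow> real \<times> real"
  assumes "continuous_on UNIV F" "continuous_on UNIV F'"
    and inv: "\<And>z. F (F' z) = z" "\<And>z. F' (F z) = z"
    and sh: "\<And>z. F (z + (1, 0)) = F z + (1, 0)"
  obtains f where "is_lift f F" "is_lift (inv f) F'" "annulus_homeo f"
proof -
  have sh': "F' (z + (1, 0)) = F' z + (1, 0)" for z
    using sh[of "F' z"] inv by metis
  define rep where "rep = (\<lambda>p. SOME z. annulus_proj z = p)"
  have rep: "annulus_proj (rep p) = p" for p
    unfolding rep_def using surj_annulus_proj by (metis (mono_tags, lifting) someI_ex surjD)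
  have ex: "\<exists>k::int. rep (annulus_proj z) = z + (of_int k, 0)" for z
    using rep[of "annulus_proj z"] annulus_proj_eq_iff by metis
  define f where "f = annulus_proj \<circ> F \<circ> rep"
  define f' where "f' = annulus_proj \<circ> F' \<circ> rep"
  have f: "f (annulus_proj z) = annulus_proj (F z)" for z
    unfolding f_def using ex[of z] shift_int[of F, OF sh] by (metis annulus_proj_shift comp_apply)
  have f': "f' (annulus_proj z) = annulus_proj (F' z)" for z
    unfolding f'_def using ex[of z] shift_int[of F', OF sh'] by (metis annulus_proj_shift comp_apply)
  have ff: "f (f' p) = p" "f' (f p) = p" for p
    using f f' inv rep by metis+
  then have b: "bij f" by (metis bijI' )
  have i: "inv f = f'" using ff by (metis inv_equality ext)
  have L: "is_lift f F" "is_lift (inv f) F'"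
    unfolding i by (simp_all add: is_liftI assms f f' del: split_paired_All)
  then have "annulus_homeo f"
    using b is_lift_continuous_imp by (auto simp: annulus_homeo_iff)
  then show ?thesis using that L by blast
qed

section \<open>Area preservation in the plane\<close>

(* Quantifiers over the plane are to stay quantifiers over points. *)
declare split_paired_All [simp del] split_paired_Ex [simp del]

text \<open>The product rule for a factor \<open>B\<close> that may fail to be differentiable. The derivative of a \<open>C\<^sup>1\<close> map is
  such a factor.\<close>

lemma has_derivative_mult_vanishing:
  fixes A B :: "'a::real_normed_vector \<Rightarrow> real"
  assumes A: "(A has_derivative A') (at x)" and "A x = 0" and B: "continuous (at x) B"
  shows "((\<lambda>z. A z * B z) has_derivative (\<lambda>h. A' h * B x)) (at x)"
proof -
  have bl: "bounded_linear A'" and lim: "((\<lambda>h. norm (A (x + h) - A x - A' h) / norm h) \<longlongrightarrow> 0) (at 0)"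
    using A by (auto simp: has_derivative_at)
  obtain K where K: "\<And>h. norm (A' h) \<le> norm h * K" using bounded_linear.bounded[OF bl] by blast
  have Bl: "((\<lambda>h. B (x + h)) \<longlongrightarrow> B x) (at 0)"
    using B by (simp add: isCont_def LIM_offset_zero_iff)
  show ?thesis
    unfolding has_derivative_at
  proof
    show "bounded_linear (\<lambda>h. A' h * B x)" by (rule bounded_linear_mult_const[OF bl])
    let ?g = "\<lambda>h. norm (A (x + h) - A x - A' h) / norm h * \<bar>B (x + h)\<bar> + K * \<bar>B (x + h) - B x\<bar>"
    have "(?g \<longlongrightarrow> 0 * \<bar>B x\<bar> + K * \<bar>B x - B x\<bar>) (at 0)"
      by (intro tendsto_intros lim Bl)
    then have g: "(?g \<longlongrightarrow> 0) (at 0)" by simp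
    show "((\<lambda>h. norm (A (x + h) * B (x + h) - A x * B x - A' h * B x) / norm h) \<longlongrightarrow> 0) (at 0)"
    proof (rule Lim_null_comparison[OF _ g], rule always_eventually, rule allI)
      fix h :: 'a
      show "norm (norm (A (x + h) * B (x + h) - A x * B x - A' h * B x) / norm h) \<le> ?g h"
      proof (cases "h = 0")
        case False
        have eq: "A (x + h) * B (x + h) - A x * B x - A' h * B x
          = (A (x + h) - A x - A' h) * B (x + h) + A' h * (B (x + h) - B x)"
          using assms(2) by (simp add: algebra_simps)
        have "norm (A (x + h) * B (x + h) - A x * B x - A' h * B x)
          \<le> norm (A (x + h) - A x - A' h) * \<bar>B (x + h)\<bar> + norm h * K * \<bar>B (x + h) - B x\<bar>"
          unfolding eq
          by (rule order_trans[OF norm_triangle_ineq])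
             (auto simp: abs_mult intro!: add_mono mult_right_mono K[unfolded real_norm_def])
        then show ?thesis using False by (simp add: field_simps)
      qed (use assms(2) linear_0[OF bounded_linear.linear[OF bl]] in auto)
    qed
  qed
qed

text \<open>Young's theorem, with differentiability of the two partial derivatives assumed at one
  point only.\<close>

lemma mixed_partials_eq:
  fixes T p q :: "real \<Rightarrow> real \<Rightarrow> real"
  assumes p: "\<And>x y. ((\<lambda>x. T x y) has_real_derivative p x y) (at x)"
    and q: "\<And>x y. (T x has_real_derivative q x y) (at y)"
    and dp: "((\<lambda>z. p (fst z) (snd z)) has_derivative dp) (at (x0, y0))"
    and dq: "((\<lambda>z. q (fst z) (snd z)) has_derivative dq) (at (x0, y0))"
  shows "dp (0, 1) = dq (1, 0)"
proof (rule ccontr)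
  assume ne: "dp (0, 1) \<noteq> dq (1, 0)"
  define e where "e = \<bar>dp (0, 1) - dq (1, 0)\<bar> / 16"
  have e: "e > 0" using ne by (simp add: e_def)
  interpret dp: bounded_linear dp using dp by (rule has_derivative_bounded_linear)
  interpret dq: bounded_linear dq using dq by (rule has_derivative_bounded_linear)
  obtain d1 where d1: "d1 > 0" "\<And>z. norm (z - (x0, y0)) < d1 \<Longrightarrow>
      \<bar>p (fst z) (snd z) - p x0 y0 - dp (z - (x0, y0))\<bar> \<le> e * norm (z - (x0, y0))"
    using dp e unfolding has_derivative_at_alt by fastforce
  obtain d2 where d2: "d2 > 0" "\<And>z. norm (z - (x0, y0)) < d2 \<Longrightarrow>
      \<bar>q (fst z) (snd z) - q x0 y0 - dq (z - (x0, y0))\<bar> \<le> e * norm (z - (x0, y0))"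
    using dq e unfolding has_derivative_at_alt by fastforce
  define h where "h = min d1 d2 / 4"
  have h: "h > 0" "2 * h < d1" "2 * h < d2" using d1 d2 by (auto simp: h_def)
  have nrm: "norm ((a, b) :: real \<times> real) \<le> 2 * h" if "\<bar>a\<bar> \<le> h" "\<bar>b\<bar> \<le> h" for a b
    using norm_Pair_le[of a b] that by simp
  let ?D = "T (x0 + h) (y0 + h) - T (x0 + h) y0 - T x0 (y0 + h) + T x0 y0"
  have 1: "\<bar>?D - h * (h * dp (0, 1))\<bar> \<le> h * (4 * h * e)"
  proof -
    have "\<exists>z>x0. z < x0 + h \<and> (T (x0 + h) (y0 + h) - T (x0 + h) y0) - (T x0 (y0 + h) - T x0 y0)
        = (x0 + h - x0) * (p z (y0 + h) - p z y0)"
      by (rule MVT2) (use h in \<open>auto intro!: derivative_intros p\<close>)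
    then obtain z where z: "x0 < z" "z < x0 + h" "?D = h * (p z (y0 + h) - p z y0)" by auto
    have a: "\<bar>p z (y0 + h) - p x0 y0 - dp (z - x0, h)\<bar> \<le> e * (2 * h)"
      using d1(2)[of "(z, y0 + h)"] nrm[of "z - x0" h] z h e
      by (auto intro!: order_trans[OF _ mult_left_mono[of "norm (z - x0, h)" "2 * h" e]])
    have b: "\<bar>p z y0 - p x0 y0 - dp (z - x0, 0)\<bar> \<le> e * (2 * h)"
      using d1(2)[of "(z, y0)"] nrm[of "z - x0" 0] z h e
      by (auto intro!: order_trans[OF _ mult_left_mono[of "norm (z - x0, 0)" "2 * h" e]])
    have c: "dp (z - x0, h) = dp (z - x0, 0) + h * dp (0, 1)"
      using dp.add[of "(z - x0, 0)" "(0, h)"] dp.scaleR[of h "(0, 1)"] by simp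
    have "\<bar>p z (y0 + h) - p z y0 - h * dp (0, 1)\<bar> \<le> 4 * h * e" using a b c by argo
    then show ?thesis using h unfolding z(3)
      by (simp flip: right_diff_distrib add: abs_mult)
  qed
  have 2: "\<bar>?D - h * (h * dq (1, 0))\<bar> \<le> h * (4 * h * e)"
  proof -
    have "\<exists>z>y0. z < y0 + h \<and> (T (x0 + h) (y0 + h) - T x0 (y0 + h)) - (T (x0 + h) y0 - T x0 y0)
        = (y0 + h - y0) * (q (x0 + h) z - q x0 z)"
      by (rule MVT2) (use h in \<open>auto intro!: derivative_intros q\<close>)
    then obtain z where z: "y0 < z" "z < y0 + h" "?D = h * (q (x0 + h) z - q x0 z)" by auto
    have a: "\<bar>q (x0 + h) z - q x0 y0 - dq (h, z - y0)\<bar> \<le> e * (2 * h)"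
      using d2(2)[of "(x0 + h, z)"] nrm[of h "z - y0"] z h e
      by (auto intro!: order_trans[OF _ mult_left_mono[of "norm (h, z - y0)" "2 * h" e]])
    have b: "\<bar>q x0 z - q x0 y0 - dq (0, z - y0)\<bar> \<le> e * (2 * h)"
      using d2(2)[of "(x0, z)"] nrm[of 0 "z - y0"] z h e
      by (auto intro!: order_trans[OF _ mult_left_mono[of "norm (0, z - y0)" "2 * h" e]])
    have c: "dq (h, z - y0) = dq (0, z - y0) + h * dq (1, 0)"
      using dq.add[of "(0, z - y0)" "(h, 0)"] dq.scaleR[of h "(1, 0)"] by simp
    have "\<bar>q (x0 + h) z - q x0 z - h * dq (1, 0)\<bar> \<le> 4 * h * e" using a b c by argo
    then show ?thesis using h unfolding z(3)
      by (simp flip: right_diff_distrib add: abs_mult)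
  qed
  have "\<bar>h * (h * dp (0, 1)) - h * (h * dq (1, 0))\<bar> \<le> 2 * (h * (4 * h * e))" using 1 2 by argo
  then have "\<bar>(h * h) * (dp (0, 1) - dq (1, 0))\<bar> \<le> (h * h) * (8 * e)"
    by (simp add: algebra_simps)
  then have "\<bar>dp (0, 1) - dq (1, 0)\<bar> \<le> 8 * e"
    using h by (simp add: abs_mult)
  then show False using e by (simp add: e_def)
qed

definition C1_symplectic :: "(real \<times> real \<Rightarrow> real \<times> real) \<Rightarrow> (real \<times> real \<Rightarrow> ((real \<times> real) \<Rightarrow>\<^sub>L (real \<times> real))) \<Rightarrow> bool"
  where "C1_symplectic F F' \<longleftrightarrow> (\<forall>z. (F has_derivative blinfun_apply (F' z)) (at z))
    \<and> continuous_on UNIV F' \<and> (\<forall>z. area_form z (F' z (1, 0)) (F' z (0, 1)) = 1)"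

lemma blinfun_plane_apply:
  fixes D :: "(real \<times> real) \<Rightarrow>\<^sub>L 'a::real_normed_vector"
  shows "D (x, y) = x *\<^sub>R D (1, 0) + y *\<^sub>R D (0, 1)"
  using blinfun.add_right[of D "(x, 0)" "(0, y)"] blinfun.scaleR_right[of D x "(1, 0)"]
    blinfun.scaleR_right[of D y "(0, 1)"] by simp

lemma area_form_blinfun:
  fixes D :: "(real \<times> real) \<Rightarrow>\<^sub>L (real \<times> real)"
  shows "area_form z (D u) (D v) = area_form z (D (1, 0)) (D (0, 1)) * area_form z u v"
  using blinfun_plane_apply[of D "fst u" "snd u"] blinfun_plane_apply[of D "fst v" "snd v"]
  by (simp add: area_form_def algebra_simps)

lemma C1_lift:
  assumes "annulus_C1 f" "is_lift f F"
  obtains F' where "\<And>z. (F has_derivative blinfun_apply (F' z)) (at z)" "continuous_on UNIV F'"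
proof -
  obtain F0 where F0: "is_lift f F0" "C1 F0" using assms(1) by (auto simp: annulus_C1_def)
  obtain F' where F': "\<And>z. (F0 has_derivative blinfun_apply (F' z)) (at z)" "continuous_on UNIV F'"
    using F0(2) by (auto simp: C1_def)
  obtain k :: int where "\<And>z. F z = F0 z + (of_int k, 0)" using lift_unique[OF F0(1) assms(2)] by blast
  then have "F = (\<lambda>z. F0 z + (of_int k, 0))" by auto
  then show ?thesis using that F' has_derivative_add_const by metis
qed

lemma symplectic_diffeo_lift:
  assumes "symplectic_diffeo f" "is_lift f F"
  obtains F' where "C1_symplectic F F'"
proof -
  have "annulus_C1 f" using assms(1) by (simp add: symplectic_diffeo_def annulus_C1_diffeo_def)
  then obtain F' where F': "\<And>z. (F has_derivative blinfun_apply (F' z)) (at z)" "continuous_on UNIV F'"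
    using C1_lift assms(2) by blast
  have "frechet_derivative F (at z) = blinfun_apply (F' z)" for z
    using frechet_derivative_at[OF F'(1)] by simp
  then have "area_form (F z) (F' z (1,0)) (F' z (0,1)) = area_form z (1,0) (0,1)" for z
    using assms by (metis symplectic_diffeo_def)
  then have "C1_symplectic F F'"
    using F' by (simp add: C1_symplectic_def area_form_def)
  then show ?thesis using that by blast
qed

text \<open>Taking the exterior derivative of \<open>F\<^sup>* (r d\<theta>) - r d\<theta> = dS\<close> would need second derivatives of \<open>F\<close>.
  To avoid them, fix a point \<open>z0\<close> and replace \<open>S\<close> by \<open>T = S - F\<^sub>2(z0) * F\<^sub>1\<close>: in the partial derivatives
  of \<open>T\<close> those of \<open>F\<^sub>1\<close> are multiplied by \<open>F\<^sub>2 - F\<^sub>2(z0)\<close>, which vanishes at \<open>z0\<close>. So they are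
  differentiable at \<open>z0\<close>, and the symmetry of the second derivative of \<open>T\<close> is the area condition there.\<close>

lemma exact_imp_symplectic_derivative:
  assumes F': "\<And>z. (F has_derivative blinfun_apply (F' z)) (at z)" "continuous_on UNIV F'"
    and S: "\<And>z. (S has_derivative
        (\<lambda>u. liouville_form (F z) (F' z u) - liouville_form z u)) (at z)"
  shows "C1_symplectic F F'"
proof -
  have "area_form z0 (F' z0 (1, 0)) (F' z0 (0, 1)) = 1" for z0
  proof -
    obtain x0 y0 where z0: "z0 = (x0, y0)" by (cases z0)
    let ?s = "snd (F z0)"
    define T where "T = (\<lambda>z. S z - ?s * fst (F z))"
    have fF: "((\<lambda>z. fst (F z)) has_derivative (\<lambda>u. fst (F' z u))) (at z)" for z
      by (intro has_derivative_fst F')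
    have sF: "((\<lambda>z. snd (F z)) has_derivative (\<lambda>u. snd (F' z u))) (at z)" for z
      by (intro has_derivative_snd F')
    have T: "(T has_derivative (\<lambda>u. (snd (F z) - ?s) * fst (F' z u) - snd z * fst u)) (at z)" for z
      unfolding T_def
      by (rule has_derivative_eq_rhs[OF has_derivative_diff[OF S has_derivative_mult_right[OF fF]]])
        (auto simp: liouville_form_def algebra_simps)
    let ?p = "\<lambda>x y. (snd (F (x, y)) - ?s) * fst (F' (x, y) (1, 0)) - y"
    let ?q = "\<lambda>x y. (snd (F (x, y)) - ?s) * fst (F' (x, y) (0, 1))"
    have p: "((\<lambda>x. T (x, y)) has_real_derivative ?p x y) (at x)" for x y
    proof -
      have "((\<lambda>x. T (x, y)) has_derivative
          (\<lambda>h. (\<lambda>u. (snd (F (x, y)) - ?s) * fst (F' (x, y) u) - snd (x, y) * fst u) (h, 0))) (at x)"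
        by (rule has_derivative_compose[OF _ T, where f = "\<lambda>x. (x, y)"])
           (auto intro!: derivative_eq_intros)
      moreover have "(\<lambda>u. (snd (F (x, y)) - ?s) * fst (F' (x, y) u) - snd (x, y) * fst u) (h, 0)
          = ?p x y * h" for h
      proof -
        have "fst (F' (x, y) (h, 0)) = h * fst (F' (x, y) (1, 0))" by (subst blinfun_plane_apply) simp
        then show ?thesis by (simp add: algebra_simps)
      qed
      ultimately show ?thesis unfolding has_field_derivative_def
        by (elim has_derivative_eq_rhs) (auto simp only: fun_eq_iff)
    qed
    have q: "((\<lambda>y. T (x, y)) has_real_derivative ?q x y) (at y)" for x y
    proof -
      have "((\<lambda>y. T (x, y)) has_derivative
          (\<lambda>h. (\<lambda>u. (snd (F (x, y)) - ?s) * fst (F' (x, y) u) - snd (x, y) * fst u) (0, h))) (at y)"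
        by (rule has_derivative_compose[OF _ T, where f = "\<lambda>y. (x, y)"])
           (auto intro!: derivative_eq_intros)
      moreover have "(\<lambda>u. (snd (F (x, y)) - ?s) * fst (F' (x, y) u) - snd (x, y) * fst u) (0, h)
          = ?q x y * h" for h
      proof -
        have "fst (F' (x, y) (0, h)) = h * fst (F' (x, y) (0, 1))" by (subst blinfun_plane_apply) simp
        then show ?thesis by (simp add: algebra_simps)
      qed
      ultimately show ?thesis unfolding has_field_derivative_def
        by (elim has_derivative_eq_rhs) (auto simp only: fun_eq_iff)
    qed
    have cont: "continuous (at z0) (\<lambda>z. fst (F' z u))" for u
      using F'(2) by (auto intro!: continuous_intros simp: continuous_on_eq_continuous_at)
    have v: "((\<lambda>z. (snd (F z) - ?s) * fst (F' z u)) has_derivative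
        (\<lambda>h. snd (F' z0 h) * fst (F' z0 u))) (at z0)" for u
      by (rule has_derivative_mult_vanishing[OF _ _ cont]) (auto intro!: has_derivative_eq_rhs[OF has_derivative_diff[OF sF has_derivative_const]])
    have "((\<lambda>z. (snd (F z) - ?s) * fst (F' z (1,0)) - snd z) has_derivative
        (\<lambda>h. snd (F' z0 h) * fst (F' z0 (1, 0)) - snd h)) (at z0)"
      by (intro derivative_intros v)
    moreover note v[of "(0, 1)"]
    ultimately have "snd (F' z0 (0, 1)) * fst (F' z0 (1, 0)) - snd (0::real, 1::real)
        = snd (F' z0 (1, 0)) * fst (F' z0 (0, 1))"
      using mixed_partials_eq[OF p q, of "(\<lambda>h. snd (F' z0 h) * fst (F' z0 (1, 0)) - snd h)" x0 y0]
      by (simp add: z0)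
    then show ?thesis by (simp add: area_form_def algebra_simps)
  qed
  then show ?thesis using F' by (simp add: C1_symplectic_def)
qed

lemma exact_symplectic_imp_symplectic:
  assumes "exact_symplectic_diffeo f"
  shows "symplectic_diffeo f"
  unfolding symplectic_diffeo_def
proof (intro conjI allI impI)
  show C: "annulus_C1_diffeo f" using assms by (simp add: exact_symplectic_diffeo_def)
  fix F z u v assume F: "is_lift f F"
  obtain F' where F': "\<And>z. (F has_derivative blinfun_apply (F' z)) (at z)" "continuous_on UNIV F'"
    using C1_lift F C by (metis annulus_C1_diffeo_def)
  have fd: "frechet_derivative F (at z) = blinfun_apply (F' z)" for z
    using frechet_derivative_at[OF F'(1)] by simp
  obtain S :: "annulus \<Rightarrow> real" where "\<And>z. ((S \<circ> annulus_proj) has_derivative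
      (\<lambda>u. liouville_form (F z) (F' z u) - liouville_form z u)) (at z)"
    using assms F unfolding exact_symplectic_diffeo_def fd[symmetric] by blast
  then have "C1_symplectic F F'" by (rule exact_imp_symplectic_derivative[OF F'])
  then have "area_form z (F' z u) (F' z v) = area_form z u v"
    using area_form_blinfun[of z "F' z" u v] by (metis C1_symplectic_def mult_1)
  then show "area_form (F z) (frechet_derivative F (at z) u) (frechet_derivative F (at z) v) = area_form z u v"
    by (simp add: fd area_form_def)
qed

lemma exact_symplectic_homeo_imp: "exact_symplectic_homeo \<Phi> \<Longrightarrow> symplectic_homeo \<Phi>"
  unfolding exact_symplectic_homeo_def symplectic_homeo_def
  using exact_symplectic_imp_symplectic by blast

text \<open>The isomorphism with \<open>real^2\<close> along which the change of variables formula, stated there with a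
  determinant, is carried over to the plane of pairs.\<close>

definition plane_vec :: "real \<times> real \<Rightarrow> real^2" where "plane_vec z = vector [fst z, snd z]"
definition vec_plane :: "real^2 \<Rightarrow> real \<times> real" where "vec_plane v = (v $ 1, v $ 2)"

lemma vec_plane_inverse [simp]: "vec_plane (plane_vec z) = z" "plane_vec (vec_plane v) = v"
  by (auto simp: vec_plane_def plane_vec_def vec_eq_iff forall_2)

lemma linear_plane_vec: "linear plane_vec" and linear_vec_plane: "linear vec_plane"
  by (auto intro!: linearI simp: vec_plane_def plane_vec_def vec_eq_iff forall_2)

lemma measure_vec_plane_image:
  assumes "compact S"
  shows "measure lebesgue (vec_plane ` S) = measure lebesgue S"
proof -
  have lin: "bounded_linear vec_plane" using linear_vec_plane by (simp add: linear_conv_bounded_linear)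
  have m: "vec_plane \<in> borel_measurable lborel"
    using linear_continuous_on[OF lin, of UNIV] borel_measurable_continuous_onI by simp
  have "lborel = distr lborel borel vec_plane"
  proof (rule lborel_eqI)
    fix l u :: "real \<times> real" assume lu: "\<And>b. b \<in> Basis \<Longrightarrow> l \<bullet> b \<le> u \<bullet> b"
    have le: "fst l \<le> fst u" "snd l \<le> snd u"
      using lu[of "(1, 0)"] lu[of "(0, 1)"] by (auto simp: Basis_prod_def inner_prod_def)
    have le': "plane_vec l $ i \<le> plane_vec u $ i" for i
      using exhaust_2[of i] le by (auto simp: plane_vec_def)
    have "vec_plane -` box l u = box (plane_vec l) (plane_vec u)"
      by (cases l, cases u) (auto simp: mem_box_cart forall_2 plane_vec_def vec_plane_def mem_box Basis_prod_def)
    then have "emeasure (distr lborel borel vec_plane) (box l u)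
        = emeasure lborel (box (plane_vec l) (plane_vec u))"
      using m by (subst emeasure_distr) auto
    also have "\<dots> = ennreal (\<Prod>b\<in>Basis. (plane_vec u - plane_vec l) \<bullet> b)"
      by (rule emeasure_lborel_box) (use le' in \<open>auto simp: Basis_vec_def inner_axis\<close>)
    also have "(\<Prod>b\<in>Basis. (plane_vec u - plane_vec l) \<bullet> b) = (fst u - fst l) * (snd u - snd l)"
      by (simp add: Basis_vec_def plane_vec_def UNION_singleton_eq_range prod.reindex inj_on_def
         axis_eq_axis inner_axis UNIV_2 cart_eq_inner_axis[symmetric])
    also have "\<dots> = (\<Prod>b\<in>Basis. (u - l) \<bullet> b)"
      by (simp add: Basis_prod_def prod.union_disjoint inner_prod_def)
    finally show "emeasure (distr lborel borel vec_plane) (box l u) = ennreal (\<Prod>b\<in>Basis. (u - l) \<bullet> b)" .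
  qed auto
  have cS: "compact (vec_plane ` S)"
    using assms linear_continuous_on[OF lin] by (intro compact_continuous_image) auto
  have "measure lebesgue (vec_plane ` S) = measure (distr lborel borel vec_plane) (vec_plane ` S)"
    using \<open>lborel = _\<close> cS by (metis borel_compact measure_completion sets_lborel)
  also have "\<dots> = measure lborel (vec_plane -` vec_plane ` S)"
    using m cS by (subst measure_distr) (auto intro: borel_compact)
  also have "vec_plane -` vec_plane ` S = S"
    by (metis inj_on_inverseI inj_vimage_image_eq vec_plane_inverse(2))
  finally show ?thesis using assms by (simp add: borel_compact measure_completion)
qed

lemma measure_C1_symplectic_image:
  assumes F: "C1_symplectic F F'" and inj: "inj_on F S" and S: "compact S"
  shows "measure lebesgue (F ` S) = measure lebesgue S"
proof -
  have bl: "bounded_linear plane_vec" "bounded_linear vec_plane"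
    using linear_plane_vec linear_vec_plane by (auto simp: linear_conv_bounded_linear)
  have cont: "continuous_on UNIV F"
    using F has_derivative_continuous unfolding C1_symplectic_def continuous_on_eq_continuous_at[OF open_UNIV]
    by blast
  let ?S = "plane_vec ` S" and ?G = "plane_vec \<circ> F \<circ> vec_plane"
  let ?D = "\<lambda>v. plane_vec \<circ> F' (vec_plane v) \<circ> vec_plane"
  have cS: "compact ?S" using S linear_continuous_on[OF bl(1)] by (intro compact_continuous_image) auto
  have Gi: "?G ` ?S = plane_vec ` (F ` S)" by (auto simp: image_comp comp_def)
  have cG: "compact (?G ` ?S)"
    unfolding Gi using S cont linear_continuous_on[OF bl(1)]
    by (intro compact_continuous_image) (auto intro: continuous_on_subset)
  have der: "(?G has_derivative ?D v) (at v within ?S)" for v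
  proof -
    have FD: "(F has_derivative blinfun_apply (F' (vec_plane v))) (at (vec_plane v))"
      using F by (simp add: C1_symplectic_def)
    have "((\<lambda>v. F (vec_plane v)) has_derivative (\<lambda>h. F' (vec_plane v) (vec_plane h))) (at v within ?S)"
      by (rule has_derivative_compose[OF bounded_linear_imp_has_derivative[OF bl(2)] FD])
    from has_derivative_compose[OF this bounded_linear_imp_has_derivative[OF bl(1)]]
    show ?thesis by (simp add: comp_def)
  qed
  have dt: "det (matrix (?D v)) = 1" for v
  proof -
    have a: "vec_plane (axis 1 1) = (1, 0)" "vec_plane (axis 2 1) = (0, 1)"
      by (auto simp: vec_plane_def axis_def)
    have "area_form (vec_plane v) (F' (vec_plane v) (1, 0)) (F' (vec_plane v) (0, 1)) = 1"
      using F by (auto simp: C1_symplectic_def)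
    then show ?thesis
      by (simp add: det_2 matrix_def a plane_vec_def area_form_def algebra_simps)
  qed
  have "inj_on ?G ?S"
    using inj by (auto simp: inj_on_def) (metis vec_plane_inverse(1))
  then have "measure lebesgue (?G ` ?S) = integral ?S (\<lambda>x. \<bar>det (matrix (?D x))\<bar>)"
    by (intro measure_differentiable_image_eq der)
      (use cS in \<open>auto simp: dt intro!: lmeasurable_compact fmeasurableD integrable_on_const\<close>)
  also have "\<dots> = measure lebesgue ?S"
    using cS by (simp add: dt lmeasure_integral lmeasurable_compact)
  finally have "measure lebesgue (vec_plane ` ?G ` ?S) = measure lebesgue (vec_plane ` ?S)"
    using measure_vec_plane_image cS cG by simp
  then show ?thesis by (simp add: image_comp comp_def)
qed

section \<open>Symplectic homeomorphisms that preserve horizontal circles\<close>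

lemma measure_plane_box:
  fixes x y a b :: real
  assumes "x \<le> y" "a \<le> b"
  shows "measure lebesgue (cbox (x, a) (y, b)) = (y - x) * (b - a)"
  using assms content_Pair[of x a y b] by (simp add: measure_completion)

text \<open>The approximating images eventually lie in any given open neighbourhood of the limit image, which by
  outer regularity can be chosen with nearly the same measure.\<close>

lemma measure_le_limit_image:
  fixes \<Phi> :: "'a::euclidean_space \<Rightarrow> 'b::euclidean_space"
  assumes K: "compact K" and \<Phi>: "continuous_on K \<Phi>" and lim: "uniform_limit K \<phi> \<Phi> sequentially"
    and cont: "\<And>n. continuous_on K (\<phi> n)" and m: "\<And>n. measure lebesgue (\<phi> n ` K) = v"
  shows "v \<le> measure lebesgue (\<Phi> ` K)"
proof (rule field_le_epsilon)
  fix e :: real assume e: "0 < e"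
  have cK: "compact (\<Phi> ` K)" using K \<Phi> by (rule compact_continuous_image[rotated])
  obtain V where V: "open V" "\<Phi> ` K \<subseteq> V" "V \<in> lmeasurable" "measure lebesgue V < measure lebesgue (\<Phi> ` K) + e"
  proof -
    have S: "\<Phi> ` K \<in> lmeasurable" by (rule lmeasurable_compact[OF cK])
    obtain V where V: "open V" "\<Phi> ` K \<subseteq> V" "V - \<Phi> ` K \<in> lmeasurable"
        "emeasure lebesgue (V - \<Phi> ` K) < ennreal e"
      using sets_lebesgue_outer_open[OF fmeasurableD[OF S] e] by blast
    have eq: "V = \<Phi> ` K \<union> (V - \<Phi> ` K)" using V(2) by blast
    have "measure lebesgue (V - \<Phi> ` K) < e"
      using V(3,4) e by (simp add: emeasure_eq_measure2 ennreal_less_iff)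
    moreover have "measure lebesgue V \<le> measure lebesgue (\<Phi> ` K) + measure lebesgue (V - \<Phi> ` K)"
      by (subst eq, rule measure_Un_le) (use S V(3) in \<open>auto intro: fmeasurableD\<close>)
    moreover have "V \<in> lmeasurable" by (subst eq, intro fmeasurable.Un S V(3))
    ultimately show ?thesis using that V by force
  qed
  obtain d where d: "d > 0" "(\<Union>x\<in>\<Phi> ` K. ball x d) \<subseteq> V"
    using compact_subset_open_imp_ball_epsilon_subset[OF cK V(1,2)] by blast
  obtain n where "\<forall>x\<in>K. dist (\<phi> n x) (\<Phi> x) < d"
    using uniform_limitD[OF lim d(1)] by (auto simp: eventually_sequentially)
  then have "\<phi> n ` K \<subseteq> V" using d(2) by (force simp: dist_commute)
  then have "v \<le> measure lebesgue V"
    using measure_mono_fmeasurable[of "\<phi> n ` K" V lebesgue] V(3) m[of n]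
      compact_continuous_image[OF cont K, of n] by (simp add: fmeasurableD lmeasurable_compact)
  then show "v \<le> measure lebesgue (\<Phi> ` K) + e" using V(4) by simp
qed

text \<open>The image of a smaller box under the limit is connected and stays away from the image of the
  boundary of the larger box; so an approximating embedding of the larger box, whose image meets
  it, covers it.\<close>

lemma limit_image_subset_image:
  fixes \<Phi> :: "'a::euclidean_space \<Rightarrow> 'a"
  assumes sub: "cbox a b \<subseteq> box a' b'" and ne: "box a b \<noteq> {}"
    and \<Phi>: "continuous_on UNIV \<Phi>" "inj \<Phi>"
    and lim: "uniform_limit (cbox a' b') \<phi> \<Phi> sequentially"
    and cont: "\<And>n. continuous_on UNIV (\<phi> n)" and inj: "\<And>n. inj (\<phi> n)"
  shows "\<exists>n. \<Phi> ` cbox a b \<subseteq> \<phi> n ` cbox a' b'"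
proof -
  let ?R = "\<Phi> ` cbox a b" and ?B = "\<Phi> ` (cbox a' b' - box a' b')"
  have cR: "compact ?R" by (intro compact_continuous_image continuous_on_subset[OF \<Phi>(1)]) auto
  have cB: "compact ?B"
    by (intro compact_continuous_image continuous_on_subset[OF \<Phi>(1)] compact_diff) auto
  have "?R \<inter> ?B = {}" using sub injD[OF \<Phi>(2)] by blast
  then obtain d where d: "d > 0" "\<And>x y. x \<in> ?R \<Longrightarrow> y \<in> ?B \<Longrightarrow> d \<le> dist x y"
    using separate_compact_closed[OF cR compact_imp_closed[OF cB]] by blast
  obtain z where z: "z \<in> box a b" using ne by blast
  have "open (\<Phi> ` box a b)"
    by (rule invariance_of_domain_gen) (auto intro: continuous_on_subset[OF \<Phi>(1)] inj_on_subset[OF \<Phi>(2)])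
  then obtain r where r: "r > 0" "ball (\<Phi> z) r \<subseteq> \<Phi> ` box a b"
    using z by (meson imageI open_contains_ball)
  obtain n where n: "\<And>x. x \<in> cbox a' b' \<Longrightarrow> dist (\<phi> n x) (\<Phi> x) < min d r"
    using uniform_limitD[OF lim, of "min d r"] d(1) r(1) unfolding eventually_sequentially
    by (meson min_less_iff_conj order_refl)
  have zz: "z \<in> cbox a b" "z \<in> box a' b'" "z \<in> cbox a' b'"
    using z sub box_subset_cbox by blast+
  have o: "open (\<phi> n ` box a' b')"
    by (rule invariance_of_domain_gen) (auto intro: continuous_on_subset[OF cont] inj_on_subset[OF inj])
  have o': "open (- (\<phi> n ` cbox a' b'))"
    by (intro open_Compl compact_imp_closed compact_continuous_image continuous_on_subset[OF cont]) auto
  have cov: "?R \<subseteq> \<phi> n ` box a' b' \<union> - (\<phi> n ` cbox a' b')"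
  proof
    fix y assume y: "y \<in> ?R"
    show "y \<in> \<phi> n ` box a' b' \<union> - (\<phi> n ` cbox a' b')"
    proof (rule ccontr)
      assume "\<not> ?thesis"
      then obtain x where x: "x \<in> cbox a' b'" "x \<notin> box a' b'" "y = \<phi> n x" by blast
      then have "d \<le> dist y (\<Phi> x)" using d(2)[OF y] by blast
      then show False using n[OF x(1)] x(3) by simp
    qed
  qed
  have "\<phi> n z \<in> ?R" 
  proof -
    have "\<phi> n z \<in> ball (\<Phi> z) r" using n[OF zz(3)] by (simp add: dist_commute)
    then show ?thesis using r(2) box_subset_cbox by blast
  qed
  moreover have "\<phi> n z \<in> \<phi> n ` box a' b'" using zz by blast
  moreover have "connected ?R"
    by (intro connected_continuous_image continuous_on_subset[OF \<Phi>(1)] convex_connected) auto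
  moreover have "\<phi> n ` box a' b' \<inter> - (\<phi> n ` cbox a' b') \<inter> ?R = {}" using box_subset_cbox by blast
  ultimately have "- (\<phi> n ` cbox a' b') \<inter> ?R = {}"
    using connectedD[OF _ o o' _ cov] by blast
  then show ?thesis by blast
qed

lemma measure_limit_image_box:
  fixes \<Phi> :: "real \<times> real \<Rightarrow> real \<times> real"
  assumes \<Phi>: "continuous_on UNIV \<Phi>" "inj \<Phi>"
    and lim: "\<And>K. compact K \<Longrightarrow> uniform_limit K \<phi> \<Phi> sequentially"
    and cont: "\<And>n. continuous_on UNIV (\<phi> n)" and inj: "\<And>n. inj (\<phi> n)"
    and m: "\<And>n K. compact K \<Longrightarrow> measure lebesgue (\<phi> n ` K) = measure lebesgue K"
    and lt: "x < y" "a < b"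
  shows "measure lebesgue (\<Phi> ` cbox (x, a) (y, b)) = (y - x) * (b - a)"
proof (rule antisym)
  let ?Q = "cbox (x, a) (y, b)"
  have mQ: "measure lebesgue ?Q = (y - x) * (b - a)" using measure_plane_box[of x y a b] lt by simp
  have le: "measure lebesgue (\<Phi> ` ?Q) \<le> (y - x + 2 * e) * (b - a + 2 * e)" if e: "e > 0" for e
  proof -
    let ?Q' = "cbox (x - e, a - e) (y + e, b + e)"
    have "?Q \<subseteq> box (x - e, a - e) (y + e, b + e)" "box (x, a) (y, b) \<noteq> {}"
      using e lt by (auto simp: box_ne_empty Basis_prod_def mem_box)
    then obtain n where n: "\<Phi> ` ?Q \<subseteq> \<phi> n ` ?Q'"
      using limit_image_subset_image[OF _ _ \<Phi> lim[OF compact_cbox] cont inj] by meson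
    have "measure lebesgue (\<Phi> ` ?Q) \<le> measure lebesgue (\<phi> n ` ?Q')"
      by (intro measure_mono_fmeasurable n lmeasurable_compact fmeasurableD compact_continuous_image
          continuous_on_subset[OF \<Phi>(1)] continuous_on_subset[OF cont]) auto
    also have "\<dots> = (y + e - (x - e)) * (b + e - (a - e))"
      using e lt measure_plane_box[of "x - e" "y + e" "a - e" "b + e"] by (simp add: m)
    finally show ?thesis by (simp add: algebra_simps)
  qed
  have "((\<lambda>e. (y - x + 2 * e) * (b - a + 2 * e)) \<longlongrightarrow> (y - x + 2 * 0) * (b - a + 2 * 0)) (at_right 0)"
    by (intro tendsto_intros)
  then show "measure lebesgue (\<Phi> ` ?Q) \<le> (y - x) * (b - a)"
    using le by (intro tendsto_lowerbound) (auto simp: eventually_at_right_less eventually_at_filter)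
  show "(y - x) * (b - a) \<le> measure lebesgue (\<Phi> ` ?Q)"
    by (rule measure_le_limit_image[OF _ _ lim])
      (simp_all only: m mQ compact_cbox continuous_on_subset[OF \<Phi>(1)] continuous_on_subset[OF cont] subset_UNIV)
qed

lemma dist_to_circle_eq:
  assumes "\<bar>x - y\<bar> < 1 / 2"
  shows "dist (to_circle x) (to_circle y) = \<bar>x - y\<bar>"
proof -
  have "round (x - y) = 0" using assms by (intro round_unique') auto
  then show ?thesis by transfer (simp)
qed

lemma dist_to_circle_round:
  "dist (to_circle x) (to_circle y) = \<bar>x - y - of_int (round (x - y))\<bar>"
  by transfer simp

text \<open>Normalise the lifts at one point. On a large ball their distance to the limit lift is always close to
  an integer, and by connectedness that integer is \<open>0\<close> on the whole ball.\<close>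

lemma compact_open_limit_lift:
  assumes lim: "compact_open_limit \<phi> \<Phi>" and L: "\<And>n. is_lift (\<phi> n) (G n)" and P: "is_lift \<Phi> \<Psi>"
  obtains F where "\<And>n. is_lift (\<phi> n) (F n)" "\<And>K. compact K \<Longrightarrow> uniform_limit K F \<Psi> sequentially"
proof -
  define F where "F = (\<lambda>n z. G n z + (of_int (round (fst (\<Psi> 0) - fst (G n 0))), 0))"
  have F: "is_lift (\<phi> n) (F n)" for n unfolding F_def by (rule is_lift_shift[OF L])
  have F0: "\<bar>fst (F n 0) - fst (\<Psi> 0)\<bar> = dist (to_circle (fst (F n 0))) (to_circle (fst (\<Psi> 0)))" for n
    unfolding F_def using dist_to_circle_round[of "fst (\<Psi> 0)" "fst (G n 0)"]
    by (simp add: dist_commute algebra_simps abs_minus_commute)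
  have "uniform_limit K F \<Psi> sequentially" if K: "compact K" for K
  proof (rule uniform_limitI)
    fix e :: real assume e: "0 < e"
    obtain R where R: "K \<subseteq> cball 0 R" "R > 0"
      using bounded_subset_ballD[OF compact_imp_bounded[OF K], of 0] by (meson ball_subset_cball subset_trans)
    have "compact (annulus_proj ` cball 0 R)"
      by (intro compact_continuous_image continuous_on_annulus_proj) auto
    then have "\<forall>\<^sub>F n in sequentially. \<forall>p\<in>annulus_proj ` cball 0 R. dist (\<phi> n p) (\<Phi> p) < min e (1 / 4)"
      using lim e unfolding compact_open_limit_def by (intro uniform_limitD) auto
    then show "\<forall>\<^sub>F n in sequentially. \<forall>z\<in>K. dist (F n z) (\<Psi> z) < e"
    proof (rule eventually_mono)
      fix n assume n: "\<forall>p\<in>annulus_proj ` cball 0 R. dist (\<phi> n p) (\<Phi> p) < min e (1 / 4)"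
      have d: "dist (annulus_proj (F n z)) (annulus_proj (\<Psi> z)) < min e (1 / 4)" if "z \<in> cball 0 R" for z
        using n that unfolding is_lift_apply[OF F] is_lift_apply[OF P] by blast
      let ?q = "\<lambda>z. fst (F n z) - fst (\<Psi> z)"
      have dq: "dist (to_circle (fst (F n z))) (to_circle (fst (\<Psi> z))) < 1 / 4" if "z \<in> cball 0 R" for z
        using d[OF that] dist_fst_le[of "annulus_proj (F n z)" "annulus_proj (\<Psi> z)"]
        by (simp add: fst_annulus_proj)
      have nq: "\<bar>?q z\<bar> \<noteq> 1 / 3" if "z \<in> cball 0 R" for z
        using dq[OF that] dist_to_circle_eq[of "fst (F n z)" "fst (\<Psi> z)"] by linarith
      have q0: "\<bar>?q 0\<bar> < 1 / 3" using F0[of n] dq[of 0] R(2) by simp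
      have cont: "continuous_on (cball 0 R) (\<lambda>z. \<bar>?q z\<bar>)"
        by (intro continuous_intros) (auto intro: continuous_on_subset[OF is_lift_continuous[OF F]] continuous_on_subset[OF is_lift_continuous[OF P]])
      have lt: "\<bar>?q z\<bar> < 1 / 3" if z: "z \<in> cball 0 R" for z
      proof (rule ccontr)
        assume "\<not> ?thesis"
        then have "1 / 3 \<in> (\<lambda>z. \<bar>?q z\<bar>) ` cball 0 R"
          using q0 z R(2) connected_continuous_image[OF cont convex_connected[OF convex_cball]]
            connectedD_interval[of "(\<lambda>z. \<bar>?q z\<bar>) ` cball 0 R" "\<bar>?q 0\<bar>" "\<bar>?q z\<bar>" "1 / 3"] by force
        then show False using nq by (metis (no_types, lifting) imageE)
      qed
      show "\<forall>z\<in>K. dist (F n z) (\<Psi> z) < e"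
      proof
        fix z assume "z \<in> K"
        then have z: "z \<in> cball 0 R" using R(1) by blast
        have "dist (F n z) (\<Psi> z) = dist (annulus_proj (F n z)) (annulus_proj (\<Psi> z))"
          using dist_to_circle_eq[of "fst (F n z)" "fst (\<Psi> z)"] lt[OF z]
          by (simp add: dist_prod_def fst_annulus_proj snd_annulus_proj dist_real_def)
        then show "dist (F n z) (\<Psi> z) < e" using d[OF z] by simp
      qed
    qed
  qed
  then show ?thesis using that F by blast
qed

lemma symplectic_diffeo_has_lift:
  assumes "symplectic_diffeo f"
  obtains F where "is_lift f F"
  using assms unfolding symplectic_diffeo_def annulus_C1_diffeo_def annulus_C1_def by blast

lemma symplectic_diffeo_lift_inverse:
  assumes "symplectic_diffeo f" "is_lift f F"
  obtains F' where "is_lift (inv f) F'" "\<And>z. F (F' z) = z" "\<And>z. F' (F z) = z"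
  using assms lift_inverse
  unfolding symplectic_diffeo_def annulus_C1_diffeo_def annulus_C1_def by metis

lemma symplectic_diffeo_measure:
  assumes "symplectic_diffeo f" "is_lift f F" "compact K"
  shows "measure lebesgue (F ` K) = measure lebesgue K"
proof -
  obtain F' where "C1_symplectic F F'" using symplectic_diffeo_lift assms by blast
  moreover have "inj F" using symplectic_diffeo_lift_inverse[OF assms(1,2)] by (metis injI)
  ultimately show ?thesis using measure_C1_symplectic_image assms(3) by (meson inj_on_subset subset_UNIV)
qed

lemma symplectic_homeo_measure_box:
  assumes \<Phi>: "symplectic_homeo \<Phi>" and P: "is_lift \<Phi> \<Psi>" and lt: "x < y" "a < b"
  shows "measure lebesgue (\<Psi> ` cbox (x, a) (y, b)) = (y - x) * (b - a)"
proof -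
  obtain \<phi> where \<phi>: "\<And>n. symplectic_diffeo (\<phi> n)" "compact_open_limit \<phi> \<Phi>"
    using \<Phi> by (auto simp: symplectic_homeo_def)
  have "\<exists>G. is_lift (\<phi> n) G" for n
    using symplectic_diffeo_has_lift[OF \<phi>(1)] by blast
  then obtain G where "\<And>n. is_lift (\<phi> n) (G n)" by metis
  then obtain F where F: "\<And>n. is_lift (\<phi> n) (F n)" "\<And>K. compact K \<Longrightarrow> uniform_limit K F \<Psi> sequentially"
    using compact_open_limit_lift[OF \<phi>(2) _ P] by metis
  have "inj \<Psi>" using annulus_homeo_lift[OF _ P] \<Phi> by (metis injI symplectic_homeo_def)
  moreover have "inj (F n)" for n using symplectic_diffeo_lift_inverse[OF \<phi>(1) F(1)] by (metis injI)
  ultimately show ?thesis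
    using measure_limit_image_box[of \<Psi> F] F is_lift_continuous P lt symplectic_diffeo_measure[OF \<phi>(1) F(1)]
    by blast
qed

lemma strict_mono_lift:
  fixes g :: "real \<Rightarrow> real"
  assumes "continuous_on UNIV g" "inj g" "\<And>x. g (x + 1) = g x + 1"
  shows "strict_mono g"
proof -
  have "strict_mono_on UNIV g \<or> strict_antimono_on UNIV g"
    using injective_eq_monotone_map[of UNIV g] assms(1,2) by auto
  moreover have "\<not> strict_antimono_on UNIV g"
    using assms(3)[of 0] unfolding monotone_on_def
    by (metis UNIV_I add_0 less_add_one order_less_asym zero_less_one)
  ultimately show ?thesis by blast
qed

text \<open>The area over an arc between two nearby circles is preserved, so arcs do not get shorter; as the
  length of the whole circle is fixed, arcs keep their length.\<close>

lemma symplectic_homeo_conjugates_to_rotations: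
  assumes \<Phi>: "symplectic_homeo \<Phi>" and f: "symplectic_diffeo f" "isotopic_to_id f"
    and hor: "\<And>x c. snd ((inv \<Phi> \<circ> f \<circ> \<Phi>) (x, c)) = c"
  obtains \<rho> where "continuous_on UNIV \<rho>"
    "\<And>x c. (inv \<Phi> \<circ> f \<circ> \<Phi>) (x, c) = (x + to_circle (\<rho> c), c)"
proof -
  have hom: "annulus_homeo \<Phi>" using \<Phi> by (simp add: symplectic_homeo_def)
  obtain \<Psi> where \<Psi>: "is_lift \<Phi> \<Psi>"
    using hom lift_exists[of \<Phi>] by (auto simp: annulus_homeo_iff)
  obtain \<Psi>' where \<Psi>': "is_lift (inv \<Phi>) \<Psi>'" "\<And>z. \<Psi> (\<Psi>' z) = z" "\<And>z. \<Psi>' (\<Psi> z) = z"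
    using annulus_homeo_lift[OF hom \<Psi>] by blast
  obtain F where F: "is_lift f F"
    using symplectic_diffeo_has_lift[OF f(1)] by blast
  obtain Fi where "is_lift (inv f) Fi" and Fi: "\<And>z. F (Fi z) = z" "\<And>z. Fi (F z) = z"
    by (rule symplectic_diffeo_lift_inverse[OF f(1) F], rule that)
  note Fsh = isotopic_to_id_lift_shift[OF f(2) F]
  define \<gamma> where "\<gamma> = \<Psi>' \<circ> F \<circ> \<Psi>"
  have \<gamma>: "is_lift (inv \<Phi> \<circ> f \<circ> \<Phi>) \<gamma>"
    unfolding \<gamma>_def by (rule is_lift_comp[OF is_lift_comp[OF \<Psi>'(1) F] \<Psi>])
  obtain d :: int where d: "\<And>z. \<Psi> (z + (1, 0)) = \<Psi> z + (of_int d, 0)" using lift_degree[OF \<Psi>] by blast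
  have sh: "\<gamma> (z + (1, 0)) = \<gamma> z + (1, 0)" for z
    unfolding \<gamma>_def comp_def d shift_int[of F, OF Fsh]
    by (metis d \<Psi>'(2,3))
  have sn: "snd (\<gamma> z) = snd z" for z
    using is_lift_apply[OF \<gamma>, of z] hor[of "to_circle (fst z)" "snd z"]
    by (metis annulus_proj_eq prod.collapse snd_annulus_proj)
  define g where "g = (\<lambda>c x. fst (\<gamma> (x, c)))"
  have \<gamma>g: "\<gamma> (x, c) = (g c x, c)" for x c
    using sn[of "(x, c)"] by (simp add: g_def prod_eq_iff)
  have gcont: "continuous_on UNIV (\<lambda>z. g (snd z) (fst z))"
    using is_lift_continuous[OF \<gamma>] by (simp add: g_def continuous_on_fst)
  have gc: "continuous_on UNIV (g c)" for c
    using continuous_on_compose2[OF gcont, of UNIV "\<lambda>x. (x, c)"] by (simp add: continuous_intros)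
  have ginj: "inj (g c)" for c
  proof (rule injI)
    fix x y assume "g c x = g c y"
    then have "\<gamma> (x, c) = \<gamma> (y, c)" by (simp add: \<gamma>g)
    then show "x = y" unfolding \<gamma>_def comp_def by (metis Fi(2) \<Psi>'(2,3) fst_conv)
  qed
  have g1: "g c (x + 1) = g c x + 1" for c x
    using sh[of "(x, c)"] by (simp add: \<gamma>g)
  have mono: "strict_mono (g c)" for c by (rule strict_mono_lift[OF gc ginj g1])
  \<comment> \<open>A thin box over \<open>[x, y]\<close> is mapped into a slightly wider box over the image of \<open>[x, y]\<close>.\<close>
  have len: "y - x \<le> g c y - g c x" if xy: "x < y" for c x y
  proof (rule field_le_epsilon)
    fix e :: real assume e: "0 < e"
    let ?K = "cbox (x, c) (y, c + 1)"
    have "uniformly_continuous_on ?K (\<lambda>z. g (snd z) (fst z))"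
      by (intro compact_uniformly_continuous continuous_on_subset[OF gcont]) auto
    then obtain \<delta> where \<delta>: "\<delta> > 0" "\<And>z z'. z \<in> ?K \<Longrightarrow> z' \<in> ?K \<Longrightarrow> dist z' z < \<delta>
        \<Longrightarrow> dist (g (snd z') (fst z')) (g (snd z) (fst z)) < e / 2"
      using e unfolding uniformly_continuous_on_def by (meson half_gt_zero)
    define s where "s = min (\<delta> / 2) 1"
    have s: "0 < s" "s < \<delta>" "s \<le> 1" using \<delta>(1) by (auto simp: s_def)
    let ?Q = "cbox (x, c) (y, c + s)" and ?Q' = "cbox (g c x - e / 2, c) (g c y + e / 2, c + s)"
    have "\<gamma> ` ?Q \<subseteq> ?Q'"
    proof (rule image_subsetI)
      fix z assume z: "z \<in> ?Q"
      obtain t \<kappa> where t: "z = (t, \<kappa>)" by (cases z)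
      have tb: "x \<le> t" "t \<le> y" "c \<le> \<kappa>" "\<kappa> \<le> c + s"
        using z by (auto simp: t cbox_Pair_eq)
      have "dist (g \<kappa> t) (g c t) < e / 2"
        using \<delta>(2)[of "(t, c)" "(t, \<kappa>)"] tb s xy by (auto simp: cbox_Pair_eq dist_prod_def dist_real_def)
      moreover have "g c x \<le> g c t" "g c t \<le> g c y"
        using mono[of c] tb by (auto simp: strict_mono_less_eq)
      ultimately have "g c x - e / 2 \<le> g \<kappa> t" "g \<kappa> t \<le> g c y + e / 2"
        unfolding dist_real_def by argo+
      then show "\<gamma> z \<in> ?Q'" using tb unfolding t \<gamma>g cbox_Pair_eq by auto
    qed
    moreover have "F (\<Psi> z) = \<Psi> (\<gamma> z)" for z by (simp add: \<gamma>_def \<Psi>'(2))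
    ultimately have sub: "F ` \<Psi> ` ?Q \<subseteq> \<Psi> ` ?Q'" by blast
    have gxy: "g c x \<le> g c y" using mono[of c] xy by (auto simp: strict_mono_less_eq)
    have comp: "compact (\<Psi> ` ?Q)" "compact (\<Psi> ` ?Q')"
      by (intro compact_continuous_image continuous_on_subset[OF is_lift_continuous[OF \<Psi>]]; auto)+
    have "(y - x) * s = measure lebesgue (F ` \<Psi> ` ?Q)"
      using symplectic_homeo_measure_box[OF \<Phi> \<Psi>, of x y c "c + s"] xy s
      by (simp add: symplectic_diffeo_measure[OF f(1) F comp(1)])
    also have "\<dots> \<le> measure lebesgue (\<Psi> ` ?Q')"
      by (intro measure_mono_fmeasurable sub lmeasurable_compact fmeasurableD comp
          compact_continuous_image[OF continuous_on_subset[OF is_lift_continuous[OF F]]]) auto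
    also have "\<dots> = (g c y - g c x + e) * s"
      using symplectic_homeo_measure_box[OF \<Phi> \<Psi>, of "g c x - e / 2" "g c y + e / 2" c "c + s"] s e gxy
      by (simp add: algebra_simps)
    finally show "y - x \<le> g c y - g c x + e" using s(1) by simp
  qed
  have "g c x - x = g c 0" if "0 \<le> x" "x < 1" for c x
    using len[of 0 x c] len[of x 1 c] g1[of c 0] that by (cases "x = 0") auto
  then have "g c (frac x) = frac x + g c 0" for c x
    using frac_ge_0[of x] frac_lt_1[of x] by (metis add.commute diff_eq_eq)
  then have eq: "(inv \<Phi> \<circ> f \<circ> \<Phi>) (to_circle x, c) = (to_circle x + to_circle (g c 0), c)" for c x
  proof -
    have "to_circle (frac x) = to_circle x" by (simp add: to_circle_eq_iff frac_def)
    moreover have "(inv \<Phi> \<circ> f \<circ> \<Phi>) (to_circle (frac x), c) = annulus_proj (\<gamma> (frac x, c))"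
      using is_lift_apply[OF \<gamma>, of "(frac x, c)"] by simp
    ultimately show ?thesis
      using \<open>g c (frac x) = frac x + g c 0\<close> by (simp add: \<gamma>g to_circle_add)
  qed
  show ?thesis
  proof (rule that[of "\<lambda>c. g c 0"])
    show "continuous_on UNIV (\<lambda>c. g c 0)"
      using continuous_on_compose2[OF gcont, of UNIV "\<lambda>c. (0, c)"] by (simp add: continuous_intros)
    show "(inv \<Phi> \<circ> f \<circ> \<Phi>) (x, c) = (x + to_circle (g c 0), c)" for x c
      using eq surj_to_circle by (metis surjD)
  qed
qed

section \<open>Monotone maps of degree one\<close>

lemma degree_one_int:
  fixes D :: "real \<Rightarrow> real"
  assumes "\<And>x. D (x + 1) = D x + 1"
  shows "D (x + of_int k) = D x + of_int k"
proof (induction k rule: int_induct[where k = 0])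
  case (step1 i) then show ?case using assms[of "x + of_int i"] by (simp add: algebra_simps)
next
  case (step2 i) then show ?case using assms[of "x + of_int i - 1"] by (simp add: algebra_simps)
qed simp

lemma degree_one_surj:
  fixes g :: "real \<Rightarrow> real"
  assumes "continuous_on UNIV g" "\<And>t. g (t + 1) = g t + 1"
  shows "\<exists>t. g t = y"
proof -
  have gi: "g (of_int k) = g 0 + of_int k" for k using degree_one_int[of g 0 k] assms(2) by simp
  have "g (of_int \<lfloor>y - g 0\<rfloor>) \<le> y" "y \<le> g (of_int (\<lfloor>y - g 0\<rfloor> + 1))"
    unfolding gi by linarith+
  then show ?thesis
    using IVT'[of g "of_int \<lfloor>y - g 0\<rfloor>" y "of_int (\<lfloor>y - g 0\<rfloor> + 1)"] continuous_on_subset[OF assms(1)] by auto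
qed

lemma degree_one_inverse:
  fixes H :: "real \<Rightarrow> real"
  assumes H: "continuous_on UNIV H" "strict_mono H" "\<And>x. H (x + 1) = H x + 1"
  obtains Hi where "\<And>y. H (Hi y) = y" "\<And>x. Hi (H x) = x" "continuous_on UNIV Hi" "strict_mono Hi" "\<And>y. Hi (y + 1) = Hi y + 1"
proof -
  obtain Hi where Hi: "\<And>y. H (Hi y) = y" using degree_one_surj[OF H(1,3)] by metis
  have HiH: "Hi (H x) = x" for x using Hi[of "H x"] H(2) by (simp add: strict_mono_eq)
  have "continuous_on (H ` UNIV) Hi"
    by (rule continuous_on_inverse_open[OF open_UNIV H(1)]) (auto simp: HiH)
  moreover have "H ` UNIV = UNIV" using Hi by (metis surj_def)
  ultimately have "continuous_on UNIV Hi" by simp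
  moreover have "strict_mono Hi" by (rule strict_monoI) (metis Hi H(2) strict_mono_less)
  moreover have "Hi (y + 1) = Hi y + 1" for y using HiH[of "Hi y + 1"] by (simp add: H(3) Hi)
  ultimately show ?thesis using that[OF Hi HiH] by blast
qed

lemma periodic_bounded:
  fixes f :: "real \<Rightarrow> real"
  assumes "continuous_on UNIV f" "\<And>t. f (t + 1) = f t"
  obtains m M where "\<And>t. m \<le> f t" "\<And>t. f t \<le> M" "m \<in> range f" "M \<in> range f"
proof -
  have ne: "{0..1::real} \<noteq> {}" by simp
  have cf: "continuous_on {0..1} f" by (rule continuous_on_subset[OF assms(1)]) simp
  obtain x where x: "\<And>t. t \<in> {0..1} \<Longrightarrow> f x \<le> f t"
    using continuous_attains_inf[OF compact_Icc ne cf] by blast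
  obtain y where y: "\<And>t. t \<in> {0..1} \<Longrightarrow> f t \<le> f y"
    using continuous_attains_sup[OF compact_Icc ne cf] by blast
  have fr: "frac t \<in> {0..1}" "f (frac t) = f t" for t
    using frac_ge_0[of t] frac_lt_1[of t] degree_one_int[of "\<lambda>t. f t + t" "frac t" "\<lfloor>t\<rfloor>"] assms(2)
    by (auto simp: frac_def)
  show ?thesis
    by (rule that[of "f x" "f y"]) (use x[OF fr(1)] y[OF fr(1)] in \<open>simp_all add: fr(2)\<close>)
qed

lemma sum_shifted_increments:
  fixes D :: "real \<Rightarrow> real"
  assumes per: "\<And>x. D (x + 1) = D x + 1" and q: "q > 0"
  shows "(\<Sum>k<q. D (x + real k / real q + real m / real q) - D (x + real k / real q)) = real m"
proof (induction m)
  case (Suc m)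
  let ?f = "\<lambda>k. D (x + real k / real q + real m / real q)"
  have "(\<Sum>k<q. D (x + real k / real q + real (Suc m) / real q) - ?f k) = (\<Sum>k<q. ?f (Suc k) - ?f k)"
    by (intro sum.cong refl) (simp add: add_divide_distrib algebra_simps)
  also have "\<dots> = ?f q - ?f 0" by (rule sum_lessThan_telescope)
  also have "\<dots> = 1" using q per[of "x + real m / real q"] by (simp add: algebra_simps)
  finally have "(\<Sum>k<q. D (x + real k / real q + real (Suc m) / real q) - ?f k) = 1" .
  moreover have "(\<Sum>k<q. D (x + real k / real q + real (Suc m) / real q) - D (x + real k / real q))
    = (\<Sum>k<q. D (x + real k / real q + real (Suc m) / real q) - ?f k) + (\<Sum>k<q. ?f k - D (x + real k / real q))"
    unfolding sum.distrib[symmetric] by (intro sum.cong) auto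
  ultimately show ?case using Suc by simp
qed simp

text \<open>As \<open>p\<close> is invertible modulo \<open>q\<close>, the multiples of \<open>p\<close> run through all residues.\<close>

lemma sum_residues_reindex:
  fixes E :: "real \<Rightarrow> real" and p :: int and q :: nat
  assumes per: "\<And>x k. E (x + of_int k) = E x" and q: "q > 0" and cop: "coprime p (int q)"
  shows "(\<Sum>n<q. E (real n * of_int p / real q)) = (\<Sum>k<q. E (real k / real q))"
proof -
  let ?r = "\<lambda>n::nat. nat (int n * p mod int q)"
  have r: "?r n < q" for n using q by (simp add: nat_less_iff)
  have inj: "inj_on ?r {..<q}"
  proof (rule inj_onI)
    fix m n assume mn: "m \<in> {..<q}" "n \<in> {..<q}" "?r m = ?r n"
    moreover have "0 \<le> int m * p mod int q" "0 \<le> int n * p mod int q" using q by simp_all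
    ultimately have "int m * p mod int q = int n * p mod int q"
      by (metis eq_nat_nat_iff)
    then have "int q dvd int m * p - int n * p" by (simp only: mod_eq_dvd_iff)
    then have "int q dvd (int m - int n) * p" by (simp only: left_diff_distrib)
    moreover have "coprime (int q) p" using cop by (rule coprime_imp_coprime) auto
    ultimately have dv: "int q dvd int m - int n" by (simp only: coprime_dvd_mult_left_iff)
    have "\<bar>int m - int n\<bar> < int q" using mn by auto
    then have "int m - int n = 0" using dv by (metis dvd_imp_le_int not_less abs_of_nat)
    then show "m = n" by simp
  qed
  have bij: "bij_betw ?r {..<q} {..<q}"
    using inj r by (intro bij_betw_imageI endo_inj_surj) auto
  have "E (real n * of_int p / real q) = E (real (?r n) / real q)" for n
  proof -
    have "int n * p = int q * (int n * p div int q) + int (?r n)"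
      using q by simp
    then have "of_int (int n * p) = (of_int (int q * (int n * p div int q) + int (?r n)) :: real)"
      by (rule arg_cong)
    then have "real n * of_int p = real q * of_int (int n * p div int q) + real (?r n)"
      by (simp only: of_int_add of_int_mult of_int_of_nat_eq)
    then have "real n * of_int p / real q = real (?r n) / real q + of_int (int n * p div int q)"
      using q by (simp only: add_divide_distrib) simp
    then show ?thesis by (simp only: per)
  qed
  then show ?thesis using sum.reindex_bij_betw[OF bij, of "\<lambda>k. E (real k / real q)"] by simp
qed

text \<open>If the mass of an interval is at most the mass of slightly larger intervals around \<open>q\<close>
  equally spaced translates of it, then averaging over the translates bounds it by its length.\<close>

lemma increment_le_by_averaging:
  fixes D :: "real \<Rightarrow> real" and p :: int and q :: nat
  assumes mono: "mono D" and per: "\<And>x. D (x + 1) = D x + 1"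
    and q: "q > 0" and cop: "coprime p (int q)" and xy: "x \<le> y"
    and le: "\<And>n. n < q \<Longrightarrow> D y - D x \<le>
       D (y + real n * of_int p / real q + 2 / real q) - D (x + real n * of_int p / real q - 2 / real q)"
  shows "D y - D x \<le> y - x + 5 / real q"
proof -
  define E where "E = (\<lambda>u. D (y + u + 2 / real q) - D (x + u - 2 / real q))"
  have Eper: "E (u + of_int k) = E u" for u k
    using degree_one_int[of D, OF per, of "y + u + 2 / real q" k]
      degree_one_int[of D, OF per, of "x + u - 2 / real q" k] by (simp add: E_def algebra_simps)
  \<comment> \<open>Two translates by \<open>2 / q\<close> and one rounding to a multiple of \<open>1 / q\<close> cost at most \<open>5 / q\<close>.\<close>
  define m where "m = nat \<lceil>real q * (y - x)\<rceil> + 4"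
  have m: "y - x + 4 / real q \<le> real m / real q" "real m / real q \<le> y - x + 5 / real q"
  proof -
    have "real q * (y - x) + 4 \<le> real m" "real m \<le> real q * (y - x) + 5"
      using xy q by (auto simp: m_def of_nat_nat ceiling_correct intro: order_trans less_imp_le)
         (use ceiling_correct[of "real q * (y - x)"] in linarith)+
    then show "y - x + 4 / real q \<le> real m / real q" "real m / real q \<le> y - x + 5 / real q"
      using divide_right_mono[of "real q * (y - x) + 4" "real m" "real q"]
        divide_right_mono[of "real m" "real q * (y - x) + 5" "real q"] q
      by (simp_all add: add_divide_distrib)
  qed
  have "real q * (D y - D x) = (\<Sum>n<q. D y - D x)" by simp
  also have "\<dots> \<le> (\<Sum>n<q. E (real n * of_int p / real q))"
    unfolding E_def by (rule sum_mono) (use le in auto)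
  also have "\<dots> = (\<Sum>k<q. E (real k / real q))" by (rule sum_residues_reindex[of E, OF Eper q cop])
  also have "\<dots> \<le> (\<Sum>k<q. D ((x - 2 / real q) + real k / real q + real m / real q) - D ((x - 2 / real q) + real k / real q))"
    unfolding E_def
  proof (intro sum_mono diff_mono)
    fix k
    show "D (y + real k / real q + 2 / real q) \<le> D (x - 2 / real q + real k / real q + real m / real q)"
      using m(1) by (intro monoD[OF mono]) (simp add: field_simps)
    show "D (x - 2 / real q + real k / real q) \<le> D (x + real k / real q - 2 / real q)"
      by (intro monoD[OF mono]) simp
  qed
  also have "\<dots> = real m" by (rule sum_shifted_increments[of D, OF per q])
  finally have "D y - D x \<le> real m / real q" using q by (simp add: field_simps)
  then show ?thesis using m(2) by simp
qed

text \<open>The missing lower bound on \<open>[x, y]\<close> is the upper bound on the complementary interval \<open>[y, x + k]\<close>.\<close>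

lemma increment_near_length:
  fixes D :: "real \<Rightarrow> real"
  assumes per: "\<And>x. D (x + 1) = D x + 1"
    and le: "\<And>x y. x \<le> y \<Longrightarrow> D y - D x \<le> y - x + e"
  shows "\<bar>D y - D x - (y - x)\<bar> \<le> e"
proof -
  have *: "\<bar>D y - D x - (y - x)\<bar> \<le> e" if xy: "x \<le> y" for x y
  proof -
    define k where "k = \<lceil>y - x\<rceil>"
    have k: "y \<le> x + of_int k" using le_of_int_ceiling[of "y - x"] unfolding k_def by linarith
    have "D (x + of_int k) - D y \<le> x + of_int k - y + e" by (rule le[OF k])
    then show ?thesis using degree_one_int[of D, OF per, of x k] le[OF xy] by auto
  qed
  show ?thesis
  proof (cases "x \<le> y")
    case False then show ?thesis using *[of y x] by (simp add: abs_minus_commute algebra_simps)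
  qed (use * in auto)
qed

text \<open>\<open>D x\<close> and \<open>x\<close> are both determined by the number of steps that the orbit of \<open>0\<close> takes to pass \<open>x\<close>, once
  by exact steps of length \<open>a\<close> and once by steps of length about \<open>\<tau>\<close>; comparing long orbits shows that
  \<open>a\<close> is about \<open>\<tau>\<close>.\<close>

lemma semiconjugacy_near_identity:
  fixes D \<Gamma> :: "real \<Rightarrow> real"
  assumes mono: "mono D" and per: "\<And>x. D (x + 1) = D x + 1" and D0: "D 0 = 0"
    and conj: "\<And>x. D (\<Gamma> x) = D x + a"
    and \<Gamma>: "\<And>x. \<bar>\<Gamma> x - x - \<tau>\<bar> \<le> \<epsilon> * \<tau>" and \<tau>: "0 < \<tau>" and \<epsilon>: "0 < \<epsilon>" "\<epsilon> \<le> 1 / 2"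
  shows "\<bar>D x - x\<bar> \<le> 4 * \<epsilon> + 2 * \<tau>"
proof -
  have pos: "(1 - \<epsilon>) * \<tau> > 0" using \<tau> \<epsilon> by simp
  define z where "z = (\<lambda>n. (\<Gamma> ^^ n) 0)"
  have Dz: "D (z n) = real n * a" for n
    by (induction n) (auto simp: z_def conj D0 algebra_simps)
  have z: "real n * ((1 - \<epsilon>) * \<tau>) \<le> z n \<and> z n \<le> real n * ((1 + \<epsilon>) * \<tau>)" for n
  proof (induction n)
    case (Suc n)
    have "\<bar>z (Suc n) - z n - \<tau>\<bar> \<le> \<epsilon> * \<tau>" using \<Gamma>[of "z n"] by (simp add: z_def)
    then show ?case using Suc by (auto simp: algebra_simps abs_le_iff)
  qed (simp add: z_def)
  have near: "\<bar>D x - x\<bar> \<le> 1" for x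
  proof -
    have f: "D (frac x) = D x - of_int \<lfloor>x\<rfloor>" "frac x = x - of_int \<lfloor>x\<rfloor>"
      using degree_one_int[of D, OF per, of "frac x" "\<lfloor>x\<rfloor>"] by (auto simp: frac_def)
    have "0 \<le> D (frac x)" "D (frac x) \<le> 1"
      using monoD[OF mono, of 0 "frac x"] monoD[OF mono, of "frac x" 1] D0 per[of 0]
        frac_ge_0[of x] frac_lt_1[of x] by auto
    then show ?thesis using f frac_ge_0[of x] frac_lt_1[of x] by linarith
  qed
  have a: "(1 - \<epsilon>) * \<tau> \<le> a" "a \<le> (1 + \<epsilon>) * \<tau>"
  proof -
    have n: "real n * (((1 - \<epsilon>) * \<tau>) - a) \<le> 1" "real n * (a - ((1 + \<epsilon>) * \<tau>)) \<le> 1" for n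
      using near[of "z n"] z[of n] Dz[of n] by (auto simp: algebra_simps abs_le_iff)
    show "(1 - \<epsilon>) * \<tau> \<le> a"
    proof (rule ccontr)
      assume "\<not> ?thesis"
      then obtain n where "1 < real n * (((1 - \<epsilon>) * \<tau>) - a)"
        using reals_Archimedean3[of "((1 - \<epsilon>) * \<tau>) - a"] by auto
      then show False using n(1)[of n] by simp
    qed
    show "a \<le> (1 + \<epsilon>) * \<tau>"
    proof (rule ccontr)
      assume "\<not> ?thesis"
      then obtain n where "1 < real n * (a - ((1 + \<epsilon>) * \<tau>))"
        using reals_Archimedean3[of "a - ((1 + \<epsilon>) * \<tau>)"] by auto
      then show False using n(2)[of n] by simp
    qed
  qed
  have main: "\<bar>D x - x\<bar> \<le> 4 * \<epsilon> + 2 * \<tau>" if x: "0 \<le> x" "x < 1" for x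
  proof -
    obtain N where "x < real N * ((1 - \<epsilon>) * \<tau>)" using reals_Archimedean3[OF pos] by blast
    then have ex: "x < z N" using z[of N] by linarith
    define n where "n = (LEAST n. x < z n)"
    have n: "x < z n" unfolding n_def by (rule LeastI[of _ N]) (rule ex)
    have "z 0 = 0" by (simp add: z_def)
    then have "n \<noteq> 0" using n x by (metis not_less)
    then obtain m where m: "n = Suc m" using not0_implies_Suc by blast
    then have zm: "z m \<le> x" using not_less_Least[of m "\<lambda>n. x < z n"] by (auto simp: n_def)
    have Dx: "real m * a \<le> D x" "D x \<le> real (Suc m) * a"
      using monoD[OF mono zm] monoD[OF mono less_imp_le[OF n]] Dz[of m] Dz[of "Suc m"] m by auto
    have xl: "real m * ((1 - \<epsilon>) * \<tau>) \<le> x" "x \<le> real (Suc m) * ((1 + \<epsilon>) * \<tau>)"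
      using z[of m] z[of n] n zm m by auto
    have mt: "real m * \<tau> \<le> 2"
    proof -
      have "real m * \<tau> * (1 / 2) \<le> real m * \<tau> * (1 - \<epsilon>)" using \<epsilon> \<tau> by (intro mult_left_mono) auto
      then show ?thesis using xl(1) x by (simp add: algebra_simps)
    qed
    have me: "real m * \<tau> * \<epsilon> \<le> 2 * \<epsilon>" using mt \<epsilon> by (intro mult_right_mono) auto
    have te: "\<tau> * \<epsilon> \<le> \<tau>" using \<tau> \<epsilon> by (simp add: mult_left_le)
    have "real m * ((1 - \<epsilon>) * \<tau>) \<le> real m * a" by (intro mult_left_mono a) auto
    moreover have "real (Suc m) * a \<le> real (Suc m) * ((1 + \<epsilon>) * \<tau>)" by (intro mult_left_mono a) auto
    ultimately have "D x \<le> real (Suc m) * ((1 + \<epsilon>) * \<tau>)" "real m * ((1 - \<epsilon>) * \<tau>) \<le> D x"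
      using Dx by linarith+
    then show ?thesis using xl me te by (simp add: algebra_simps abs_le_iff)
  qed
  have "D (frac x) - frac x = D x - x"
    using degree_one_int[of D, OF per, of "frac x" "\<lfloor>x\<rfloor>"] by (auto simp: frac_def)
  then show ?thesis using main[of "frac x"] frac_ge_0[of x] frac_lt_1[of x] by simp
qed

text \<open>The difference form of \<open>X dX \<le> Y dY\<close>, summed along a chain of \<open>M\<close> steps in which \<open>X + Y\<close> has equal
  increments. The chain trades the error \<open>\<epsilon>\<close>, made \<open>M\<close> times, against the squares of the increments,
  which contribute \<open>1 / M\<close>.\<close>

lemma integrate_product_increments:
  fixes X Y :: "real \<Rightarrow> real"
  assumes k: "0 < k" and XY0: "X 0 = 0" "Y 0 = 0"
    and cont: "continuous_on {0..k} X" "continuous_on {0..k} Y"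
    and mono: "\<And>a b. 0 \<le> a \<Longrightarrow> a < b \<Longrightarrow> b \<le> k \<Longrightarrow> X a < X b \<and> Y a < Y b"
    and inc: "\<And>a b. 0 \<le> a \<Longrightarrow> a < b \<Longrightarrow> b \<le> k \<Longrightarrow>
       X a * (X b - X a) - Y b * (Y b - Y a) \<le> \<epsilon> * (X b + Y b)\<^sup>2"
    and \<epsilon>: "0 \<le> \<epsilon>" and M: "0 < M"
  shows "X k - Y k \<le> (2 * real M * \<epsilon> + 1 / real M) * (X k + Y k)"
proof -
  define Z where "Z = X k + Y k"
  have Z: "0 < Z" using mono[of 0 k] XY0 k by (simp add: Z_def)
  have mono': "a < b" if "X a + Y a < X b + Y b" "0 \<le> a" "0 \<le> b" "a \<le> k" "b \<le> k" for a b
    using mono[of b a] that by (cases a b rule: linorder_cases) auto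
  have "\<exists>\<kappa>. 0 \<le> \<kappa> \<and> \<kappa> \<le> k \<and> X \<kappa> + Y \<kappa> = real j * Z / real M" if "j \<le> M" for j
  proof (rule IVT')
    show "X 0 + Y 0 \<le> real j * Z / real M" using XY0 Z by simp
    have "real j * Z \<le> Z * real M" using that Z by simp
    then show "real j * Z / real M \<le> X k + Y k" using M by (simp add: Z_def[symmetric] divide_le_eq)
  qed (use k cont in \<open>auto intro: continuous_intros\<close>)
  then obtain \<kappa> where \<kappa>: "\<And>j. j \<le> M \<Longrightarrow> 0 \<le> \<kappa> j \<and> \<kappa> j \<le> k \<and> X (\<kappa> j) + Y (\<kappa> j) = real j * Z / real M"
    by metis
  let ?e = "2 * \<epsilon> * Z\<^sup>2 + (Z / real M)\<^sup>2"
  have "(X (\<kappa> j))\<^sup>2 - (Y (\<kappa> j))\<^sup>2 \<le> real j * ?e" if "j \<le> M" for j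
    using that
  proof (induction j)
    case 0
    have "\<kappa> 0 = 0" using mono[of 0 "\<kappa> 0"] \<kappa>[of 0] XY0 by (cases "\<kappa> 0 = 0") auto
    then show ?case using XY0 by simp
  next
    case (Suc j)
    let ?a = "\<kappa> j" and ?b = "\<kappa> (Suc j)"
    have jM: "j \<le> M" using Suc by simp
    have d: "X ?b + Y ?b - (X ?a + Y ?a) = Z / real M"
      using \<kappa>[OF jM] \<kappa>[OF Suc.prems] by (simp add: add_divide_distrib algebra_simps)
    have ab: "?a < ?b"
    proof (rule mono')
      have "0 < Z / real M" using Z M by simp
      then show "X ?a + Y ?a < X ?b + Y ?b" using d by linarith
    qed (use \<kappa>[OF jM] \<kappa>[OF Suc.prems] in auto)
    have m: "X ?a < X ?b" "Y ?a < Y ?b" using mono[OF _ ab] \<kappa>[OF jM] \<kappa>[OF Suc.prems] by auto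
    have bZ: "0 \<le> X ?b + Y ?b" "X ?b + Y ?b \<le> Z"
    proof -
      show "0 \<le> X ?b + Y ?b" using \<kappa>[OF Suc.prems] Z by simp
      have "real (Suc j) * Z \<le> Z * real M" using Suc.prems Z by (simp add: mult.commute)
      then show "X ?b + Y ?b \<le> Z" using \<kappa>[OF Suc.prems] M by (simp add: divide_le_eq)
    qed
    have "X ?a * (X ?b - X ?a) - Y ?b * (Y ?b - Y ?a) \<le> \<epsilon> * (X ?b + Y ?b)\<^sup>2"
      using inc[OF _ ab] \<kappa>[OF jM] \<kappa>[OF Suc.prems] by auto
    also have "\<dots> \<le> \<epsilon> * Z\<^sup>2" using \<epsilon> bZ by (intro mult_left_mono power_mono) auto
    finally have i: "X ?a * (X ?b - X ?a) - Y ?b * (Y ?b - Y ?a) \<le> \<epsilon> * Z\<^sup>2" .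
    have "(X ?b - X ?a)\<^sup>2 + (Y ?b - Y ?a)\<^sup>2 \<le> ((X ?b - X ?a) + (Y ?b - Y ?a))\<^sup>2"
      using m by (simp add: power2_sum)
    also have "\<dots> = (Z / real M)\<^sup>2" using d by (simp add: algebra_simps)
    finally have sq: "(X ?b - X ?a)\<^sup>2 + (Y ?b - Y ?a)\<^sup>2 \<le> (Z / real M)\<^sup>2" .
    have "(X ?b)\<^sup>2 - (Y ?b)\<^sup>2 - ((X ?a)\<^sup>2 - (Y ?a)\<^sup>2)
        = 2 * (X ?a * (X ?b - X ?a) - Y ?b * (Y ?b - Y ?a)) + ((X ?b - X ?a)\<^sup>2 + (Y ?b - Y ?a)\<^sup>2)"
      by (simp add: power2_eq_square algebra_simps)
    then have "(X ?b)\<^sup>2 - (Y ?b)\<^sup>2 - ((X ?a)\<^sup>2 - (Y ?a)\<^sup>2) \<le> ?e" using i sq by simp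
    then show ?case using Suc.IH[OF jM] by (simp add: algebra_simps)
  qed
  from this[of M] have *: "(X (\<kappa> M))\<^sup>2 - (Y (\<kappa> M))\<^sup>2 \<le> real M * ?e" by simp
  have "\<kappa> M = k"
    using mono[of "\<kappa> M" k] \<kappa>[of M] M by (cases "\<kappa> M = k") (auto simp: Z_def)
  then have "(X k - Y k) * Z \<le> real M * ?e"
    using * by (simp add: Z_def power2_eq_square algebra_simps)
  also have "real M * ?e = ((2 * real M * \<epsilon> + 1 / real M) * Z) * Z"
    using M by (simp add: power2_eq_square field_simps)
  finally show ?thesis using Z by (simp add: Z_def[symmetric])
qed

section \<open>Invariant foliations on the universal cover\<close>

lemma periodic_uniformly_continuous_strip:
  fixes \<phi> :: "real \<times> real \<Rightarrow> real"
  assumes cont: "continuous_on UNIV \<phi>" and per: "\<And>t c. \<phi> (t + 1, c) = \<phi> (t, c)" and e: "0 < e"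
  obtains d where "0 < d"
    "\<And>s t c' c. \<bar>c\<bar> \<le> M \<Longrightarrow> \<bar>s - t\<bar> < d \<Longrightarrow> \<bar>c' - c\<bar> < d \<Longrightarrow> \<bar>\<phi> (s, c') - \<phi> (t, c)\<bar> < e"
proof -
  have perk: "\<phi> (t + of_int k, c) = \<phi> (t, c)" for t c k
    using degree_one_int[of "\<lambda>t. \<phi> (t, c) + t" t k] by (simp add: per)
  let ?K = "cbox (-1, - M - 1) (2, M + 1)"
  have "uniformly_continuous_on ?K \<phi>"
    by (intro compact_uniformly_continuous continuous_on_subset[OF cont]) auto
  then obtain d where d: "0 < d" "\<And>z z'. z \<in> ?K \<Longrightarrow> z' \<in> ?K \<Longrightarrow> dist z' z < d \<Longrightarrow> dist (\<phi> z') (\<phi> z) < e"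
    using e unfolding uniformly_continuous_on_def by meson
  let ?d = "min (d / 2) 1"
  show ?thesis
  proof (rule that[of ?d])
    show "0 < ?d" using d by simp
    fix s t c' c assume c: "\<bar>c\<bar> \<le> M" and st: "\<bar>s - t\<bar> < ?d" "\<bar>c' - c\<bar> < ?d"
    let ?k = "\<lfloor>t\<rfloor>"
    have fr: "0 \<le> t - of_int ?k" "t - of_int ?k < 1"
      using frac_ge_0[of t] frac_lt_1[of t] by (auto simp: frac_def)
    have "-1 \<le> s - of_int ?k" "s - of_int ?k \<le> 2" "- M - 1 \<le> c'" "c' \<le> M + 1"
      "-1 \<le> t - of_int ?k" "t - of_int ?k \<le> 2" "- M - 1 \<le> c" "c \<le> M + 1"
      using fr st c by linarith+
    then have in_K: "(s - of_int ?k, c') \<in> ?K" "(t - of_int ?k, c) \<in> ?K"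
      unfolding cbox_Pair_eq by simp_all
    have "dist (s - of_int ?k, c') (t - of_int ?k, c) \<le> \<bar>s - t\<bar> + \<bar>c' - c\<bar>"
      by (simp add: dist_prod_def dist_real_def sqrt_sum_squares_le_sum_abs)
    then have "dist (s - of_int ?k, c') (t - of_int ?k, c) < d" using st by linarith
    from d(2)[OF in_K(2,1) this] have "\<bar>\<phi> (s - of_int ?k, c') - \<phi> (t - of_int ?k, c)\<bar> < e"
      by (simp add: dist_real_def)
    then show "\<bar>\<phi> (s, c') - \<phi> (t, c)\<bar> < e"
      using perk[of "s - of_int ?k" ?k c'] perk[of "t - of_int ?k" ?k c] by simp
  qed
qed

lemma periodic_uniformly_continuous:
  fixes \<phi> :: "real \<times> real \<Rightarrow> real"
  assumes "continuous_on UNIV \<phi>" "\<And>t c. \<phi> (t + 1, c) = \<phi> (t, c)" "0 < e"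
  obtains d where "0 < d" "\<And>s t c. \<bar>s - t\<bar> < d \<Longrightarrow> \<bar>c - c0\<bar> < d \<Longrightarrow> \<bar>\<phi> (s, c) - \<phi> (t, c0)\<bar> < e"
  using periodic_uniformly_continuous_strip[OF assms, of "\<bar>c0\<bar>"] by (metis order_refl)

text \<open>One of the two intervals is empty or a point, so this is the antiderivative on the whole line that
  vanishes at \<open>0\<close>.\<close>

definition primitive :: "(real \<Rightarrow> real) \<Rightarrow> real \<Rightarrow> real"
  where "primitive f t = integral {0..t} f - integral {t..0} f"

lemma primitive_0 [simp]: "primitive f 0 = 0"
  by (simp add: primitive_def)

lemma primitive_diff:
  assumes f: "continuous_on UNIV f" and "s \<le> t"
  shows "primitive f t - primitive f s = integral {s..t} f"
proof -
  have z: "integral {a..b} f = 0" if "b \<le> a" for a b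
    using that by (cases "a = b") auto
  have int: "f integrable_on {a..b}" for a b
    by (rule integrable_continuous_real[OF continuous_on_subset[OF f]]) simp
  note I = Henstock_Kurzweil_Integration.integral_combine[OF _ _ int]
  consider "0 \<le> s" | "s \<le> 0" "0 \<le> t" | "t \<le> 0" using assms by linarith
  then show ?thesis
  proof cases
    case 1 then show ?thesis using I[of 0 s t] assms z[of 0 s] z[of 0 t] by (simp add: primitive_def)
  next
    case 2 then show ?thesis using I[of s 0 t] z[of s 0] z[of 0 t] by (simp add: primitive_def)
  next
    case 3 then show ?thesis using I[of s t 0] assms z[of t 0] z[of s 0] by (simp add: primitive_def)
  qed
qed

lemma primitive_deriv:
  assumes f: "continuous_on UNIV f"
  shows "(primitive f has_real_derivative f t) (at t)"
proof -
  have "((\<lambda>u. integral {t - 1..u} f) has_real_derivative f t) (at t within {t - 1..t + 1})"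
    by (rule integral_has_real_derivative) (auto intro: continuous_on_subset[OF f])
  then have "((\<lambda>u. integral {t - 1..u} f) has_real_derivative f t) (at t)"
    by (simp add: at_within_Icc_at)
  then have "((\<lambda>u. integral {t - 1..u} f + primitive f (t - 1)) has_real_derivative f t) (at t)"
    by (auto intro!: derivative_eq_intros)
  then show ?thesis
  proof (rule has_field_derivative_transform_within_open[of _ _ _ "{t - 1<..}"])
    fix u assume "u \<in> {t - 1<..}"
    then show "integral {t - 1..u} f + primitive f (t - 1) = primitive f u"
      using primitive_diff[OF f, of "t - 1" u] by simp
  qed auto
qed

lemma primitive_periodic:
  assumes f: "continuous_on UNIV f" and per: "\<And>t. f (t + 1) = f t"
  shows "primitive f (t + 1) = primitive f t + integral {0..1} f"
proof -
  have "\<exists>k. \<forall>t\<in>UNIV. primitive f (t + 1) - primitive f t = k"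
  proof (rule has_derivative_zero_constant)
    fix t :: real
    have "((\<lambda>t. primitive f (t + 1) - primitive f t) has_real_derivative f (t + 1) - f t) (at t)"
      using DERIV_shift[of "primitive f" "f (t + 1)" t 1] primitive_deriv[OF f]
      by (intro DERIV_diff) auto
    then show "((\<lambda>t. primitive f (t + 1) - primitive f t) has_derivative (\<lambda>h. 0)) (at t within UNIV)"
      by (simp add: per has_field_derivative_def lambda_zero)
  qed auto
  then obtain k where k: "\<And>t. primitive f (t + 1) - primitive f t = k" by blast
  have "k = integral {0..1} f" using k[of 0] primitive_diff[OF f, of 0 1] by simp
  then show ?thesis using k[of t] by simp
qed

locale leaf_family =
  fixes e :: "real \<Rightarrow> real \<Rightarrow> real"
  assumes e_cont: "continuous_on UNIV (\<lambda>z::real \<times> real. e (snd z) (fst z))"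
    and e_less: "c1 < c2 \<Longrightarrow> e c1 t < e c2 t"
    and e_per: "e c (t + 1) = e c t"
    and e_mean: "integral {0..1} (e c) = c"
begin

definition w :: "real \<Rightarrow> real \<Rightarrow> real"
  where "w t c = primitive (e c) t"

definition v :: "real \<Rightarrow> real \<Rightarrow> real \<Rightarrow> real"
  where "v c1 c2 t = w t c2 - w t c1"

lemma e_cont1: "continuous_on S (e c)"
  using continuous_on_compose2[OF e_cont, of S "\<lambda>t. (t, c)"] by (simp add: continuous_intros)

lemma e_cont2: "continuous_on S (\<lambda>c. e c t)"
  using continuous_on_compose2[OF e_cont, of S "\<lambda>c. (t, c)"] by (simp add: continuous_intros)

lemma w_0 [simp]: "w 0 c = 0"
  by (simp add: w_def)

lemma w_deriv: "((\<lambda>t. w t c) has_real_derivative e c t) (at t)"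
  using primitive_deriv[OF e_cont1] by (simp add: w_def)

lemma w_per: "w (t + 1) c = w t c + c"
  using primitive_periodic[OF e_cont1 e_per] e_mean by (simp add: w_def)

lemma v_0 [simp]: "v c1 c2 0 = 0" by (simp add: v_def)

lemma v_per: "v c1 c2 (t + 1) = v c1 c2 t + (c2 - c1)" by (simp add: v_def w_per)

lemma v_per_int: "v c1 c2 (t + of_int k) = v c1 c2 t + of_int k * (c2 - c1)"
proof (induction k rule: int_induct[where k = 0])
  case (step1 i) then show ?case using v_per[of c1 c2 "t + of_int i"] by (simp add: algebra_simps)
next
  case (step2 i) then show ?case using v_per[of c1 c2 "t + of_int i - 1"] by (simp add: algebra_simps)
qed simp

lemma v_deriv: "(v c1 c2 has_real_derivative e c2 t - e c1 t) (at t)"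
  unfolding v_def[abs_def] by (intro DERIV_diff w_deriv)

lemma v_less: "c1 < c2 \<Longrightarrow> s < t \<Longrightarrow> v c1 c2 s < v c1 c2 t"
  using DERIV_pos_imp_increasing[of s t "v c1 c2"] v_deriv[of c1 c2] e_less[of c1 c2]
  by (meson diff_gt_0_iff_gt)

lemma v_le: "c1 < c2 \<Longrightarrow> s \<le> t \<Longrightarrow> v c1 c2 s \<le> v c1 c2 t"
  using v_less[of c1 c2 s t] by (cases "s = t") auto

end

text \<open>\<open>g c\<close> is the lifted dynamics on the leaf \<open>e c\<close>. The last axiom says that the region between two
  leaves over an interval is mapped, without loss of area, into the region over the image interval.\<close>

locale twist_family = leaf_family e for e +
  fixes g :: "real \<Rightarrow> real \<Rightarrow> real"
  assumes g_cont: "continuous_on UNIV (\<lambda>z::real \<times> real. g (snd z) (fst z))"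
    and g_less: "s < t \<Longrightarrow> g c s < g c t"
    and g_per: "g c (t + 1) = g c t + 1"
    and g_twist: "c1 < c2 \<Longrightarrow> g c1 t < g c2 t"
    and flux: "c1 < c2 \<Longrightarrow> s \<le> t \<Longrightarrow> v c1 c2 t - v c1 c2 s \<le> v c1 c2 (g c2 t) - v c1 c2 (g c1 s)"
begin

lemma g_le: "s \<le> t \<Longrightarrow> g c s \<le> g c t"
  using g_less[of s t c] by (cases "s = t") auto

lemma g_per_int: "g c (t + of_int k) = g c t + of_int k"
  using degree_one_int[of "g c"] g_per by blast

text \<open>The area swept out by a vertical segment between the two leaves, bounded below and above; the
  bounds hold at independent points because the area itself does not depend on the segment.\<close>

lemma flux_bounds:
  assumes "c1 < c2"
  shows "v c1 c2 (g c1 s) - v c1 c2 s \<le> v c1 c2 (g c2 t) - v c1 c2 t"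
proof -
  obtain k :: int where k: "s \<le> t + of_int k"
    using ex_le_of_int[of "s - t"] by (metis diff_le_eq add.commute)
  show ?thesis
    using flux[OF assms k] by (simp add: g_per_int v_per_int)
qed

lemma g_uniform:
  assumes "0 < \<epsilon>"
  obtains d where "0 < d" "\<And>c t. \<bar>c - c0\<bar> < d \<Longrightarrow> \<bar>g c t - g c0 t\<bar> < \<epsilon>"
proof -
  let ?f = "\<lambda>z::real \<times> real. g (snd z) (fst z) - fst z"
  have "continuous_on UNIV ?f" by (intro continuous_intros g_cont)
  then obtain d where "0 < d"
    "\<And>s t c. \<bar>s - t\<bar> < d \<Longrightarrow> \<bar>c - c0\<bar> < d \<Longrightarrow> \<bar>?f (s, c) - ?f (t, c0)\<bar> < \<epsilon>"
    using periodic_uniformly_continuous[of ?f \<epsilon> c0] assms by (auto simp: g_per)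
  then show ?thesis using that[of d] by (metis add_diff_cancel_right' diff_self diff_diff_eq2 abs_zero fst_conv snd_conv diff_add_cancel)
qed

end

text \<open>Dirichlet's theorem provides infinitely many reduced fractions, hence some with a large denominator.\<close>

lemma large_coprime_approximation:
  fixes \<alpha> :: real
  assumes "\<alpha> \<notin> \<rat>"
  obtains p :: int and q :: nat where "N < q" "coprime p (int q)" "\<bar>real q * \<alpha> - of_int p\<bar> < 1 / real q"
proof -
  have inf: "infinite (approx_set \<alpha>)" using assms rational_iff_finite_approx_set by blast
  then obtain h k where hk: "(h, k) \<in> approx_set \<alpha>" "int N < k"
    using infinite_approx_set by blast
  then have k: "0 < k" "coprime h k" "\<bar>\<alpha> - h / k\<bar> < 1 / k\<^sup>2" by (auto simp: approx_set_def)
  show ?thesis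
  proof (rule that[of "nat k" h])
    show "N < nat k" using hk by simp
    show "coprime h (int (nat k))" using k by simp
    have "of_int k * \<bar>\<alpha> - h / k\<bar> < of_int k * (1 / (of_int k)\<^sup>2 :: real)"
      using k by (intro mult_strict_left_mono) auto
    moreover have "of_int k * \<bar>\<alpha> - h / k\<bar> = \<bar>of_int k * \<alpha> - of_int h\<bar>"
      using k by (simp add: abs_mult_pos' right_diff_distrib)
    ultimately show "\<bar>real (nat k) * \<alpha> - of_int h\<bar> < 1 / real (nat k)"
      using k by (simp add: power2_eq_square)
  qed
qed

section \<open>Leaves with irrational rotation number\<close>

text \<open>In the coordinate \<open>x\<close> that conjugates \<open>g c0\<close> to the translation by \<open>\<alpha>\<close>, the normalised area
  between two nearby leaves is an almost invariant measure, so it is almost Lebesgue measure. Both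
  leaves are variable, so the estimate provides the derivative of the area at \<open>c0\<close> and its continuity
  there at once.\<close>

lemma (in twist_family) irrational_leaf:
  assumes H: "continuous_on UNIV H" "strict_mono H" "\<And>x. H (x + 1) = H x + 1"
    and conj: "\<And>x. g c0 (H x) = H (x + \<alpha>)" and irr: "\<alpha> \<notin> \<rat>" and e: "0 < \<epsilon>"
  obtains d where "0 < d" "\<And>c1 c2 x y. c1 < c2 \<Longrightarrow> \<bar>c1 - c0\<bar> < d \<Longrightarrow> \<bar>c2 - c0\<bar> < d \<Longrightarrow>
     \<bar>(v c1 c2 (H y) - v c1 c2 (H x)) / (c2 - c1) - (y - x)\<bar> \<le> \<epsilon>"
proof -
  obtain N :: nat where N: "5 / \<epsilon> < real N" using reals_Archimedean2 by blast
  obtain p q where q: "N < q" "coprime p (int q)" "\<bar>real q * \<alpha> - of_int p\<bar> < 1 / real q"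
    using large_coprime_approximation[OF irr] by blast
  have q0: "0 < q" using q by simp
  have "5 / \<epsilon> < real q" using N q(1) by linarith
  then have q5: "5 / real q \<le> \<epsilon>" using e q0 by (simp add: field_simps)
  \<comment> \<open>An error of \<open>s\<close> in each of at most \<open>q\<close> steps adds up to at most \<open>1 / q\<close>.\<close>
  define s where "s = 1 / (real q)\<^sup>2"
  have s: "0 < s" using q0 by (simp add: s_def)
  have Hint: "H (x + of_int k) = H x + of_int k" for x k
    using degree_one_int[of H] H(3) by blast
  have cs: "continuous_on {0..1} (\<lambda>x. min (H (x + s) - H x) (H x - H (x - s)))"
    by (intro continuous_intros continuous_on_compose2[OF H(1)]) auto
  obtain x0 where x0: "\<And>x. x \<in> {0..1} \<Longrightarrow> min (H (x0 + s) - H x0) (H x0 - H (x0 - s)) \<le> min (H (x + s) - H x) (H x - H (x - s))"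
  proof -
    have "{0..1::real} \<noteq> {}" by simp
    then show ?thesis using continuous_attains_inf[OF compact_Icc _ cs] that by blast
  qed
  \<comment> \<open>Perturbing \<open>g\<close> by less than \<open>\<mu>\<close> changes the coordinate \<open>x\<close> by less than \<open>s\<close>.\<close>
  define \<mu> where "\<mu> = min (H (x0 + s) - H x0) (H x0 - H (x0 - s))"
  have \<mu>: "0 < \<mu>" using H(2) s by (simp add: \<mu>_def strict_mono_less)
  have gap: "H (x - s) \<le> H x - \<mu> \<and> H x + \<mu> \<le> H (x + s)" for x
  proof -
    have "frac x \<in> {0..1}" using frac_ge_0[of x] frac_lt_1[of x] by simp
    from x0[OF this] have "\<mu> \<le> H (frac x + s) - H (frac x)" "\<mu> \<le> H (frac x) - H (frac x - s)"
      by (auto simp: \<mu>_def)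
    moreover have "H (frac x + s) = H (x + s) - of_int \<lfloor>x\<rfloor>" "H (frac x - s) = H (x - s) - of_int \<lfloor>x\<rfloor>"
      "H (frac x) = H x - of_int \<lfloor>x\<rfloor>"
      using Hint[of "frac x + s" "\<lfloor>x\<rfloor>"] Hint[of "frac x - s" "\<lfloor>x\<rfloor>"] Hint[of "frac x" "\<lfloor>x\<rfloor>"]
      by (simp_all add: frac_def algebra_simps)
    ultimately show ?thesis by simp
  qed
  obtain d where d: "0 < d" "\<And>c t. \<bar>c - c0\<bar> < d \<Longrightarrow> \<bar>g c t - g c0 t\<bar> < \<mu>"
    using g_uniform[OF \<mu>] by blast
  have near: "H (x + \<alpha> - s) \<le> g c (H x) \<and> g c (H x) \<le> H (x + \<alpha> + s)" if "\<bar>c - c0\<bar> < d" for c x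
    using d(2)[OF that, of "H x"] gap[of "x + \<alpha>"] by (simp add: conj abs_less_iff)
  show ?thesis
  proof (rule that[OF d(1)])
    fix c1 c2 x y assume c: "c1 < c2" "\<bar>c1 - c0\<bar> < d" "\<bar>c2 - c0\<bar> < d"
    define D where "D = (\<lambda>x. v c1 c2 (H x) / (c2 - c1))"
    have Dmono: "mono D"
      unfolding D_def using c(1) H(2)
      by (intro monoI divide_right_mono v_le) (auto simp: strict_mono_less_eq)
    have Dper: "D (x + 1) = D x + 1" for x
      using c(1) by (simp add: D_def H(3) v_per add_divide_distrib)
    have step: "D y - D x \<le> D (y + \<alpha> + s) - D (x + \<alpha> - s)" if "x \<le> y" for x y
    proof -
      have "v c1 c2 (H y) - v c1 c2 (H x) \<le> v c1 c2 (g c2 (H y)) - v c1 c2 (g c1 (H x))"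
        by (rule flux[OF c(1)]) (use that H(2) in \<open>simp add: strict_mono_less_eq\<close>)
      also have "\<dots> \<le> v c1 c2 (H (y + \<alpha> + s)) - v c1 c2 (H (x + \<alpha> - s))"
        using near[OF c(2), of x] near[OF c(3), of y] by (intro diff_mono v_le c(1)) auto
      finally show ?thesis unfolding D_def diff_divide_distrib[symmetric]
        using c(1) by (intro divide_right_mono) auto
    qed
    have iter: "D y - D x \<le> D (y + real n * \<alpha> + real n * s) - D (x + real n * \<alpha> - real n * s)" if "x \<le> y" for x y n
    proof (induction n)
      case (Suc n)
      have "x + real n * \<alpha> - real n * s \<le> y + real n * \<alpha> + real n * s"
      proof -
        have "0 \<le> real n * s" using s by simp
        then show ?thesis using that by linarith
      qed
      from step[OF this] Suc show ?case by (simp add: algebra_simps)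
    qed simp
    have le: "D y - D x \<le> y - x + 5 / real q" if xy: "x \<le> y" for x y
    proof (rule increment_le_by_averaging[OF Dmono Dper q0 q(2) xy])
      fix n assume n: "n < q"
      have ns: "real n * s \<le> 1 / real q"
        using n q0 by (simp add: s_def power2_eq_square divide_le_eq)
      have "real n * \<bar>\<alpha> - of_int p / real q\<bar> \<le> 1 / real q"
      proof -
        have "real n * \<bar>\<alpha> - of_int p / real q\<bar> \<le> real q * \<bar>\<alpha> - of_int p / real q\<bar>"
          using n by (intro mult_right_mono) auto
        also have "\<dots> = \<bar>real q * \<alpha> - of_int p\<bar>"
          using q0 by (simp add: abs_mult_pos' right_diff_distrib)
        finally show ?thesis using q(3) by simp
      qed
      then have "\<bar>real n * \<alpha> - real n * of_int p / real q\<bar> \<le> 1 / real q"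
        by (simp add: abs_mult_pos' right_diff_distrib)
      then have "y + real n * \<alpha> + real n * s \<le> y + real n * of_int p / real q + 2 / real q"
        "x + real n * of_int p / real q - 2 / real q \<le> x + real n * \<alpha> - real n * s"
        using ns by (auto simp: abs_le_iff)
      then show "D y - D x \<le> D (y + real n * of_int p / real q + 2 / real q) - D (x + real n * of_int p / real q - 2 / real q)"
        using iter[OF xy, of n] monoD[OF Dmono] by (smt (verit))
    qed
    have "\<bar>D y - D x - (y - x)\<bar> \<le> 5 / real q"
      by (rule increment_near_length[OF Dper le])
    then show "\<bar>(v c1 c2 (H y) - v c1 c2 (H x)) / (c2 - c1) - (y - x)\<bar> \<le> \<epsilon>"
      using q5 by (simp add: D_def diff_divide_distrib)
  qed
qed

section \<open>Leaves with rational rotation number\<close>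

text \<open>Here the leaf \<open>c0\<close> consists of fixed points (pass to an iterate). The axiom \<open>shear\<close> is the
  first order expansion of the dynamics at that leaf, and \<open>flat\<close> says that the slopes of nearby leaves
  converge to the slope of the leaf \<open>c0\<close>.\<close>

locale identity_leaf = twist_family e g for e g +
  fixes c0 :: real and b :: "real \<Rightarrow> real"
  assumes g_id: "g c0 t = t"
    and b_cont: "continuous_on UNIV b" and b_pos: "0 < b t" and b_per: "b (t + 1) = b t"
    and shear: "0 < \<epsilon> \<Longrightarrow> \<exists>d>0. \<forall>c t. \<bar>c - c0\<bar> < d \<longrightarrow>
      \<bar>g c t - t - b t * (e c t - e c0 t)\<bar> \<le> \<epsilon> * \<bar>e c t - e c0 t\<bar>"
    and flat: "0 < \<epsilon> \<Longrightarrow> \<exists>d>0. \<forall>c s t. \<bar>c - c0\<bar> < d \<longrightarrow> \<bar>s - t\<bar> < d \<longrightarrow>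
      \<bar>(e c t - e c0 t) - (e c s - e c0 s)\<bar> \<le> \<epsilon> * \<bar>t - s\<bar>"
begin

lemma b_bounds: obtains m M where "0 < m" "m \<le> 1" "1 \<le> M" "\<And>t. m \<le> b t" "\<And>t. b t \<le> M"
proof -
  obtain l u where lu: "\<And>t. l \<le> b t" "\<And>t. b t \<le> u" "l \<in> range b" "u \<in> range b"
    by (rule periodic_bounded[OF b_cont b_per], rule that)
  show ?thesis
  proof (rule that[of "min l 1" "max u 1"])
    show "0 < min l 1" "min l 1 \<le> 1" "1 \<le> max u 1" using lu(3) b_pos by auto
    show "min l 1 \<le> b t" "b t \<le> max u 1" for t using lu(1,2)[of t] by linarith+
  qed
qed

text \<open>The height of the leaf \<open>c0 + \<sigma> * \<kappa>\<close> over the leaf \<open>c0\<close> and the displacement on it, for \<open>\<sigma> = 1\<close>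
  (above) and \<open>\<sigma> = - 1\<close> (below). The sign makes both nonnegative, so that the two sides can be treated
  together.\<close>

definition dl :: "real \<Rightarrow> real \<Rightarrow> real \<Rightarrow> real"
  where "dl \<sigma> \<kappa> t = \<sigma> * (e (c0 + \<sigma> * \<kappa>) t - e c0 t)"

definition dx :: "real \<Rightarrow> real \<Rightarrow> real \<Rightarrow> real"
  where "dx \<sigma> \<kappa> t = \<sigma> * (g (c0 + \<sigma> * \<kappa>) t - t)"

lemma dl_0 [simp]: "dl \<sigma> 0 t = 0" by (simp add: dl_def)

lemma dl_less: "\<sigma> = 1 \<or> \<sigma> = -1 \<Longrightarrow> a < c \<Longrightarrow> dl \<sigma> a t < dl \<sigma> c t"
  using e_less[of "c0 + a" "c0 + c" t] e_less[of "c0 - c" "c0 - a" t] by (auto simp: dl_def)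

lemma dl_cont: "continuous_on S (\<lambda>\<kappa>. dl \<sigma> \<kappa> t)"
  unfolding dl_def by (intro continuous_intros continuous_on_compose2[OF e_cont2[of UNIV]]) auto

lemma dx_ge_0: "\<sigma> = 1 \<or> \<sigma> = -1 \<Longrightarrow> 0 \<le> a \<Longrightarrow> 0 \<le> dx \<sigma> a t"
  using g_twist[of c0 "c0 + a" t] g_twist[of "c0 - a" c0 t] g_id[of t]
  by (cases "a = 0") (auto simp: dx_def)

lemma v_mvt: "\<exists>\<xi>. v c1 c2 y - v c1 c2 x = (y - x) * (e c2 \<xi> - e c1 \<xi>) \<and> \<bar>\<xi> - x\<bar> \<le> \<bar>y - x\<bar>"
proof -
  consider "x < y" | "y < x" | "x = y" by linarith
  then show ?thesis
  proof cases
    case 1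
    obtain z where "x < z" "z < y" "v c1 c2 y - v c1 c2 x = (y - x) * (e c2 z - e c1 z)"
      using MVT2[OF 1 v_deriv[of c1 c2]] by blast
    then show ?thesis by (intro exI[of _ z]) auto
  next
    case 2
    obtain z where "y < z" "z < x" "v c1 c2 x - v c1 c2 y = (x - y) * (e c2 z - e c1 z)"
      using MVT2[OF 2 v_deriv[of c1 c2]] by blast
    then show ?thesis by (intro exI[of _ z]) (auto simp: algebra_simps)
  qed auto
qed

text \<open>\<open>flux_bounds\<close>, with the areas expressed by the mean value theorem as displacement times height. For
  two leaves at a similar distance from \<open>c0\<close> the displacements of both are nearly equal, so little is
  lost; this is why the leaves between \<open>c0\<close> and a given one are visited in a chain of small steps.\<close>

lemma swept_area:
  assumes \<sigma>: "\<sigma> = 1 \<or> \<sigma> = -1" and ac: "0 \<le> a" "a < c"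
  shows "\<exists>\<xi> \<zeta>. dx \<sigma> a s * (dl \<sigma> c \<xi> - dl \<sigma> a \<xi>) \<le> dx \<sigma> c t * (dl \<sigma> c \<zeta> - dl \<sigma> a \<zeta>)
    \<and> \<bar>\<xi> - s\<bar> \<le> dx \<sigma> a s \<and> \<bar>\<zeta> - t\<bar> \<le> dx \<sigma> c t"
proof (cases "\<sigma> = 1")
  case True
  have lt: "c0 + a < c0 + c" using ac by simp
  obtain \<xi> where \<xi>: "v (c0 + a) (c0 + c) (g (c0 + a) s) - v (c0 + a) (c0 + c) s
      = (g (c0 + a) s - s) * (e (c0 + c) \<xi> - e (c0 + a) \<xi>)" "\<bar>\<xi> - s\<bar> \<le> \<bar>g (c0 + a) s - s\<bar>"
    using v_mvt by blast
  obtain \<zeta> where \<zeta>: "v (c0 + a) (c0 + c) (g (c0 + c) t) - v (c0 + a) (c0 + c) t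
      = (g (c0 + c) t - t) * (e (c0 + c) \<zeta> - e (c0 + a) \<zeta>)" "\<bar>\<zeta> - t\<bar> \<le> \<bar>g (c0 + c) t - t\<bar>"
    using v_mvt by blast
  show ?thesis
    using flux_bounds[OF lt, of s t] \<xi> \<zeta> dx_ge_0[OF \<sigma>, of a s] dx_ge_0[OF \<sigma>, of c t] ac True
    by (intro exI[of _ \<xi>] exI[of _ \<zeta>]) (auto simp: dx_def dl_def)
next
  case False
  then have s1: "\<sigma> = -1" using \<sigma> by simp
  have lt: "c0 - c < c0 - a" using ac by simp
  obtain \<xi> where \<xi>: "v (c0 - c) (c0 - a) (g (c0 - a) s) - v (c0 - c) (c0 - a) s
      = (g (c0 - a) s - s) * (e (c0 - a) \<xi> - e (c0 - c) \<xi>)" "\<bar>\<xi> - s\<bar> \<le> \<bar>g (c0 - a) s - s\<bar>"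
    using v_mvt by blast
  obtain \<zeta> where \<zeta>: "v (c0 - c) (c0 - a) (g (c0 - c) t) - v (c0 - c) (c0 - a) t
      = (g (c0 - c) t - t) * (e (c0 - a) \<zeta> - e (c0 - c) \<zeta>)" "\<bar>\<zeta> - t\<bar> \<le> \<bar>g (c0 - c) t - t\<bar>"
    using v_mvt by blast
  show ?thesis
    using flux_bounds[OF lt, of t s] \<xi> \<zeta> dx_ge_0[OF \<sigma>, of a s] dx_ge_0[OF \<sigma>, of c t] ac s1
    by (intro exI[of _ \<xi>] exI[of _ \<zeta>]) (auto simp: dx_def dl_def algebra_simps)
qed

text \<open>By \<open>shear\<close> the displacement is about \<open>b\<close> times the height, and by \<open>flat\<close> the heights at the
  intermediate points of \<open>swept_area\<close> are about those at \<open>s\<close> and \<open>t\<close>. What is left is, up to an error,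
  the difference form of \<open>X dX \<le> Y dY\<close> for the rescaled heights \<open>X = sqrt (b s) * dl \<sigma> \<kappa> s\<close> and
  \<open>Y = sqrt (b t) * dl \<sigma> \<kappa> t\<close> as functions of \<open>\<kappa>\<close>.\<close>

lemma sheared_increment:
  assumes \<sigma>: "\<sigma> = 1 \<or> \<sigma> = -1" and m: "0 < m" "m \<le> 1" "1 \<le> M" "\<And>t. m \<le> b t" "\<And>t. b t \<le> M"
    and \<epsilon>: "0 < \<epsilon>" "\<epsilon> \<le> m"
  obtains \<gamma> where "0 < \<gamma>" "\<And>a c s t. 0 \<le> a \<Longrightarrow> a < c \<Longrightarrow> c < \<gamma> \<Longrightarrow>
    b s * dl \<sigma> a s * (dl \<sigma> c s - dl \<sigma> a s) - b t * dl \<sigma> c t * (dl \<sigma> c t - dl \<sigma> a t)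
      \<le> \<epsilon> * (1 + 8 * M\<^sup>2) * ((dl \<sigma> c s)\<^sup>2 + (dl \<sigma> c t)\<^sup>2)"
proof -
  obtain d1 where d1: "0 < d1" "\<And>c t. \<bar>c - c0\<bar> < d1 \<Longrightarrow>
      \<bar>g c t - t - b t * (e c t - e c0 t)\<bar> \<le> \<epsilon> * \<bar>e c t - e c0 t\<bar>"
    using shear[OF \<epsilon>(1)] by blast
  obtain d2 where d2: "0 < d2" "\<And>c s t. \<bar>c - c0\<bar> < d2 \<Longrightarrow> \<bar>s - t\<bar> < d2 \<Longrightarrow>
      \<bar>(e c t - e c0 t) - (e c s - e c0 s)\<bar> \<le> \<epsilon> * \<bar>t - s\<bar>"
    using flat[OF \<epsilon>(1)] by blast
  obtain d3 where d3: "0 < d3" "\<And>c t. \<bar>c - c0\<bar> < d3 \<Longrightarrow> \<bar>g c t - g c0 t\<bar> < d2"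
    using g_uniform[OF d2(1)] by blast
  have abs\<sigma>: "\<bar>\<sigma> * x\<bar> = \<bar>x\<bar>" for x using \<sigma> by auto
  let ?\<gamma> = "min d1 (min d2 d3)"
  show ?thesis
  proof (rule that[of ?\<gamma>])
    show "0 < ?\<gamma>" using d1 d2 d3 by simp
    fix a c s t assume ac: "0 \<le> a" "a < c" "c < ?\<gamma>"
    have near: "\<bar>c0 + \<sigma> * k - c0\<bar> < d1" "\<bar>c0 + \<sigma> * k - c0\<bar> < d2" "\<bar>c0 + \<sigma> * k - c0\<bar> < d3" if "0 \<le> k" "k \<le> c" for k
      using that ac abs\<sigma>[of k] by auto
    have dlpos: "0 \<le> dl \<sigma> k u" if "0 \<le> k" for k u using dl_less[OF \<sigma>, of 0 k u] that by (cases "k = 0") auto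
    have dxb: "\<bar>dx \<sigma> k u - b u * dl \<sigma> k u\<bar> \<le> \<epsilon> * dl \<sigma> k u" if k: "0 \<le> k" "k \<le> c" for k u
    proof -
      have "dx \<sigma> k u - b u * dl \<sigma> k u = \<sigma> * (g (c0 + \<sigma> * k) u - u - b u * (e (c0 + \<sigma> * k) u - e c0 u))"
        by (simp add: dx_def dl_def algebra_simps)
      then have "\<bar>dx \<sigma> k u - b u * dl \<sigma> k u\<bar> \<le> \<epsilon> * \<bar>e (c0 + \<sigma> * k) u - e c0 u\<bar>"
        using d1(2)[OF near(1)[OF k], of u] by (simp only: abs\<sigma>)
      also have "\<bar>e (c0 + \<sigma> * k) u - e c0 u\<bar> = \<bar>dl \<sigma> k u\<bar>" by (simp only: dl_def abs\<sigma>)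
      finally show ?thesis using dlpos[OF k(1)] by simp
    qed
    have dx2: "dx \<sigma> k u \<le> 2 * M * dl \<sigma> k u" "dx \<sigma> k u < d2" if k: "0 \<le> k" "k \<le> c" for k u
    proof -
      have "dx \<sigma> k u \<le> (b u + \<epsilon>) * dl \<sigma> k u" using dxb[OF k, of u] by (simp add: algebra_simps abs_le_iff)
      also have "\<dots> \<le> (2 * M) * dl \<sigma> k u"
        using m(2,3) m(5)[of u] \<epsilon> dlpos[OF k(1)] by (intro mult_right_mono) auto
      finally show "dx \<sigma> k u \<le> 2 * M * dl \<sigma> k u" .
      have "\<bar>dx \<sigma> k u\<bar> < d2" using d3(2)[OF near(3)[OF k], of u] by (simp add: dx_def abs\<sigma> g_id)
      then show "dx \<sigma> k u < d2" by simp
    qed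
    have fl: "\<bar>dl \<sigma> k u - dl \<sigma> k x\<bar> \<le> \<epsilon> * \<bar>u - x\<bar>" if k: "0 \<le> k" "k \<le> c" and "\<bar>u - x\<bar> < d2" for k u x
    proof -
      have "dl \<sigma> k u - dl \<sigma> k x = \<sigma> * ((e (c0 + \<sigma> * k) u - e c0 u) - (e (c0 + \<sigma> * k) x - e c0 x))"
        by (simp add: dl_def algebra_simps)
      then show ?thesis using d2(2)[OF near(2)[OF k], of x u] that(3) by (simp only: abs\<sigma> abs_minus_commute)
    qed
    let ?\<nu> = "\<lambda>x. dl \<sigma> c x - dl \<sigma> a x"
    obtain \<xi> \<zeta> where z: "dx \<sigma> a s * ?\<nu> \<xi> \<le> dx \<sigma> c t * ?\<nu> \<zeta>" "\<bar>\<xi> - s\<bar> \<le> dx \<sigma> a s" "\<bar>\<zeta> - t\<bar> \<le> dx \<sigma> c t"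
      using swept_area[OF \<sigma> ac(1,2)] by blast
    have c0': "0 \<le> c" "a \<le> c" using ac by auto
    have \<nu>pos: "0 < ?\<nu> x" for x using dl_less[OF \<sigma> ac(2), of x] by simp
    have A: "0 \<le> dl \<sigma> a s" "dl \<sigma> a s \<le> dl \<sigma> c s" "?\<nu> s \<le> dl \<sigma> c s" "0 \<le> dl \<sigma> c t" "?\<nu> t \<le> dl \<sigma> c t"
      using dlpos ac \<nu>pos[of s] by auto
    have \<nu>s: "?\<nu> \<xi> \<ge> ?\<nu> s - 4 * \<epsilon> * M * dl \<sigma> a s"
    proof -
      have l: "\<bar>\<xi> - s\<bar> < d2" using z(2) dx2(2)[OF ac(1) c0'(2), of s] by simp
      have "\<epsilon> * \<bar>\<xi> - s\<bar> \<le> \<epsilon> * (2 * M * dl \<sigma> a s)"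
        using z(2) dx2(1)[OF ac(1) c0'(2), of s] \<epsilon> by (intro mult_left_mono) auto
      then show ?thesis using fl[OF c0'(1) order_refl l] fl[OF ac(1) c0'(2) l] by (simp add: abs_le_iff algebra_simps)
    qed
    have \<nu>t: "?\<nu> \<zeta> \<le> ?\<nu> t + 4 * \<epsilon> * M * dl \<sigma> c t"
    proof -
      have l: "\<bar>\<zeta> - t\<bar> < d2" using z(3) dx2(2)[OF c0'(1) order_refl, of t] by simp
      have "\<epsilon> * \<bar>\<zeta> - t\<bar> \<le> \<epsilon> * (2 * M * dl \<sigma> c t)"
        using z(3) dx2(1)[OF c0'(1) order_refl, of t] \<epsilon> by (intro mult_left_mono) auto
      then show ?thesis using fl[OF c0'(1) order_refl l] fl[OF ac(1) c0'(2) l] by (simp add: abs_le_iff algebra_simps)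
    qed
    have L: "b s * dl \<sigma> a s * ?\<nu> s - \<epsilon> * (1 + 4 * M\<^sup>2) * (dl \<sigma> c s)\<^sup>2 \<le> dx \<sigma> a s * ?\<nu> \<xi>"
    proof -
      have nn: "0 \<le> (b s - \<epsilon>) * dl \<sigma> a s" using m(4)[of s] \<epsilon> A(1) by simp
      have "b s * dl \<sigma> a s * ?\<nu> s - \<epsilon> * (dl \<sigma> a s * ?\<nu> s) - (b s - \<epsilon>) * (4 * \<epsilon> * M) * (dl \<sigma> a s * dl \<sigma> a s)
          = (b s - \<epsilon>) * dl \<sigma> a s * (?\<nu> s - 4 * \<epsilon> * M * dl \<sigma> a s)" by (simp add: algebra_simps)
      also have "\<dots> \<le> (b s - \<epsilon>) * dl \<sigma> a s * ?\<nu> \<xi>" using nn \<nu>s by (rule mult_left_mono[rotated])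
      also have "\<dots> \<le> dx \<sigma> a s * ?\<nu> \<xi>"
        using dxb[OF ac(1) c0'(2), of s] \<nu>pos[of \<xi>] by (intro mult_right_mono) (auto simp: abs_le_iff algebra_simps)
      finally have 1: "b s * dl \<sigma> a s * ?\<nu> s - \<epsilon> * (dl \<sigma> a s * ?\<nu> s) - (b s - \<epsilon>) * (4 * \<epsilon> * M) * (dl \<sigma> a s * dl \<sigma> a s)
          \<le> dx \<sigma> a s * ?\<nu> \<xi>" .
      have 2: "\<epsilon> * (dl \<sigma> a s * ?\<nu> s) \<le> \<epsilon> * (dl \<sigma> c s * dl \<sigma> c s)"
        using A \<epsilon> \<nu>pos[of s] by (intro mult_left_mono mult_mono) auto
      have 3: "(b s - \<epsilon>) * (4 * \<epsilon> * M) * (dl \<sigma> a s * dl \<sigma> a s) \<le> M * (4 * \<epsilon> * M) * (dl \<sigma> c s * dl \<sigma> c s)"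
        using A \<epsilon> m(1,3) m(5)[of s] m(4)[of s] by (intro mult_mono mult_nonneg_nonneg) auto
      show ?thesis using 1 2 3 by (simp add: power2_eq_square algebra_simps)
    qed
    have R: "dx \<sigma> c t * ?\<nu> \<zeta> \<le> b t * dl \<sigma> c t * ?\<nu> t + \<epsilon> * (1 + 8 * M\<^sup>2) * (dl \<sigma> c t)\<^sup>2"
    proof -
      have "dx \<sigma> c t * ?\<nu> \<zeta> \<le> (b t + \<epsilon>) * dl \<sigma> c t * ?\<nu> \<zeta>"
        using dxb[OF c0'(1) order_refl, of t] \<nu>pos[of \<zeta>] by (intro mult_right_mono) (auto simp: abs_le_iff algebra_simps)
      also have "\<dots> \<le> (b t + \<epsilon>) * dl \<sigma> c t * (?\<nu> t + 4 * \<epsilon> * M * dl \<sigma> c t)"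
        using A \<epsilon> b_pos[of t] \<nu>t by (intro mult_left_mono) auto
      also have "\<dots> = b t * dl \<sigma> c t * ?\<nu> t + \<epsilon> * (dl \<sigma> c t * ?\<nu> t) + (b t + \<epsilon>) * (4 * \<epsilon> * M) * (dl \<sigma> c t * dl \<sigma> c t)"
        by (simp add: algebra_simps)
      finally have 1: "dx \<sigma> c t * ?\<nu> \<zeta> \<le> \<dots>" .
      have 2: "\<epsilon> * (dl \<sigma> c t * ?\<nu> t) \<le> \<epsilon> * (dl \<sigma> c t * dl \<sigma> c t)"
        using A \<epsilon> \<nu>pos[of t] by (intro mult_left_mono mult_mono) auto
      have 3: "(b t + \<epsilon>) * (4 * \<epsilon> * M) * (dl \<sigma> c t * dl \<sigma> c t) \<le> (2 * M) * (4 * \<epsilon> * M) * (dl \<sigma> c t * dl \<sigma> c t)"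
        using A \<epsilon> m(1,2,3) m(5)[of t] by (intro mult_right_mono mult_nonneg_nonneg) auto
      show ?thesis using 1 2 3 by (simp add: power2_eq_square algebra_simps)
    qed
    have "\<epsilon> * (1 + 4 * M\<^sup>2) * (dl \<sigma> c s)\<^sup>2 \<le> \<epsilon> * (1 + 8 * M\<^sup>2) * (dl \<sigma> c s)\<^sup>2"
      using \<epsilon> by (intro mult_right_mono mult_left_mono) auto
    then show "b s * dl \<sigma> a s * (dl \<sigma> c s - dl \<sigma> a s) - b t * dl \<sigma> c t * (dl \<sigma> c t - dl \<sigma> a t)
      \<le> \<epsilon> * (1 + 8 * M\<^sup>2) * ((dl \<sigma> c s)\<^sup>2 + (dl \<sigma> c t)\<^sup>2)"
      using L R z(1) by (simp add: distrib_left)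
  qed
qed

text \<open>To first order the area swept out by a vertical segment between the leaves \<open>c0\<close> and \<open>c0 + \<sigma> * \<kappa>\<close> is
  half of \<open>b\<close> times the squared height of the segment. So this product is asymptotically constant
  along the leaf; exchanging \<open>s\<close> and \<open>t\<close> gives the opposite inequality.\<close>

lemma height_ratio:
  assumes \<sigma>: "\<sigma> = 1 \<or> \<sigma> = -1" and \<eta>: "0 < \<eta>"
  obtains \<gamma> where "0 < \<gamma>" "\<And>\<kappa> s t. 0 < \<kappa> \<Longrightarrow> \<kappa> < \<gamma> \<Longrightarrow>
    sqrt (b s) * dl \<sigma> \<kappa> s - sqrt (b t) * dl \<sigma> \<kappa> t \<le> \<eta> * (sqrt (b s) * dl \<sigma> \<kappa> s + sqrt (b t) * dl \<sigma> \<kappa> t)"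
proof -
  obtain m M where m: "0 < m" "m \<le> 1" "1 \<le> M" "\<And>t. m \<le> b t" "\<And>t. b t \<le> M" by (rule b_bounds, rule that)
  obtain N :: nat where N: "0 < N" "1 / real N \<le> \<eta> / 2"
  proof -
    obtain n :: nat where "2 / \<eta> < real n" using reals_Archimedean2 by blast
    then have "2 < \<eta> * real n" using \<eta> by (simp add: field_simps)
    moreover from this have "0 < n" using \<eta> by (cases n) auto
    ultimately show ?thesis using that[of n] by (simp add: field_simps)
  qed
  define C where "C = (1 + 8 * M\<^sup>2) / m"
  have C: "0 < C" using m by (simp add: C_def add_pos_nonneg)
  define \<epsilon> where "\<epsilon> = min m (\<eta> / (4 * real N * C))"
  have \<epsilon>: "0 < \<epsilon>" "\<epsilon> \<le> m" "2 * real N * (\<epsilon> * C) \<le> \<eta> / 2"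
  proof -
    show "0 < \<epsilon>" "\<epsilon> \<le> m" using m(1) \<eta> N C by (auto simp: \<epsilon>_def)
    have "\<epsilon> \<le> \<eta> / (4 * real N * C)" by (simp add: \<epsilon>_def)
    then show "2 * real N * (\<epsilon> * C) \<le> \<eta> / 2" using N C by (simp add: field_simps)
  qed
  obtain \<gamma> where \<gamma>: "0 < \<gamma>" "\<And>a c s t. 0 \<le> a \<Longrightarrow> a < c \<Longrightarrow> c < \<gamma> \<Longrightarrow>
    b s * dl \<sigma> a s * (dl \<sigma> c s - dl \<sigma> a s) - b t * dl \<sigma> c t * (dl \<sigma> c t - dl \<sigma> a t)
      \<le> \<epsilon> * (1 + 8 * M\<^sup>2) * ((dl \<sigma> c s)\<^sup>2 + (dl \<sigma> c t)\<^sup>2)"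
    using sheared_increment[OF \<sigma> m \<epsilon>(1,2)] by blast
  show ?thesis
  proof (rule that[OF \<gamma>(1)])
    fix \<kappa> s t assume \<kappa>: "0 < \<kappa>" "\<kappa> < \<gamma>"
    let ?X = "\<lambda>u k. sqrt (b u) * dl \<sigma> k u"
    have sb: "0 < sqrt (b u)" "sqrt (b u) * sqrt (b u) = b u" for u using b_pos[of u] by auto
    have "?X s \<kappa> - ?X t \<kappa> \<le> (2 * real N * (\<epsilon> * C) + 1 / real N) * (?X s \<kappa> + ?X t \<kappa>)"
    proof (rule integrate_product_increments[OF \<kappa>(1)])
      show "continuous_on {0..\<kappa>} (?X u)" for u by (intro continuous_intros dl_cont)
      then show "continuous_on {0..\<kappa>} (?X t)" .
      show "?X s a < ?X s c \<and> ?X t a < ?X t c" if "a < c" for a c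
        using dl_less[OF \<sigma> that] sb by simp
      show "?X s a * (?X s c - ?X s a) - ?X t c * (?X t c - ?X t a) \<le> \<epsilon> * C * (?X s c + ?X t c)\<^sup>2"
        if ac: "0 \<le> a" "a < c" "c \<le> \<kappa>" for a c
      proof -
        have pos: "0 \<le> dl \<sigma> c u" for u using dl_less[OF \<sigma>, of 0 c u] ac by simp
        have sq: "(dl \<sigma> c u)\<^sup>2 \<le> (?X u c)\<^sup>2 / m" for u
        proof -
          have "m * (dl \<sigma> c u)\<^sup>2 \<le> b u * (dl \<sigma> c u)\<^sup>2" using m(4)[of u] by (intro mult_right_mono) auto
          also have "\<dots> = (?X u c)\<^sup>2" using b_pos[of u] by (simp add: power_mult_distrib)
          finally show ?thesis using m(1) by (simp add: field_simps)
        qed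
        have "?X s a * (?X s c - ?X s a) - ?X t c * (?X t c - ?X t a)
          = (sqrt (b s) * sqrt (b s)) * dl \<sigma> a s * (dl \<sigma> c s - dl \<sigma> a s)
            - (sqrt (b t) * sqrt (b t)) * dl \<sigma> c t * (dl \<sigma> c t - dl \<sigma> a t)" by (simp only: algebra_simps)
        also have "\<dots> \<le> \<epsilon> * (1 + 8 * M\<^sup>2) * ((dl \<sigma> c s)\<^sup>2 + (dl \<sigma> c t)\<^sup>2)"
          using \<gamma>(2)[OF ac(1,2), of s t] ac \<kappa> by (simp only: sb)
        also have "\<dots> \<le> \<epsilon> * (1 + 8 * M\<^sup>2) * ((?X s c)\<^sup>2 / m + (?X t c)\<^sup>2 / m)"
          using \<epsilon> by (intro mult_left_mono add_mono sq) auto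
        also have "\<dots> = \<epsilon> * C * ((?X s c)\<^sup>2 + (?X t c)\<^sup>2)"
          by (simp add: C_def add_divide_distrib[symmetric])
        also have "\<dots> \<le> \<epsilon> * C * (?X s c + ?X t c)\<^sup>2"
          using \<epsilon> C pos sb by (intro mult_left_mono) (auto simp: power2_sum mult_nonneg_nonneg less_imp_le)
        finally show ?thesis .
      qed
    qed (use \<epsilon> C N in auto)
    also have "\<dots> \<le> \<eta> * (?X s \<kappa> + ?X t \<kappa>)"
    proof -
      have "0 < ?X s \<kappa>" "0 < ?X t \<kappa>" using dl_less[OF \<sigma> \<kappa>(1)] sb by auto
      then show ?thesis using \<epsilon>(3) N(2) by (intro mult_right_mono) auto
    qed
    finally show "?X s \<kappa> - ?X t \<kappa> \<le> \<eta> * (?X s \<kappa> + ?X t \<kappa>)" .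
  qed
qed

text \<open>\<open>\<beta>\<close> is the limit shape of the strip between \<open>c0\<close> and a nearby leaf: proportional to \<open>1 / sqrt (b t)\<close>
  and, like the strip after division by \<open>c - c0\<close>, of mean \<open>1\<close>.\<close>

definition total :: real where "total = integral {0..1} (\<lambda>t. 1 / sqrt (b t))"

definition \<beta> :: "real \<Rightarrow> real" where "\<beta> t = 1 / (total * sqrt (b t))"

lemma inv_sqrt_cont: "continuous_on S (\<lambda>t. 1 / sqrt (b t))"
  by (intro continuous_intros continuous_on_subset[OF b_cont]) (use b_pos less_irrefl in \<open>auto, metis\<close>)

lemma total_pos: "0 < total"
proof -
  obtain m M where m: "0 < m" "m \<le> 1" "1 \<le> M" "\<And>t. m \<le> b t" "\<And>t. b t \<le> M" by (rule b_bounds, rule that)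
  have "integral {0..1} (\<lambda>t::real. 1 / sqrt M) \<le> total"
    unfolding total_def
  proof (rule integral_le)
    fix t :: real
    show "1 / sqrt M \<le> 1 / sqrt (b t)" using m b_pos[of t] by (intro divide_left_mono) auto
  qed (auto intro!: integrable_continuous_real inv_sqrt_cont)
  then show ?thesis using m by (auto intro: less_le_trans[rotated])
qed

lemma \<beta>_pos: "0 < \<beta> t" using total_pos b_pos[of t] by (simp add: \<beta>_def)

lemma \<beta>_cont: "continuous_on S \<beta>"
proof -
  have "\<beta> = (\<lambda>t. (1 / total) * (1 / sqrt (b t)))" by (auto simp: \<beta>_def)
  then show ?thesis using continuous_on_mult_left[OF inv_sqrt_cont, of S "1 / total"] by simp
qed

lemma \<beta>_per: "\<beta> (t + 1) = \<beta> t" by (simp add: \<beta>_def b_per)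

lemma \<beta>_integral: "integral {0..1} \<beta> = 1"
proof -
  have "\<beta> = (\<lambda>t. (1 / total) * (1 / sqrt (b t)))" by (auto simp: \<beta>_def)
  then have "integral {0..1} \<beta> = (1 / total) * total"
    unfolding total_def by (simp only: integral_mult_right)
  then show ?thesis using total_pos by simp
qed

lemma \<beta>_bound: obtains K where "1 \<le> K" "\<And>t. \<beta> t \<le> K" "\<And>t. b t \<le> K"
proof -
  obtain m M where m: "0 < m" "m \<le> 1" "1 \<le> M" "\<And>t. m \<le> b t" "\<And>t. b t \<le> M" by (rule b_bounds, rule that)
  have "\<beta> t \<le> 1 / (total * sqrt m)" for t
    unfolding \<beta>_def using total_pos m(1,4) b_pos[of t] by (intro divide_left_mono mult_left_mono) auto
  then show ?thesis using that[of "max M (1 / (total * sqrt m))"] m by (auto simp: le_max_iff_disj)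
qed

text \<open>By \<open>height_ratio\<close> the height is nearly a constant multiple of \<open>1 / sqrt (b t)\<close>, and the normalisation
  \<open>e_mean\<close> determines the constant.\<close>

lemma height_limit:
  assumes \<eta>: "0 < \<eta>"
  obtains \<gamma> where "0 < \<gamma>" "\<And>c t. c \<noteq> c0 \<Longrightarrow> \<bar>c - c0\<bar> < \<gamma> \<Longrightarrow> \<bar>(e c t - e c0 t) / (c - c0) - \<beta> t\<bar> \<le> \<eta>"
proof -
  obtain K where K: "1 \<le> K" "\<And>t. \<beta> t \<le> K" "\<And>t. b t \<le> K" by (rule \<beta>_bound, rule that)
  define \<eta>' where "\<eta>' = min (1 / 2) (\<eta> / (4 * K))"
  have \<eta>': "0 < \<eta>'" "\<eta>' \<le> 1 / 2" "4 * \<eta>' * K \<le> \<eta>"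
  proof -
    show "0 < \<eta>'" "\<eta>' \<le> 1 / 2" using \<eta> K by (auto simp: \<eta>'_def)
    have "\<eta>' \<le> \<eta> / (4 * K)" by (simp add: \<eta>'_def)
    then show "4 * \<eta>' * K \<le> \<eta>" using K by (simp add: field_simps)
  qed
  \<comment> \<open>A bound for the ratio \<open>(1 + \<eta>') / (1 - \<eta>')\<close>.\<close>
  define r where "r = 1 + 4 * \<eta>'"
  obtain \<gamma>1 where \<gamma>1: "0 < \<gamma>1" "\<And>\<kappa> s t. 0 < \<kappa> \<Longrightarrow> \<kappa> < \<gamma>1 \<Longrightarrow>
    sqrt (b s) * dl 1 \<kappa> s - sqrt (b t) * dl 1 \<kappa> t \<le> \<eta>' * (sqrt (b s) * dl 1 \<kappa> s + sqrt (b t) * dl 1 \<kappa> t)"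
    by (rule height_ratio[of 1 \<eta>']) (use \<eta>'(1) in \<open>simp, simp, blast\<close>)
  obtain \<gamma>2 where \<gamma>2: "0 < \<gamma>2" "\<And>\<kappa> s t. 0 < \<kappa> \<Longrightarrow> \<kappa> < \<gamma>2 \<Longrightarrow>
    sqrt (b s) * dl (-1) \<kappa> s - sqrt (b t) * dl (-1) \<kappa> t \<le> \<eta>' * (sqrt (b s) * dl (-1) \<kappa> s + sqrt (b t) * dl (-1) \<kappa> t)"
    by (rule height_ratio[of "-1" \<eta>']) (use \<eta>'(1) in \<open>simp, simp, blast\<close>)
  show ?thesis
  proof (rule that[of "min \<gamma>1 \<gamma>2"])
    show "0 < min \<gamma>1 \<gamma>2" using \<gamma>1 \<gamma>2 by simp
    fix c t assume c: "c \<noteq> c0" "\<bar>c - c0\<bar> < min \<gamma>1 \<gamma>2"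
    define \<sigma> where "\<sigma> = sgn (c - c0)"
    define \<kappa> where "\<kappa> = \<bar>c - c0\<bar>"
    have \<sigma>: "\<sigma> = 1 \<or> \<sigma> = -1" and \<kappa>: "0 < \<kappa>" and c\<kappa>: "c0 + \<sigma> * \<kappa> = c"
      using c by (auto simp: \<sigma>_def \<kappa>_def sgn_if)
    have dlc: "dl \<sigma> \<kappa> u = \<sigma> * (e c u - e c0 u)" for u by (simp add: dl_def c\<kappa>)
    let ?X = "\<lambda>u. sqrt (b u) * dl \<sigma> \<kappa> u"
    have sb: "0 < sqrt (b u)" for u using b_pos[of u] by simp
    have Xpos: "0 < ?X u" for u using dl_less[OF \<sigma> \<kappa>, of u] sb by simp
    have ratio: "?X u \<le> r * ?X x" for u x
    proof -
      have "?X u - ?X x \<le> \<eta>' * (?X u + ?X x)"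
        using \<sigma>
      proof
        assume "\<sigma> = 1" then show ?thesis using \<gamma>1(2)[OF \<kappa>, of u x] c(2) unfolding \<kappa>_def by simp
      next
        assume "\<sigma> = -1" then show ?thesis using \<gamma>2(2)[OF \<kappa>, of u x] c(2) unfolding \<kappa>_def by simp
      qed
      then have "(1 - \<eta>') * ?X u \<le> (1 + \<eta>') * ?X x" by (simp add: algebra_simps)
      also have "\<dots> \<le> ((1 - \<eta>') * r) * ?X x"
      proof (intro mult_right_mono)
        have "\<eta>' * \<eta>' \<le> \<eta>' * (1 / 2)" using \<eta>' by (intro mult_left_mono) auto
        then show "1 + \<eta>' \<le> (1 - \<eta>') * r" by (simp add: r_def algebra_simps)
      qed (use Xpos[of x] in simp)
      finally have "(1 - \<eta>') * ?X u \<le> (1 - \<eta>') * (r * ?X x)" by (simp add: mult.assoc)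
      then show ?thesis using \<eta>' by simp
    qed
    have r: "1 < r" using \<eta>' by (simp add: r_def)
    have ki: "\<kappa> = integral {0..1} (\<lambda>u. dl \<sigma> \<kappa> u)"
    proof -
      have "integral {0..1} (\<lambda>u. dl \<sigma> \<kappa> u) = \<sigma> * (integral {0..1} (e c) - integral {0..1} (e c0))"
        unfolding dlc by (simp add: integral_diff integrable_continuous_real e_cont1)
      also have "\<dots> = \<kappa>" using c by (auto simp: e_mean \<sigma>_def \<kappa>_def sgn_if)
      finally show ?thesis by simp
    qed
    have int: "(\<lambda>u. dl \<sigma> \<kappa> u) integrable_on {0..1}"
      unfolding dlc by (intro integrable_continuous_real continuous_intros e_cont1)
    have up: "\<kappa> \<le> r * ?X t * total"
    proof -
      have "integral {0..1} (\<lambda>u. dl \<sigma> \<kappa> u) \<le> integral {0..1} (\<lambda>u. (r * ?X t) * (1 / sqrt (b u)))"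
      proof (rule integral_le[OF int])
        show "(\<lambda>u. r * ?X t * (1 / sqrt (b u))) integrable_on {0..1}"
          by (intro integrable_continuous_real continuous_on_mult_left inv_sqrt_cont)
        show "dl \<sigma> \<kappa> u \<le> r * ?X t * (1 / sqrt (b u))" for u
          using ratio[of u t] sb[of u] by (simp add: field_simps)
      qed
      then show ?thesis unfolding total_def ki[symmetric] by (simp only: integral_mult_right)
    qed
    have lo: "?X t * total \<le> r * \<kappa>"
    proof -
      have "integral {0..1} (\<lambda>u. ?X t * (1 / sqrt (b u))) \<le> integral {0..1} (\<lambda>u. r * dl \<sigma> \<kappa> u)"
      proof (rule integral_le)
        show "(\<lambda>u. ?X t * (1 / sqrt (b u))) integrable_on {0..1}"
          by (intro integrable_continuous_real continuous_on_mult_left inv_sqrt_cont)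
        show "(\<lambda>u. r * dl \<sigma> \<kappa> u) integrable_on {0..1}" using integrable_on_cmult_left[OF int, of r] by simp
        show "?X t * (1 / sqrt (b u)) \<le> r * dl \<sigma> \<kappa> u" for u
          using ratio[of t u] sb[of u] by (simp add: field_simps)
      qed
      then show ?thesis unfolding total_def by (simp only: integral_mult_right ki[symmetric])
    qed
    have eq: "(e c t - e c0 t) / (c - c0) = dl \<sigma> \<kappa> t / \<kappa>"
    proof -
      have "c - c0 = \<sigma> * \<kappa>" using c\<kappa> by simp
      moreover have "x / (\<sigma> * \<kappa>) = \<sigma> * x / \<kappa>" for x using \<sigma> by auto
      ultimately show ?thesis by (simp only: dlc)
    qed
    have rat: "dl \<sigma> \<kappa> t / \<kappa> = \<beta> t * (?X t * total / \<kappa>)"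
      using total_pos sb[of t] by (simp add: \<beta>_def)
    have q: "\<bar>?X t * total / \<kappa> - 1\<bar> \<le> r - 1"
    proof -
      have 1: "?X t * total / \<kappa> \<le> r" using lo \<kappa> by (simp add: divide_le_eq)
      have 2: "1 \<le> r * (?X t * total / \<kappa>)" using up \<kappa> by (simp add: le_divide_eq mult.assoc)
      have "(2 - r) * r \<le> 1" using zero_le_power2[of "r - 1"] by (simp add: power2_eq_square algebra_simps)
      then have "r * (2 - r) \<le> r * (?X t * total / \<kappa>)" using 2 by (simp add: mult.commute)
      then have "2 - r \<le> ?X t * total / \<kappa>" using r by (simp only: mult_le_cancel_left_pos)
      then show ?thesis using 1 by (simp only: abs_le_iff) linarith
    qed
    have "\<bar>(e c t - e c0 t) / (c - c0) - \<beta> t\<bar> = \<beta> t * \<bar>?X t * total / \<kappa> - 1\<bar>"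
      unfolding eq rat using \<beta>_pos[of t] by (simp add: abs_mult_pos' right_diff_distrib)
    also have "\<dots> \<le> K * (r - 1)" using q K \<beta>_pos[of t] by (intro mult_mono) auto
    finally show "\<bar>(e c t - e c0 t) / (c - c0) - \<beta> t\<bar> \<le> \<eta>" using \<eta>'(3) by (simp add: r_def mult.commute)
  qed
qed

definition B :: "real \<Rightarrow> real" where "B = primitive \<beta>"

lemma B_deriv: "(B has_real_derivative \<beta> t) (at t)"
  unfolding B_def by (rule primitive_deriv[OF \<beta>_cont])

lemma B_0 [simp]: "B 0 = 0" by (simp add: B_def)

lemma B_per: "B (t + 1) = B t + 1"
  unfolding B_def using primitive_periodic[OF \<beta>_cont \<beta>_per] \<beta>_integral by simp

lemma B_less: "s < t \<Longrightarrow> B s < B t"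
  using DERIV_pos_imp_increasing[of s t B] B_deriv \<beta>_pos by meson

lemma B_cont: "continuous_on S B"
  by (rule DERIV_continuous_on, rule has_field_derivative_at_within, rule B_deriv)

lemma area_derivative:
  assumes \<eta>: "0 < \<eta>"
  obtains \<gamma> where "0 < \<gamma>" "\<And>c t. c \<noteq> c0 \<Longrightarrow> \<bar>c - c0\<bar> < \<gamma> \<Longrightarrow> \<bar>v c0 c t / (c - c0) - B t\<bar> \<le> \<eta>"
proof -
  obtain \<gamma> where \<gamma>: "0 < \<gamma>"
    "\<And>c t. c \<noteq> c0 \<Longrightarrow> \<bar>c - c0\<bar> < \<gamma> \<Longrightarrow> \<bar>(e c t - e c0 t) / (c - c0) - \<beta> t\<bar> \<le> \<eta>"
    using height_limit[OF \<eta>] by blast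
  show ?thesis
  proof (rule that[OF \<gamma>(1)])
    fix c t assume c: "c \<noteq> c0" "\<bar>c - c0\<bar> < \<gamma>"
    let ?u = "\<lambda>t. v c0 c t / (c - c0) - B t"
    have du: "(?u has_real_derivative (e c t - e c0 t) / (c - c0) - \<beta> t) (at t)" for t
      by (intro DERIV_diff DERIV_cdivide v_deriv B_deriv)
    have "?u (t + 1) = ?u t" for t using c by (simp add: v_per B_per add_divide_distrib)
    then have "?u (frac t) = ?u t" 
      using degree_one_int[of "\<lambda>t. ?u t + t" "frac t" "\<lfloor>t\<rfloor>"] by (simp add: frac_def)
    moreover have "\<bar>?u (frac t)\<bar> \<le> \<eta>"
    proof (cases "frac t = 0")
      case False
      then have p: "0 < frac t" using frac_ge_0[of t] by linarith
      obtain z where "?u (frac t) - ?u 0 = (frac t - 0) * ((e c z - e c0 z) / (c - c0) - \<beta> z)"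
        using MVT2[OF p du] by blast
      then have "\<bar>?u (frac t)\<bar> = frac t * \<bar>(e c z - e c0 z) / (c - c0) - \<beta> z\<bar>"
        using p by (simp add: abs_mult)
      also have "\<dots> \<le> 1 * \<eta>" using \<gamma>(2)[OF c, of z] frac_lt_1[of t] p by (intro mult_mono) auto
      finally show ?thesis by simp
    next
      case True
      show ?thesis unfolding True using \<eta> by simp
    qed
    ultimately show "\<bar>?u t\<bar> \<le> \<eta>" by simp
  qed
qed

text \<open>The displacement in the coordinate \<open>B\<close> is the product of three factors: the slope of \<open>B\<close>, about \<open>\<beta> t\<close>;
  the displacement per height, about \<open>b t\<close>; and the height, about \<open>\<beta> t * (c - c0)\<close>. The choice of \<open>\<beta>\<close>
  makes \<open>\<beta> t * b t * \<beta> t\<close> independent of \<open>t\<close>.\<close>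

lemma near_translation:
  assumes \<epsilon>: "0 < \<epsilon>"
  obtains \<gamma> where "0 < \<gamma>" "\<And>c t. c \<noteq> c0 \<Longrightarrow> \<bar>c - c0\<bar> < \<gamma> \<Longrightarrow>
    \<bar>B (g c t) - B t - (c - c0) / total\<^sup>2\<bar> \<le> \<epsilon> * (\<bar>c - c0\<bar> / total\<^sup>2)"
proof -
  obtain K where K: "1 \<le> K" "\<And>t. \<beta> t \<le> K" "\<And>t. b t \<le> K" by (rule \<beta>_bound, rule that)
  define \<epsilon>1 where "\<epsilon>1 = min 1 (\<epsilon> / (3 * (K + 1)\<^sup>2 * total\<^sup>2))"
  have KT: "0 < 3 * (K + 1)\<^sup>2 * total\<^sup>2" using K total_pos by simp
  have \<epsilon>1: "0 < \<epsilon>1" "\<epsilon>1 \<le> 1" "\<epsilon>1 * (3 * (K + 1)\<^sup>2) \<le> \<epsilon> / total\<^sup>2"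
  proof -
    show "0 < \<epsilon>1" "\<epsilon>1 \<le> 1" using \<epsilon> KT by (auto simp: \<epsilon>1_def)
    have "\<epsilon>1 \<le> \<epsilon> / (3 * (K + 1)\<^sup>2 * total\<^sup>2)" by (simp add: \<epsilon>1_def)
    then have "\<epsilon>1 * (3 * (K + 1)\<^sup>2) * total\<^sup>2 \<le> \<epsilon>" using KT by (simp add: le_divide_eq mult.assoc)
    then show "\<epsilon>1 * (3 * (K + 1)\<^sup>2) \<le> \<epsilon> / total\<^sup>2" using total_pos by (simp add: le_divide_eq)
  qed
  obtain d1 where d1: "0 < d1" "\<And>c t. \<bar>c - c0\<bar> < d1 \<Longrightarrow>
      \<bar>g c t - t - b t * (e c t - e c0 t)\<bar> \<le> \<epsilon>1 * \<bar>e c t - e c0 t\<bar>"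
    using shear[OF \<epsilon>1(1)] by blast
  obtain d2 where d2: "0 < d2" "\<And>c t. c \<noteq> c0 \<Longrightarrow> \<bar>c - c0\<bar> < d2 \<Longrightarrow> \<bar>(e c t - e c0 t) / (c - c0) - \<beta> t\<bar> \<le> \<epsilon>1"
    using height_limit[OF \<epsilon>1(1)] by blast
  have "continuous_on UNIV (\<lambda>z::real \<times> real. \<beta> (fst z))"
    by (intro continuous_on_compose2[OF \<beta>_cont[of UNIV]] continuous_intros) auto
  then obtain d3 where d3: "0 < d3" "\<And>s t. \<bar>s - t\<bar> < d3 \<Longrightarrow> \<bar>\<beta> s - \<beta> t\<bar> < \<epsilon>1"
    using periodic_uniformly_continuous[of "\<lambda>z. \<beta> (fst z)" \<epsilon>1 0] \<beta>_per \<epsilon>1(1)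
    by (metis abs_zero diff_self fst_conv)
  obtain d4 where d4: "0 < d4" "\<And>c t. \<bar>c - c0\<bar> < d4 \<Longrightarrow> \<bar>g c t - g c0 t\<bar> < d3"
    using g_uniform[OF d3(1)] by blast
  show ?thesis
  proof (rule that[of "min (min d1 d2) d4"])
    show "0 < min (min d1 d2) d4" using d1 d2 d4 by simp
    fix c t assume c: "c \<noteq> c0" "\<bar>c - c0\<bar> < min (min d1 d2) d4"
    have "\<exists>\<xi>. B (g c t) - B t = (g c t - t) * \<beta> \<xi> \<and> \<bar>\<xi> - t\<bar> \<le> \<bar>g c t - t\<bar>"
    proof -
      consider "t < g c t" | "g c t < t" | "g c t = t" by linarith
      then show ?thesis
      proof cases
        case 1
        obtain z where "t < z" "z < g c t" "B (g c t) - B t = (g c t - t) * \<beta> z"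
          using MVT2[OF 1 B_deriv] by blast
        then show ?thesis by (intro exI[of _ z]) auto
      next
        case 2
        obtain z where "g c t < z" "z < t" "B t - B (g c t) = (t - g c t) * \<beta> z"
          using MVT2[OF 2 B_deriv] by blast
        then show ?thesis by (intro exI[of _ z]) (auto simp: algebra_simps)
      qed auto
    qed
    then obtain \<xi> where \<xi>: "B (g c t) - B t = (g c t - t) * \<beta> \<xi>" "\<bar>\<xi> - t\<bar> \<le> \<bar>g c t - t\<bar>" by blast
    have ne: "e c t - e c0 t \<noteq> 0" using c(1) e_less[of c c0 t] e_less[of c0 c t] by (cases c c0 rule: linorder_cases) auto
    define x1 where "x1 = \<beta> \<xi>"
    define x2 where "x2 = (g c t - t) / (e c t - e c0 t)"
    define x3 where "x3 = (e c t - e c0 t) / (c - c0)"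
    have e1: "\<bar>x1 - \<beta> t\<bar> \<le> \<epsilon>1" using d3(2)[of \<xi> t] d4(2)[of c t] \<xi>(2) c by (simp add: x1_def g_id)
    have e2: "\<bar>x2 - b t\<bar> \<le> \<epsilon>1"
    proof -
      have "\<bar>x2 - b t\<bar> * \<bar>e c t - e c0 t\<bar> = \<bar>g c t - t - b t * (e c t - e c0 t)\<bar>"
        unfolding abs_mult[symmetric] left_diff_distrib using ne by (simp add: x2_def)
      also have "\<dots> \<le> \<epsilon>1 * \<bar>e c t - e c0 t\<bar>" using d1(2) c by simp
      finally show ?thesis using ne by simp
    qed
    have e3: "\<bar>x3 - \<beta> t\<bar> \<le> \<epsilon>1" using d2(2) c by (simp add: x3_def)
    have bb: "\<bar>\<beta> t\<bar> \<le> K + 1" "\<bar>b t\<bar> \<le> K + 1" using K(2,3)[of t] \<beta>_pos[of t] b_pos[of t] by auto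
    have b2: "\<bar>x2\<bar> \<le> K + 1" using e2 K(3)[of t] b_pos[of t] \<epsilon>1(2) by (simp add: abs_le_iff)
    have b3: "\<bar>x3\<bar> \<le> K + 1" using e3 K(2)[of t] \<beta>_pos[of t] \<epsilon>1(2) by (simp add: abs_le_iff)
    have eq: "x1 * x2 * x3 - \<beta> t * b t * \<beta> t = (x1 - \<beta> t) * (x2 * x3) + (x2 - b t) * (\<beta> t * x3) + (x3 - \<beta> t) * (\<beta> t * b t)"
      by (simp add: algebra_simps)
    have pr: "\<bar>u * (x * y)\<bar> \<le> \<epsilon>1 * (K + 1)\<^sup>2" if "\<bar>u\<bar> \<le> \<epsilon>1" "\<bar>x\<bar> \<le> K + 1" "\<bar>y\<bar> \<le> K + 1" for u x y :: real
      unfolding abs_mult power2_eq_square using that by (intro mult_mono) auto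
    have "\<bar>x1 * x2 * x3 - \<beta> t * b t * \<beta> t\<bar> \<le> 3 * (\<epsilon>1 * (K + 1)\<^sup>2)"
      unfolding eq using pr[OF e1 b2 b3] pr[OF e2 bb(1) b3] pr[OF e3 bb] by linarith
    also have "\<dots> \<le> \<epsilon> / total\<^sup>2" using \<epsilon>1(3) by (simp add: algebra_simps)
    also have "\<beta> t * b t * \<beta> t = 1 / total\<^sup>2"
      using b_pos[of t] total_pos by (simp add: \<beta>_def power2_eq_square divide_simps)
    finally have fin: "\<bar>x1 * x2 * x3 - 1 / total\<^sup>2\<bar> \<le> \<epsilon> / total\<^sup>2" .
    have "B (g c t) - B t - (c - c0) / total\<^sup>2 = (c - c0) * (x1 * x2 * x3 - 1 / total\<^sup>2)"
    proof -
      have "(g c t - t) * \<beta> \<xi> = (c - c0) * (x1 * x2 * x3)"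
        unfolding x1_def x2_def x3_def using ne c(1) by simp
      then show ?thesis unfolding \<xi>(1) by (simp add: right_diff_distrib)
    qed
    then have "\<bar>B (g c t) - B t - (c - c0) / total\<^sup>2\<bar> = \<bar>c - c0\<bar> * \<bar>x1 * x2 * x3 - 1 / total\<^sup>2\<bar>"
      by (simp only: abs_mult)
    also have "\<dots> \<le> \<bar>c - c0\<bar> * (\<epsilon> / total\<^sup>2)" using fin by (intro mult_left_mono) auto
    finally show "\<bar>B (g c t) - B t - (c - c0) / total\<^sup>2\<bar> \<le> \<epsilon> * (\<bar>c - c0\<bar> / total\<^sup>2)" by (simp add: mult.commute)
  qed
qed

text \<open>Two leaves near \<open>c0\<close> cannot be compared directly by the estimates above, which all involve the leaf
  \<open>c0\<close> itself. Instead, the area derivative \<open>h\<close> at a nearby leaf is identified through the dynamics.\<close>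

lemma semiconjugacy_limit:
  assumes \<eta>: "0 < \<eta>"
  obtains \<gamma> where "0 < \<gamma>" "\<And>c (h :: real \<Rightarrow> real) a t. c \<noteq> c0 \<Longrightarrow> \<bar>c - c0\<bar> < \<gamma> \<Longrightarrow> mono h \<Longrightarrow> (\<And>t. h (t + 1) = h t + 1) \<Longrightarrow>
    h 0 = 0 \<Longrightarrow> (\<And>t. h (g c t) = h t + a) \<Longrightarrow> \<bar>h t - B t\<bar> \<le> \<eta>"
proof -
  define \<epsilon> where "\<epsilon> = min (1 / 2) (\<eta> / 8)"
  have \<epsilon>: "0 < \<epsilon>" "\<epsilon> \<le> 1 / 2" "4 * \<epsilon> \<le> \<eta> / 2" using \<eta> by (auto simp: \<epsilon>_def)
  obtain \<gamma> where \<gamma>: "0 < \<gamma>" "\<And>c t. c \<noteq> c0 \<Longrightarrow> \<bar>c - c0\<bar> < \<gamma> \<Longrightarrow>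
    \<bar>B (g c t) - B t - (c - c0) / total\<^sup>2\<bar> \<le> \<epsilon> * (\<bar>c - c0\<bar> / total\<^sup>2)"
    using near_translation[OF \<epsilon>(1)] by blast
  have smono: "strict_mono B" using B_less by (simp add: strict_mono_def)
  obtain Bi where Bi: "\<And>y. B (Bi y) = y" and BiB: "\<And>t. Bi (B t) = t" and "continuous_on UNIV Bi"
    and "strict_mono Bi" and Bi1: "\<And>y. Bi (y + 1) = Bi y + 1"
    by (rule degree_one_inverse[of B, OF B_cont smono B_per], rule that)
  have Bimono: "mono Bi" by (rule strict_mono_mono) fact
  let ?\<gamma> = "min \<gamma> (\<eta> * total\<^sup>2 / 4)"
  show ?thesis
  proof (rule that[of ?\<gamma>])
    show "0 < ?\<gamma>" using \<gamma>(1) \<eta> total_pos by simp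
    fix c a t and h :: "real \<Rightarrow> real"
    assume c: "c \<noteq> c0" "\<bar>c - c0\<bar> < ?\<gamma>" and h: "mono h" "\<And>t. h (t + 1) = h t + 1" "h 0 = 0"
      and hg: "\<And>t. h (g c t) = h t + a"
    define \<sigma> where "\<sigma> = sgn (c - c0)"
    define \<tau> where "\<tau> = \<bar>c - c0\<bar> / total\<^sup>2"
    have \<sigma>: "\<sigma> = 1 \<or> \<sigma> = -1" using c by (auto simp: \<sigma>_def sgn_if)
    have \<tau>: "0 < \<tau>" using c total_pos by (simp add: \<tau>_def)
    have "\<bar>c - c0\<bar> < \<eta> * total\<^sup>2 / 4" using c by simp
    then have \<tau>2: "2 * \<tau> \<le> \<eta> / 2" using total_pos by (simp add: \<tau>_def field_simps)
    have \<sigma>\<tau>: "\<sigma> * \<tau> = (c - c0) / total\<^sup>2" by (auto simp: \<sigma>_def \<tau>_def sgn_if)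
    \<comment> \<open>Below \<open>c0\<close> the dynamics moves to the left; conjugation with \<open>\<sigma>\<close> makes the translation positive.\<close>
    define D where "D = (\<lambda>y. \<sigma> * h (Bi (\<sigma> * y)))"
    define \<Gamma> where "\<Gamma> = (\<lambda>y. \<sigma> * B (g c (Bi (\<sigma> * y))))"
    have \<sigma>\<sigma>: "\<sigma> * (\<sigma> * y) = y" for y using \<sigma> by auto
    have "\<bar>D (\<sigma> * B t) - \<sigma> * B t\<bar> \<le> 4 * \<epsilon> + 2 * \<tau>"
    proof (rule semiconjugacy_near_identity[OF _ _ _ _ _ \<tau> \<epsilon>(1,2)])
      show "mono D"
        unfolding D_def using \<sigma> monoD[OF h(1)] monoD[OF Bimono] by (intro monoI) auto
      have n: "h (Bi (- (x + 1))) + 1 = h (Bi (- x))" for x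
        using Bi1[of "- (x + 1)"] h(2)[of "Bi (- (x + 1))"] by simp
      show "D (x + 1) = D x + 1" for x
        using \<sigma>
      proof
        assume "\<sigma> = 1" then show ?thesis by (simp add: D_def Bi1 h(2))
      next
        assume "\<sigma> = -1" then show ?thesis using n[of x] unfolding D_def by simp
      qed
      show "D 0 = 0" using BiB[of 0] h(3) by (simp add: D_def)
      show "D (\<Gamma> x) = D x + \<sigma> * a" for x
        by (simp add: D_def \<Gamma>_def \<sigma>\<sigma> BiB hg distrib_left)
      show "\<bar>\<Gamma> x - x - \<tau>\<bar> \<le> \<epsilon> * \<tau>" for x
      proof -
        have "\<Gamma> x - x - \<tau> = \<sigma> * (B (g c (Bi (\<sigma> * x))) - B (Bi (\<sigma> * x)) - \<sigma> * \<tau>)"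
          by (simp add: \<Gamma>_def Bi right_diff_distrib \<sigma>\<sigma>)
        also have "\<bar>\<dots>\<bar> = \<bar>B (g c (Bi (\<sigma> * x))) - B (Bi (\<sigma> * x)) - \<sigma> * \<tau>\<bar>" using \<sigma> by (auto simp: abs_minus_commute)
        also have "\<dots> \<le> \<epsilon> * (\<bar>c - c0\<bar> / total\<^sup>2)"
          unfolding \<sigma>\<tau> using \<gamma>(2)[OF c(1), of "Bi (\<sigma> * x)"] c(2) by simp
        finally show ?thesis by (simp only: \<tau>_def)
      qed
    qed
    moreover have "D (\<sigma> * B t) - \<sigma> * B t = \<sigma> * (h t - B t)"
      by (simp add: D_def \<sigma>\<sigma> BiB right_diff_distrib)
    ultimately have "\<bar>h t - B t\<bar> \<le> 4 * \<epsilon> + 2 * \<tau>" using \<sigma> by auto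
    then show "\<bar>h t - B t\<bar> \<le> \<eta>" using \<epsilon>(3) \<tau>2 by linarith
  qed
qed

end

section \<open>Continuously differentiable plane maps along a leaf\<close>

definition C1_map :: "(real \<times> real \<Rightarrow> real \<times> real) \<Rightarrow> (real \<times> real \<Rightarrow> ((real \<times> real) \<Rightarrow>\<^sub>L (real \<times> real))) \<Rightarrow> bool"
  where "C1_map P P' \<longleftrightarrow> (\<forall>z. (P has_derivative blinfun_apply (P' z)) (at z)) \<and> continuous_on UNIV P'"

lemma C1_map_deriv: "C1_map P P' \<Longrightarrow> (P has_derivative blinfun_apply (P' z)) (at z)"
  by (simp add: C1_map_def)

lemma C1_map_continuous: "C1_map P P' \<Longrightarrow> continuous_on S P"
  by (meson C1_map_deriv continuous_at_imp_continuous_on has_derivative_continuous)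

lemma C1_map_comp:
  assumes "C1_map P P'" "C1_map Q Q'"
  shows "C1_map (P \<circ> Q) (\<lambda>z. P' (Q z) o\<^sub>L Q' z)"
  unfolding C1_map_def
proof (intro conjI allI)
  fix z
  show "(P \<circ> Q has_derivative blinfun_apply (P' (Q z) o\<^sub>L Q' z)) (at z)"
    using diff_chain_at[OF C1_map_deriv[OF assms(2)] C1_map_deriv[OF assms(1)], of z]
    by (simp add: blinfun_compose.rep_eq)
  have "continuous_on UNIV (\<lambda>z. P' (Q z))"
    using assms by (intro continuous_on_compose2[of UNIV P' UNIV Q] C1_map_continuous) (auto simp: C1_map_def)
  then show "continuous_on UNIV (\<lambda>z. P' (Q z) o\<^sub>L Q' z)"
    using assms(2) unfolding C1_map_def
    by (intro bounded_bilinear.continuous_on[OF bounded_bilinear_blinfun_compose]) auto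
qed

primrec iter_deriv :: "('a::real_normed_vector \<Rightarrow> 'a) \<Rightarrow> ('a \<Rightarrow> ('a \<Rightarrow>\<^sub>L 'a)) \<Rightarrow> nat \<Rightarrow> 'a \<Rightarrow> ('a \<Rightarrow>\<^sub>L 'a)"
  where
  "iter_deriv P P' 0 z = id_blinfun"
| "iter_deriv P P' (Suc n) z = P' ((P ^^ n) z) o\<^sub>L iter_deriv P P' n z"

lemma C1_map_iterate: "C1_map P P' \<Longrightarrow> C1_map (P ^^ n) (iter_deriv P P' n)"
proof (induction n)
  case 0 show ?case by (simp add: C1_map_def id_def continuous_on_const)
next
  case (Suc n)
  from C1_map_comp[OF Suc.prems Suc.IH[OF Suc.prems]] show ?case by (simp add: comp_def)
qed

lemma C1_symplectic_iff: "C1_symplectic F F' \<longleftrightarrow> C1_map F F' \<and> (\<forall>z. area_form z (F' z (1, 0)) (F' z (0, 1)) = 1)"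
  by (auto simp: C1_symplectic_def C1_map_def)

lemma C1_symplectic_area:
  "C1_symplectic F F' \<Longrightarrow> area_form x (F' z u) (F' z v) = area_form y u v"
  using area_form_blinfun[of z "F' z" u v] by (simp add: C1_symplectic_def area_form_def)

lemma C1_symplectic_comp:
  assumes "C1_symplectic P P'" "C1_symplectic Q Q'"
  shows "C1_symplectic (P \<circ> Q) (\<lambda>z. P' (Q z) o\<^sub>L Q' z)"
  using assms C1_map_comp C1_symplectic_area[OF assms(1)] unfolding C1_symplectic_iff
  by (auto simp: blinfun_compose.rep_eq area_form_def)

lemma C1_symplectic_iterate: "C1_symplectic P P' \<Longrightarrow> C1_symplectic (P ^^ n) (iter_deriv P P' n)"
proof (induction n)
  case 0 show ?case by (simp add: C1_symplectic_def id_def area_form_def continuous_on_const)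
next
  case (Suc n)
  from C1_symplectic_comp[OF Suc.prems Suc.IH[OF Suc.prems]] show ?case by (simp add: comp_def)
qed

text \<open>The mean value inequality for \<open>P - P' z\<close>, on a ball in which \<open>P'\<close> varies by at most \<open>\<epsilon>\<close>.\<close>

lemma uniform_strict_derivative:
  assumes P: "C1_map P P'" and K: "compact K" and e: "0 < \<epsilon>"
  obtains d where "0 < d" "\<And>z x y. z \<in> K \<Longrightarrow> dist x z < d \<Longrightarrow> dist y z < d \<Longrightarrow>
    norm (P y - P x - P' z (y - x)) \<le> \<epsilon> * norm (y - x)"
proof -
  obtain R where R: "K \<subseteq> cball 0 R"
    using bounded_subset_ballD[OF compact_imp_bounded[OF K], of 0] by (meson ball_subset_cball subset_trans)
  have "uniformly_continuous_on (cball 0 (R + 1)) P'"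
    using P by (intro compact_uniformly_continuous) (auto simp: C1_map_def intro: continuous_on_subset)
  then obtain d where d: "0 < d" "\<And>x y. x \<in> cball 0 (R + 1) \<Longrightarrow> y \<in> cball 0 (R + 1) \<Longrightarrow> dist y x < d \<Longrightarrow> dist (P' y) (P' x) < \<epsilon>"
    using e unfolding uniformly_continuous_on_def by meson
  show ?thesis
  proof (rule that[of "min d 1"])
    show "0 < min d 1" using d by simp
    fix z x y assume z: "z \<in> K" "dist x z < min d 1" "dist y z < min d 1"
    have "norm ((P y - P' z y) - (P x - P' z x)) \<le> \<epsilon> * norm (y - x)"
    proof (rule differentiable_bound[where S = "ball z (min d 1)" and f' = "\<lambda>u h. P' u h - P' z h"])
      fix u assume u: "u \<in> ball z (min d 1)"
      show "((\<lambda>x. P x - P' z x) has_derivative (\<lambda>h. P' u h - P' z h)) (at u within ball z (min d 1))"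
        by (intro has_derivative_diff has_derivative_at_withinI[OF C1_map_deriv[OF P]]
            bounded_linear_imp_has_derivative blinfun.bounded_linear_right)
      have zR: "norm z \<le> R" using z(1) R by auto
      have uz: "dist u z < 1" "dist u z < d" using u by (auto simp: dist_commute)
      have "norm u \<le> R + 1" using norm_triangle_ineq[of "u - z" z] uz zR by (simp add: dist_norm)
      then have "dist (P' u) (P' z) < \<epsilon>" using d(2)[of z u] zR uz by auto
      then have "norm (P' u - P' z) \<le> \<epsilon>" by (simp add: dist_norm)
      then show "onorm (\<lambda>h. P' u h - P' z h) \<le> \<epsilon>" by (simp add: norm_blinfun.rep_eq minus_blinfun.rep_eq)
    qed (use z in \<open>auto simp: dist_commute\<close>)
    then show "norm (P y - P x - P' z (y - x)) \<le> \<epsilon> * norm (y - x)"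
      by (simp add: blinfun.diff_right algebra_simps)
  qed
qed

lemma shift_derivative:
  assumes P: "C1_map P P'" and sh: "\<And>z. P (z + (1, 0)) = P z + (1, 0)"
  shows "P' (z + (of_int k, 0)) = P' z"
proof -
  let ?s = "(of_int k :: real, 0 :: real)"
  have "((\<lambda>z. P (z + ?s)) has_derivative blinfun_apply (P' (z + ?s))) (at z)"
    by (rule has_derivative_compose[OF has_derivative_add_const[OF has_derivative_ident] C1_map_deriv[OF P]])
  moreover have "(\<lambda>z. P (z + ?s)) = (\<lambda>z. P z + ?s)" using shift_int[of P, OF sh] by auto
  ultimately have "((\<lambda>z. P z + ?s) has_derivative blinfun_apply (P' (z + ?s))) (at z)" by simp
  moreover have "((\<lambda>z. P z + ?s) has_derivative blinfun_apply (P' z)) (at z)"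
    by (intro has_derivative_add_const C1_map_deriv[OF P])
  ultimately show ?thesis by (metis has_derivative_unique blinfun_apply_inject)
qed

text \<open>By periodicity the whole graph is as good as its compact part over \<open>[0, 1]\<close>.\<close>

lemma strict_derivative_along_graph:
  assumes P: "C1_map P P'" and sh: "\<And>z. P (z + (1, 0)) = P z + (1, 0)"
    and f: "continuous_on UNIV f" "\<And>t. f (t + 1) = f t" and e: "0 < \<epsilon>"
  obtains d where "0 < d" "\<And>t x y. dist x (t, f t) < d \<Longrightarrow> dist y (t, f t) < d \<Longrightarrow>
    norm (P y - P x - P' (t, f t) (y - x)) \<le> \<epsilon> * norm (y - x)"
proof -
  have "compact ((\<lambda>t. (t, f t)) ` {0..1})"
    by (intro compact_continuous_image continuous_intros continuous_on_subset[OF f(1)]) auto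
  then obtain d where d: "0 < d" "\<And>z x y. z \<in> (\<lambda>t. (t, f t)) ` {0..1} \<Longrightarrow> dist x z < d \<Longrightarrow> dist y z < d \<Longrightarrow>
    norm (P y - P x - P' z (y - x)) \<le> \<epsilon> * norm (y - x)"
    using uniform_strict_derivative[OF P _ e] by blast
  show ?thesis
  proof (rule that[OF d(1)])
    fix t x y assume xy: "dist x (t, f t) < d" "dist y (t, f t) < d"
    let ?k = "\<lfloor>t\<rfloor>"
    let ?s = "(of_int (- ?k) :: real, 0 :: real)"
    have ff: "f (frac t) = f t"
      using degree_one_int[of "\<lambda>t. f t + t" "frac t" ?k] by (simp add: f(2) frac_def)
    have eq: "(frac t, f (frac t)) = (t, f t) + ?s" by (simp add: ff) (simp add: frac_def)
    have in1: "(t, f t) + ?s \<in> (\<lambda>t. (t, f t)) ` {0..1}"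
      unfolding eq[symmetric] using frac_ge_0[of t] frac_lt_1[of t] by auto
    have "norm (P (y + ?s) - P (x + ?s) - P' ((t, f t) + ?s) ((y + ?s) - (x + ?s))) \<le> \<epsilon> * norm ((y + ?s) - (x + ?s))"
    proof (rule d(2)[OF in1])
      have "dist (u + ?s) (w + ?s) = dist u w" for u w :: "real \<times> real"
        by (simp only: dist_norm add_diff_cancel_right)
      then show "dist (x + ?s) ((t, f t) + ?s) < d" "dist (y + ?s) ((t, f t) + ?s) < d"
        using xy by (simp_all only:)
    qed
    then show "norm (P y - P x - P' (t, f t) (y - x)) \<le> \<epsilon> * norm (y - x)"
      by (simp only: shift_int[of P, OF sh] shift_derivative[OF P sh] add_diff_cancel_right)
  qed
qed

text \<open>As the determinant is \<open>1\<close>, the other eigenvalue is \<open>1\<close> too; so the trace is \<open>2\<close>, and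
  \<open>(M - 1)\<^sup>2 = 0\<close> by the Cayley-Hamilton theorem.\<close>

lemma shear_of_fixed_vector:
  fixes M :: "(real \<times> real) \<Rightarrow>\<^sub>L (real \<times> real)"
  assumes det: "area_form z (M (1, 0)) (M (0, 1)) = 1" and u: "M u = u" "u \<noteq> 0"
  shows "M (M x - x) = M x - x"
proof -
  obtain a c where 1: "M (1, 0) = (a, c)" by (cases "M (1, 0)")
  obtain b d where 2: "M (0, 1) = (b, d)" by (cases "M (0, 1)")
  have M: "M (x, y) = (a * x + b * y, c * x + d * y)" for x y
    by (subst blinfun_plane_apply) (simp add: 1 2 mult.commute)
  have dt: "a * d - c * b = 1" using det by (simp add: 1 2 area_form_def)
  obtain p q where pq: "u = (p, q)" by (cases u)
  have k: "(a - 1) * p + b * q = 0" "c * p + (d - 1) * q = 0" and nz: "p \<noteq> 0 \<or> q \<noteq> 0"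
    using u by (auto simp: pq M algebra_simps zero_prod_def)
  have "((a - 1) * (d - 1) - b * c) * p = (d - 1) * ((a - 1) * p + b * q) - b * (c * p + (d - 1) * q)"
    "((a - 1) * (d - 1) - b * c) * q = (a - 1) * (c * p + (d - 1) * q) - c * ((a - 1) * p + b * q)"
    by (simp_all add: algebra_simps)
  then have D: "(a - 1) * (d - 1) - b * c = 0" using nz unfolding k by auto
  have tr: "a + d = 2" using D dt by (simp add: algebra_simps)
  have d: "d = 2 - a" using tr by simp
  have bc: "c * b = - ((a - 1) * (a - 1))" using D by (simp add: d algebra_simps)
  obtain x1 x2 where x: "x = (x1, x2)" by (cases x)
  have p: "M x - x = ((a - 1) * x1 + b * x2, c * x1 + (1 - a) * x2)"
    by (simp add: x M d algebra_simps)
  have "(a - 1) * ((a - 1) * x1 + b * x2) + b * (c * x1 + (1 - a) * x2) = ((a - 1) * (a - 1) + c * b) * x1"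
    "c * ((a - 1) * x1 + b * x2) + (1 - a) * (c * x1 + (1 - a) * x2) = (c * b + (a - 1) * (a - 1)) * x2"
    by (simp_all add: algebra_simps)
  then have "(a - 1) * ((a - 1) * x1 + b * x2) + b * (c * x1 + (1 - a) * x2) = 0"
    "c * ((a - 1) * x1 + b * x2) + (1 - a) * (c * x1 + (1 - a) * x2) = 0"
    unfolding bc by simp_all
  then show ?thesis unfolding p M d by (simp add: left_diff_distrib)
qed

lemma shear_iterate:
  fixes M :: "(real \<times> real) \<Rightarrow>\<^sub>L (real \<times> real)"
  assumes "\<And>x. M (M x - x) = M x - x"
  shows "(blinfun_apply M ^^ n) x = x + real n *\<^sub>R (M x - x)"
proof (induction n)
  case (Suc n)
  have "(blinfun_apply M ^^ Suc n) x = M x + real n *\<^sub>R (M x - x)"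
    by (simp add: Suc blinfun.add_right blinfun.scaleR_right assms)
  then show ?case by (simp add: scaleR_add_left)
qed simp

lemma iterate_derivative_at_fixed_point:
  assumes P: "C1_map P P'" and z: "P z = z"
  shows "(P ^^ n has_derivative (blinfun_apply (P' z) ^^ n)) (at z)"
proof (induction n)
  case (Suc n)
  have "(P ^^ n) z = z" by (induction n) (auto simp: z)
  then show ?case using diff_chain_at[OF Suc, of P "P' z"] C1_map_deriv[OF P, of z]
    by (simp only: funpow.simps)
qed (simp add: id_def)

section \<open>Area preserving twist maps with an invariant foliation\<close>

text \<open>\<open>F\<close> is a lift of the twist diffeomorphism, \<open>Fi\<close> its inverse, and the leaves are the graphs of the
  functions \<open>e c\<close>.\<close>

locale twist_plane = leaf_family e for e +
  fixes F Fi :: "real \<times> real \<Rightarrow> real \<times> real" and F' Fi'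
  assumes F_sympl: "C1_symplectic F F'" and Fi_C1: "C1_map Fi Fi'"
    and inv: "F (Fi z) = z" "Fi (F z) = z"
    and F_shift: "F (z + (1, 0)) = F z + (1, 0)"
    and F_twist: "0 < fst (F' z (0, 1))"
    and F_fibre: "r < r' \<Longrightarrow> fst (F (t, r)) < fst (F (t, r'))"
    and F_leaf: "snd (F (t, e c t)) = e c (fst (F (t, e c t)))"
    and e_onto: "\<exists>c. e c t = r"
begin

definition g :: "real \<Rightarrow> real \<Rightarrow> real" where "g c t = fst (F (t, e c t))"

lemma F_C1: "C1_map F F'" using F_sympl by (simp add: C1_symplectic_iff)

lemma F_graph: "F (t, e c t) = (g c t, e c (g c t))"
  by (simp add: g_def prod_eq_iff F_leaf)

lemma F_inj: "inj F" by (metis injI inv(2))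

lemma e_le: "c1 \<le> c2 \<Longrightarrow> e c1 t \<le> e c2 t"
  using e_less[of c1 c2 t] by (cases "c1 = c2") auto

definition band :: "real \<Rightarrow> real \<Rightarrow> real \<Rightarrow> real \<Rightarrow> (real \<times> real) set"
  where "band c1 c2 s t = {z. s \<le> fst z \<and> fst z \<le> t \<and> e c1 (fst z) \<le> snd z \<and> snd z \<le> e c2 (fst z)}"

lemma closed_band: "closed (band c1 c2 s t)"
  unfolding band_def
  by (intro closed_Collect_conj closed_Collect_le continuous_intros
      continuous_on_compose2[OF e_cont1[of UNIV]]) auto

lemma compact_band: "compact (band c1 c2 s t)"
proof (cases "s \<le> t")
  case True
  have ne: "{s..t} \<noteq> {}" using True by simp
  obtain x where x: "\<And>y. y \<in> {s..t} \<Longrightarrow> e c1 x \<le> e c1 y"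
    using continuous_attains_inf[OF compact_Icc ne e_cont1] by blast
  obtain x' where x': "\<And>y. y \<in> {s..t} \<Longrightarrow> e c2 y \<le> e c2 x'"
    using continuous_attains_sup[OF compact_Icc ne e_cont1] by blast
  have "band c1 c2 s t \<subseteq> cbox (s, e c1 x) (t, e c2 x')"
  proof
    fix z assume "z \<in> band c1 c2 s t"
    then show "z \<in> cbox (s, e c1 x) (t, e c2 x')"
      using x[of "fst z"] x'[of "fst z"] by (cases z) (auto simp: band_def cbox_Pair_eq)
  qed
  then show ?thesis using closed_band by (meson bounded_cbox bounded_subset compact_eq_bounded_closed)
next
  case False
  then have "band c1 c2 s t = {}" by (auto simp: band_def)
  then show ?thesis by simp
qed

lemma measure_band:
  assumes c: "c1 < c2" and st: "s \<le> t"
  shows "measure lebesgue (band c1 c2 s t) = v c1 c2 t - v c1 c2 s"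
proof -
  let ?B = "band c1 c2 s t"
  have B: "?B \<in> sets borel" using compact_band by (simp add: borel_compact)
  have sec: "Pair x -` ?B = (if x \<in> {s..t} then {e c1 x..e c2 x} else {})" for x
    by (auto simp: band_def)
  have "emeasure lborel ?B = emeasure (lborel \<Otimes>\<^sub>M lborel) ?B" by (simp add: lborel_prod)
  also have "\<dots> = (\<integral>\<^sup>+ x. emeasure lborel (Pair x -` ?B) \<partial>lborel)"
    by (rule sigma_finite_measure.emeasure_pair_measure_alt[OF sigma_finite_lborel])
      (use B in \<open>simp only: lborel_prod sets_lborel\<close>)
  also have "\<dots> = (\<integral>\<^sup>+ x. ennreal (e c2 x - e c1 x) * indicator {s..t} x \<partial>lborel)"
    by (intro nn_integral_cong) (use e_le[of c1 c2] c in \<open>auto simp: sec\<close>)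
  also have "\<dots> = ennreal (v c1 c2 t - v c1 c2 s)"
  proof (rule nn_integral_FTC_Icc)
    have "continuous_on UNIV (\<lambda>x. e c2 x - e c1 x)" by (intro continuous_intros e_cont1)
    then show "(\<lambda>x. e c2 x - e c1 x) \<in> borel_measurable borel" by (rule borel_measurable_continuous_onI)
    show "(v c1 c2 has_real_derivative e c2 x - e c1 x) (at x)" for x
      by (rule v_deriv)
    show "0 \<le> e c2 x - e c1 x" for x using e_le[of c1 c2 x] c by simp
  qed (use st in auto)
  finally have "measure lborel ?B = v c1 c2 t - v c1 c2 s"
    using v_le[OF c st] by (simp add: measure_def)
  then show ?thesis using B by (simp add: measure_completion)
qed

lemma e_convergent:
  assumes "0 < \<epsilon>"
  obtains d where "0 < d" "\<And>c s t. \<bar>c - c0\<bar> < d \<Longrightarrow> \<bar>s - t\<bar> < d \<Longrightarrow> \<bar>e c s - e c0 t\<bar> < \<epsilon>"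
proof -
  have "(\<lambda>z. e (snd z) (fst z)) (t + 1, c) = (\<lambda>z. e (snd z) (fst z)) (t, c)" for t c :: real
    by (simp add: e_per)
  then show ?thesis
    using periodic_uniformly_continuous[OF e_cont _ assms, where ?c0.0 = c0] that
    by (metis (mono_tags, lifting) fst_conv snd_conv)
qed

text \<open>The axiom \<open>flux\<close> is the inclusion of \<open>F ` band c1 c2 s t\<close> in \<open>band c1 c2 (g c1 s) (g c2 t)\<close>: by the
  twist, the lowest leaf at \<open>s\<close> is moved furthest to the left and the highest leaf at \<open>t\<close> furthest to
  the right.\<close>

lemma g_family: "twist_family e g"
proof unfold_locales
  show gc: "continuous_on UNIV (\<lambda>z::real \<times> real. g (snd z) (fst z))"
    unfolding g_def
    by (intro continuous_on_fst continuous_on_compose2[OF C1_map_continuous[OF F_C1, of UNIV]]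
        continuous_on_Pair continuous_on_fst continuous_on_id e_cont) auto
  have per: "g c (t + 1) = g c t + 1" for c t
    using F_shift[of "(t, e c t)"] by (simp add: g_def e_per)
  then show "g c (t + 1) = g c t + 1" for c t .
  have "strict_mono (g c)" for c
  proof (rule strict_mono_lift[of "g c", OF _ _ per])
    show "continuous_on UNIV (g c)"
      using continuous_on_compose2[OF gc, of UNIV "\<lambda>t. (t, c)"] by (simp add: continuous_intros)
    show "inj (g c)"
      by (rule injI) (metis F_graph F_inj injD fst_conv)
  qed
  then have less: "s < t \<Longrightarrow> g c s < g c t" for s t c by (simp add: strict_mono_def)
  then show "s < t \<Longrightarrow> g c s < g c t" for s t c .
  show tw: "g c1 t < g c2 t" if "c1 < c2" for c1 c2 t
    unfolding g_def by (rule F_fibre[OF e_less[OF that]])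
  show "v c1 c2 t - v c1 c2 s \<le> v c1 c2 (g c2 t) - v c1 c2 (g c1 s)" if c: "c1 < c2" and st: "s \<le> t" for c1 c2 s t
  proof -
    have le: "g c x \<le> g c y" if "x \<le> y" for c x y using less[of x y c] that by (cases "x = y") auto
    have tle: "g c x \<le> g c' x" if "c \<le> c'" for c c' x using tw[of c c' x] that by (cases "c = c'") auto
    have gst: "g c1 s \<le> g c2 t" using le[OF st, of c1] tw[OF c, of t] by simp
    have "F ` band c1 c2 s t \<subseteq> band c1 c2 (g c1 s) (g c2 t)"
    proof (rule image_subsetI)
      fix z assume z: "z \<in> band c1 c2 s t"
      obtain x r where xr: "z = (x, r)" by (cases z)
      obtain c where cr: "e c x = r" using e_onto by blast
      have x: "s \<le> x" "x \<le> t" "e c1 x \<le> e c x" "e c x \<le> e c2 x" using z by (auto simp: xr band_def cr)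
      have cc: "c1 \<le> c" "c \<le> c2" using x e_less[of c c1 x] e_less[of c2 c x] by (meson leD leI)+
      have "g c1 s \<le> g c x" using le[OF x(1), of c1] tle[OF cc(1), of x] by simp
      moreover have "g c x \<le> g c2 t" using le[OF x(2), of c2] tle[OF cc(2), of x] by simp
      ultimately show "F z \<in> band c1 c2 (g c1 s) (g c2 t)"
        using cc e_le by (simp add: xr cr[symmetric] F_graph band_def)
    qed
    then have "measure lebesgue (F ` band c1 c2 s t) \<le> measure lebesgue (band c1 c2 (g c1 s) (g c2 t))"
      by (intro measure_mono_fmeasurable lmeasurable_compact fmeasurableD compact_band
          compact_continuous_image C1_map_continuous[OF F_C1])
    then show ?thesis
      using measure_C1_symplectic_image[OF F_sympl inj_on_subset[OF F_inj] compact_band, of c1 c2 s t]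
        measure_band[OF c st] measure_band[OF c gst] by simp
  qed
qed

sublocale g: twist_family e g by (rule g_family)

end

lemma abs_fst_le_norm: "\<bar>fst u\<bar> \<le> norm u" for u :: "real \<times> real"
  using norm_fst_le[of "fst u" "snd u"] by simp

lemma (in twist_family) iterate:
  "twist_family e (\<lambda>c t. (g c ^^ Suc n) t - of_int p)"
proof unfold_locales
  have 1: "(s < t \<longrightarrow> (g c ^^ m) s < (g c ^^ m) t) \<and> (g c ^^ m) (t + 1) = (g c ^^ m) t + 1" for c s t m
    by (induction m) (auto simp: g_less g_per)
  then show "s < t \<Longrightarrow> (g c ^^ Suc n) s - of_int p < (g c ^^ Suc n) t - of_int p" for s t c
    using 1[of s t "Suc n" c] by simp
  show "(g c ^^ Suc n) (t + 1) - of_int p = (g c ^^ Suc n) t - of_int p + 1" for c t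
    using 1[of 0 t "Suc n" c] by simp
  have "continuous_on UNIV (\<lambda>z::real \<times> real. (g (snd z) ^^ m) (fst z))" for m
  proof (induction m)
    case (Suc m)
    have "continuous_on UNIV (\<lambda>z::real \<times> real. (\<lambda>z. g (snd z) (fst z)) ((g (snd z) ^^ m) (fst z), snd z))"
      by (rule continuous_on_compose2[OF g_cont]) (auto intro!: continuous_intros Suc)
    then show ?case by simp
  qed (auto intro: continuous_intros)
  then show "continuous_on UNIV (\<lambda>z::real \<times> real. (g (snd z) ^^ Suc n) (fst z) - of_int p)"
    by (intro continuous_intros)
  show "(g c1 ^^ Suc n) t - of_int p < (g c2 ^^ Suc n) t - of_int p" if c: "c1 < c2" for c1 c2 t
  proof -
    have "(g c1 ^^ Suc n) t < (g c2 ^^ Suc n) t"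
    proof (induction n)
      case (Suc n)
      then show ?case using g_less[OF Suc, of c1] g_twist[OF c, of "(g c2 ^^ Suc n) t"] by simp
    qed (simp add: g_twist c)
    then show ?thesis by simp
  qed
  show "v c1 c2 t - v c1 c2 s \<le> v c1 c2 ((g c2 ^^ Suc n) t - of_int p) - v c1 c2 ((g c1 ^^ Suc n) s - of_int p)"
    if c: "c1 < c2" and st: "s \<le> t" for c1 c2 s t
  proof -
    have "(g c1 ^^ m) s \<le> (g c2 ^^ m) t \<and> v c1 c2 t - v c1 c2 s \<le> v c1 c2 ((g c2 ^^ m) t) - v c1 c2 ((g c1 ^^ m) s)" for m
    proof (induction m)
      case (Suc m)
      have le: "(g c1 ^^ m) s \<le> (g c2 ^^ m) t" using Suc by simp
      show ?case using Suc flux[OF c le] g_le[OF le, of c1] g_twist[OF c, of "(g c2 ^^ m) t"] by simp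
    qed (use st in simp)
    then show ?thesis
      using v_per_int[of c1 c2 "(g c2 ^^ Suc n) t" "-p"] v_per_int[of c1 c2 "(g c1 ^^ Suc n) s" "-p"] by (smt (verit) diff_conv_add_uminus of_int_minus)
  qed
qed

section \<open>The first order dynamics at a leaf of periodic points\<close>

context twist_plane
begin

lemma F_iterate_graph: "(F ^^ n) (t, e c t) = ((g c ^^ n) t, e c ((g c ^^ n) t))"
  by (induction n) (auto simp: F_graph)

lemma e_per_int: "e c (t + of_int k) = e c t"
  using degree_one_int[of "\<lambda>t. e c t + t" t k] by (simp add: e_per)

text \<open>Pushing a vertical vector forward by the iterates never makes its first component negative,
  and a vanishing first component would become negative one step later or earlier.\<close>

lemma iterate_twist_pos: "0 < fst (iter_deriv F F' (Suc n) z (0, 1))"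
proof -
  have nonneg: "0 \<le> fst (iter_deriv F F' j z (0, 1))" for j
  proof -
    obtain t r where z: "z = (t, r)" by (cases z)
    have "((\<lambda>h. (F ^^ j) (t, r + h)) has_derivative (\<lambda>h. iter_deriv F F' j z (0, h))) (at 0)"
    proof -
      have d: "(F ^^ j has_derivative iter_deriv F F' j z) (at (t, r + 0))"
        using C1_map_deriv[OF C1_map_iterate[OF F_C1]] by (simp add: z)
      show ?thesis
        by (rule has_derivative_compose[where f = "\<lambda>h. (t, r + h)", OF _ d])
          (auto intro!: derivative_eq_intros)
    qed
    from has_derivative_fst[OF this]
    have "((\<lambda>h. fst ((F ^^ j) (t, r + h))) has_real_derivative fst (iter_deriv F F' j z (0, 1))) (at 0)"
      unfolding has_field_derivative_def
    proof (rule has_derivative_eq_rhs, intro ext)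
      fix h show "fst (iter_deriv F F' j z (0, h)) = fst (iter_deriv F F' j z (0, 1)) * h"
        by (subst blinfun_plane_apply) simp
    qed
    moreover have "fst ((F ^^ j) (t, r + h)) \<ge> fst ((F ^^ j) (t, r))" if "0 < h" for h
    proof -
      obtain c1 c2 where c: "e c1 t = r" "e c2 t = r + h" using e_onto by meson
      have c12: "c1 < c2"
      proof (rule ccontr)
        assume "\<not> c1 < c2"
        then have "e c2 t \<le> e c1 t" by (intro e_le) simp
        then show False using c that by simp
      qed
      have "(g c1 ^^ j) t \<le> (g c2 ^^ j) t"
      proof (cases j)
        case (Suc n)
        interpret it: twist_family e "\<lambda>c t. (g c ^^ Suc n) t - of_int 0" by (rule g.iterate)
        show ?thesis using it.g_twist[OF c12, of t] by (simp add: Suc)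
      qed simp
      then show ?thesis using F_iterate_graph[of j t c1] F_iterate_graph[of j t c2] c by simp
    qed
    ultimately show ?thesis
    proof (intro leI notI)
      assume der: "((\<lambda>h. fst ((F ^^ j) (t, r + h))) has_real_derivative fst (iter_deriv F F' j z (0, 1))) (at 0)"
        and mono: "\<And>h. 0 < h \<Longrightarrow> fst ((F ^^ j) (t, r)) \<le> fst ((F ^^ j) (t, r + h))"
        and neg: "fst (iter_deriv F F' j z (0, 1)) < 0"
      obtain d where d: "0 < d" "\<And>h. 0 < h \<Longrightarrow> h < d \<Longrightarrow> fst ((F ^^ j) (t, r + (0 + h))) < fst ((F ^^ j) (t, r + 0))"
        using DERIV_neg_dec_right[OF der neg] by blast
      show False using d(2)[of "d / 2"] mono[of "d / 2"] d(1) by simp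
    qed
  qed
  obtain x y where xy: "iter_deriv F F' (Suc n) z (0, 1) = (x, y)" by (cases "iter_deriv F F' (Suc n) z (0, 1)")
  have "x \<noteq> 0"
  proof
    assume x0: "x = 0"
    have "area_form z (iter_deriv F F' (Suc n) z (1, 0)) (x, y) = 1"
      using C1_symplectic_iterate[OF F_sympl, of "Suc n"] xy unfolding C1_symplectic_iff by metis
    then have "y \<noteq> 0" using x0 by (auto simp: area_form_def)
    have "iter_deriv F F' (Suc (Suc n)) z (0, 1) = F' ((F ^^ Suc n) z) (0, y)"
      using xy x0 by (simp add: blinfun_compose.rep_eq)
    also have "\<dots> = y *\<^sub>R F' ((F ^^ Suc n) z) (0, 1)" by (subst blinfun_plane_apply) simp
    finally have "0 \<le> y * fst (F' ((F ^^ Suc n) z) (0, 1))" using nonneg[of "Suc (Suc n)"] by simp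
    then have "0 \<le> y" using F_twist by (simp add: zero_le_mult_iff not_le[symmetric])
    let ?M = "F' ((F ^^ n) z)" and ?w = "iter_deriv F F' n z (0, 1)"
    have w: "?M ?w = (0, y)" using xy x0 by (simp add: blinfun_compose.rep_eq)
    have "area_form z (?M (0, 1)) (?M ?w) = area_form z (0, 1) ?w"
      by (rule C1_symplectic_area[OF F_sympl])
    then have "fst (?M (0, 1)) * y = - fst ?w" unfolding w by (simp add: area_form_def)
    then have "fst (?M (0, 1)) * y \<le> 0" using nonneg[of n] by simp
    then have "y \<le> 0" using F_twist[of "(F ^^ n) z"] by (simp add: mult_le_0_iff)
    then show False using \<open>y \<noteq> 0\<close> \<open>0 \<le> y\<close> by simp
  qed
  then show ?thesis using nonneg[of "Suc n"] by (simp add: xy del: iter_deriv.simps)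
qed

context
  fixes n :: nat and p :: int and c0 :: real
  assumes periodic: "\<And>t. (g c0 ^^ Suc n) t = t + of_int p"
begin

text \<open>\<open>G\<close> is an iterate of \<open>F\<close>, translated back so that it fixes the leaf \<open>c0\<close> pointwise, with inverse \<open>Gi\<close>
  and leaf dynamics \<open>\<gamma>\<close>. The functions \<open>a1\<close> and \<open>b\<close> are the first row of \<open>G' - 1\<close> along that leaf.\<close>

definition G :: "real \<times> real \<Rightarrow> real \<times> real" where "G z = (F ^^ Suc n) z - (of_int p, 0)"
definition G' where "G' = iter_deriv F F' (Suc n)"
definition Gi :: "real \<times> real \<Rightarrow> real \<times> real" where "Gi z = (Fi ^^ Suc n) (z + (of_int p, 0))"
definition \<gamma> :: "real \<Rightarrow> real \<Rightarrow> real" where "\<gamma> c t = (g c ^^ Suc n) t - of_int p"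
definition b :: "real \<Rightarrow> real" where "b t = fst (G' (t, e c0 t) (0, 1))"
definition a1 :: "real \<Rightarrow> real" where "a1 t = fst (G' (t, e c0 t) (1, 0)) - 1"

lemma \<gamma>_family: "twist_family e \<gamma>"
  using g.iterate[of n p] by (simp add: \<gamma>_def[abs_def])

interpretation \<gamma>: twist_family e \<gamma> by (rule \<gamma>_family)

lemma G_sympl: "C1_symplectic G G'"
proof -
  have "(G has_derivative blinfun_apply (G' z)) (at z)" for z
    unfolding G_def[abs_def] G'_def
    using has_derivative_diff[OF C1_map_deriv[OF C1_map_iterate[OF F_C1, of "Suc n"]] has_derivative_const]
    by (simp del: funpow.simps iter_deriv.simps)
  then show ?thesis
    using C1_symplectic_iterate[OF F_sympl, of "Suc n"] unfolding C1_symplectic_def G'_def by blast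
qed

lemma G_C1: "C1_map G G'" using G_sympl by (simp add: C1_symplectic_iff)

lemma iterate_shift:
  fixes P :: "real \<times> real \<Rightarrow> real \<times> real"
  assumes "\<And>z. P (z + (1, 0)) = P z + (1, 0)"
  shows "(P ^^ m) (z + (1, 0)) = (P ^^ m) z + (1, 0)"
  by (induction m) (auto simp: assms)

lemma G_shift: "G (z + (1, 0)) = G z + (1, 0)"
  unfolding G_def iterate_shift[of F, OF F_shift] by simp

lemma iterate_inverse: "(F ^^ m) ((Fi ^^ m) z) = z" "(Fi ^^ m) ((F ^^ m) z) = z"
proof (induction m arbitrary: z)
  case (Suc m)
  { case 1
    have "(F ^^ Suc m) ((Fi ^^ Suc m) z) = (F ^^ m) (F (Fi ((Fi ^^ m) z)))"
      by (simp only: funpow_swap1 funpow.simps comp_apply)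
    then show ?case by (simp only: inv Suc) }
  { case 2
    have "(Fi ^^ Suc m) ((F ^^ Suc m) z) = (Fi ^^ m) (Fi (F ((F ^^ m) z)))"
      by (simp only: funpow_swap1 funpow.simps comp_apply)
    then show ?case by (simp only: inv Suc) }
qed simp_all

lemma G_inv: "G (Gi z) = z" "Gi (G z) = z"
  unfolding G_def Gi_def iterate_inverse by (simp_all add: iterate_inverse del: funpow.simps)

lemma Gi_shift: "Gi (z + (1, 0)) = Gi z + (1, 0)"
  using G_shift[of "Gi z"] G_inv(2)[of "Gi z + (1, 0)"] by (simp add: G_inv(1))

lemma Gi_C1: obtains Gi' where "C1_map Gi Gi'"
proof -
  have s: "C1_map (\<lambda>z. z + (of_int p, 0)) (\<lambda>z. id_blinfun)"
    unfolding C1_map_def by (auto intro!: derivative_eq_intros continuous_on_const simp: id_blinfun.rep_eq)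
  have "C1_map ((Fi ^^ Suc n) \<circ> (\<lambda>z. z + (of_int p, 0))) (\<lambda>z. iter_deriv Fi Fi' (Suc n) (z + (of_int p, 0)) o\<^sub>L id_blinfun)"
    by (rule C1_map_comp[OF C1_map_iterate[OF Fi_C1] s])
  moreover have "(Fi ^^ Suc n) \<circ> (\<lambda>z. z + (of_int p, 0)) = Gi" by (auto simp: Gi_def)
  ultimately show ?thesis using that by metis
qed

lemma G_graph: "G (t, e c t) = (\<gamma> c t, e c (\<gamma> c t))"
  using e_per_int[of c "(g c ^^ Suc n) t" "- p"]
  unfolding G_def F_iterate_graph \<gamma>_def by (simp del: funpow.simps)

lemma G_iterate_graph: "(G ^^ m) (t, e c t) = ((\<gamma> c ^^ m) t, e c ((\<gamma> c ^^ m) t))"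
  by (induction m) (auto simp: G_graph)

lemma \<gamma>_id: "\<gamma> c0 t = t" by (simp add: \<gamma>_def periodic del: funpow.simps)

lemma G_fixed: "G (t, e c0 t) = (t, e c0 t)" by (simp add: G_graph \<gamma>_id)

lemma Gi_fixed: "Gi (t, e c0 t) = (t, e c0 t)" by (metis G_fixed G_inv(2))

lemma e_graph_continuous: "continuous_on S (\<lambda>t. (t, e c t))"
  by (intro continuous_intros e_cont1)

lemma G'_graph_continuous: "continuous_on UNIV (\<lambda>t. G' (t, e c0 t))"
proof -
  have "continuous_on UNIV G'" using G_C1 by (simp add: C1_map_def)
  from continuous_on_compose2[OF this e_graph_continuous[of UNIV c0]] show ?thesis by simp
qed

lemma G'_graph_periodic: "G' (t + 1, e c0 (t + 1)) = G' (t, e c0 t)"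
  using shift_derivative[OF G_C1 G_shift, of "(t, e c0 t)" 1] by (simp add: e_per)

lemma b_cont: "continuous_on UNIV b" and a1_cont: "continuous_on UNIV a1"
  unfolding b_def a1_def by (intro continuous_intros G'_graph_continuous)+

lemma b_pos: "0 < b t" unfolding b_def G'_def by (rule iterate_twist_pos)

lemma b_per: "b (t + 1) = b t" and a1_per: "a1 (t + 1) = a1 t"
  unfolding b_def a1_def G'_graph_periodic by simp_all

lemma G'_fst: "fst (G' (t, e c0 t) (x, y)) - x = a1 t * x + b t * y"
  by (subst blinfun_plane_apply) (simp add: a1_def b_def algebra_simps)

text \<open>The fixed points accumulate along the leaf, so the derivative at each of them has the
  eigenvalue \<open>1\<close>.\<close>

lemma G'_fixed_vector: "\<exists>u. G' (t, e c0 t) u = u \<and> u \<noteq> 0"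
proof (rule ccontr)
  assume no: "\<not> ?thesis"
  let ?z = "(t, e c0 t)" and ?L = "\<lambda>u. G' (t, e c0 t) u - u"
  have bl: "bounded_linear ?L" by (intro bounded_linear_sub blinfun.bounded_linear_right bounded_linear_ident)
  then have lin: "linear ?L" by (rule bounded_linear.linear)
  have "inj ?L" unfolding linear_injective_0[OF lin] using no by auto
  then obtain k where k: "0 < k" "\<And>u. k * norm u \<le> norm (?L u)"
    using linear_inj_bounded_below_pos[OF lin] by blast
  have "((\<lambda>z. G z - z) has_derivative ?L) (at ?z)"
    by (intro has_derivative_diff C1_map_deriv[OF G_C1] has_derivative_ident)
  then obtain d where d: "0 < d" "\<And>y. norm (y - ?z) < d \<Longrightarrow>
      norm ((G y - y) - (G ?z - ?z) - ?L (y - ?z)) \<le> k / 2 * norm (y - ?z)"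
    using k(1) unfolding has_derivative_at_alt by (meson half_gt_zero)
  obtain d' where d': "0 < d'" "\<And>s. \<bar>s - t\<bar> < d' \<Longrightarrow> \<bar>e c0 s - e c0 t\<bar> < d / 2"
    using e_convergent[of "d / 2" c0] d(1) by (metis abs_zero diff_self half_gt_zero)
  define s where "s = t + min (d' / 2) (d / 4)"
  have s: "s \<noteq> t" "\<bar>s - t\<bar> < d'" "\<bar>s - t\<bar> < d / 2" using d(1) d'(1) by (auto simp: s_def min_def)
  let ?y = "(s, e c0 s)"
  have "norm (?y - ?z) < d" using norm_Pair_le[of "s - t" "e c0 s - e c0 t"] s d'(2)[OF s(2)] by simp
  then have "norm (?L (?y - ?z)) \<le> k / 2 * norm (?y - ?z)"
    using d(2)[of ?y] by (simp only: G_fixed diff_self diff_0_right diff_0 norm_minus_cancel)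
  then have "k * norm (?y - ?z) \<le> k / 2 * norm (?y - ?z)" using k(2)[of "?y - ?z"] by linarith
  moreover have "0 < norm (?y - ?z)" using s(1) by (simp add: zero_prod_def)
  ultimately show False using k(1) by simp
qed

lemma G'_shear: "G' (t, e c0 t) (G' (t, e c0 t) x - x) = G' (t, e c0 t) x - x"
  using G'_fixed_vector[of t] shear_of_fixed_vector[of "(t, e c0 t)" "G' (t, e c0 t)"] G_sympl
  unfolding C1_symplectic_def by metis

lemma Gi'_shear:
  assumes Gi': "C1_map Gi Gi'"
  shows "Gi' (t, e c0 t) x - x = - (G' (t, e c0 t) x - x)"
    and "Gi' (t, e c0 t) (Gi' (t, e c0 t) x - x) = Gi' (t, e c0 t) x - x"
proof -
  let ?z = "(t, e c0 t)"
  have "(Gi \<circ> G has_derivative Gi' ?z \<circ> G' ?z) (at ?z)"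
    using diff_chain_at[OF C1_map_deriv[OF G_C1, of ?z], of Gi "Gi' ?z"] C1_map_deriv[OF Gi', of ?z]
    by (simp only: G_fixed)
  moreover have "Gi \<circ> G = (\<lambda>z. z)" by (auto simp: G_inv)
  ultimately have "Gi' ?z \<circ> G' ?z = (\<lambda>x. x)"
    using has_derivative_unique[OF _ has_derivative_ident] by metis
  then have inv: "Gi' ?z (G' ?z x) = x" for x by (metis comp_apply)
  have 1: "Gi' ?z (G' ?z x - x) = G' ?z x - x" for x
    by (metis inv G'_shear)
  show 2: "Gi' ?z x - x = - (G' ?z x - x)" for x
    using 1[of x] by (simp add: blinfun.diff_right inv algebra_simps)
  show "Gi' ?z (Gi' ?z x - x) = Gi' ?z x - x"
    unfolding 2 by (simp only: blinfun.minus_right 1)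
qed

lemma \<gamma>_iterate_less: "s < t \<Longrightarrow> (\<gamma> c ^^ m) s < (\<gamma> c ^^ m) t"
  by (induction m) (auto simp: \<gamma>.g_less)

lemma Gi_iterate_less:
  assumes st: "s < t"
  shows "fst ((Gi ^^ m) (s, e c s)) < fst ((Gi ^^ m) (t, e c t))"
proof -
  have "\<exists>u. (Gi ^^ m) (x, e c x) = (u, e c u) \<and> (\<gamma> c ^^ m) u = x" for x
  proof (induction m)
    case (Suc m)
    then obtain u where u: "(Gi ^^ m) (x, e c x) = (u, e c u)" "(\<gamma> c ^^ m) u = x" by blast
    obtain y where y: "\<gamma> c y = u"
      using degree_one_surj[of "\<gamma> c" u] \<gamma>.g_per continuous_on_compose2[OF \<gamma>.g_cont, of UNIV "\<lambda>t. (t, c)"]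
      by (auto simp: continuous_intros)
    have "Gi (u, e c u) = (y, e c y)" using G_graph[of y c] G_inv(2) y by metis
    then show ?case using u y by (intro exI[of _ y]) (simp add: funpow_swap1)
  qed simp
  then obtain us ut where u: "(Gi ^^ m) (s, e c s) = (us, e c us)" "(\<gamma> c ^^ m) us = s"
    "(Gi ^^ m) (t, e c t) = (ut, e c ut)" "(\<gamma> c ^^ m) ut = t" by meson
  have "us < ut"
  proof (rule ccontr)
    assume "\<not> us < ut"
    then have "(\<gamma> c ^^ m) ut \<le> (\<gamma> c ^^ m) us" using \<gamma>_iterate_less[of ut us m c] by (cases "ut = us") auto
    then show False using u st by simp
  qed
  then show ?thesis by (simp add: u)
qed

text \<open>The iterates \<open>G ^^ N\<close> and their inverses are increasing on every leaf. As the derivative of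
  \<open>G ^^ N\<close> at the fixed leaf is a shear growing linearly in \<open>N\<close>, this confines the slopes of nearby
  leaves to a cone of width \<open>O(1 / N)\<close> around the tangent of the fixed leaf.\<close>

lemma slope_cone:
  assumes N: "0 < N"
  obtains d where "0 < d" "\<And>c s t. \<bar>c - c0\<bar> < d \<Longrightarrow> s \<le> t \<Longrightarrow> t - s < d \<Longrightarrow>
    real N * \<bar>a1 s * (t - s) + b s * (e c t - e c s)\<bar> \<le> 2 * (t - s) + \<bar>e c t - e c s\<bar>"
proof -
  obtain Gi' where Gi': "C1_map Gi Gi'" by (rule Gi_C1)
  obtain d1 where d1: "0 < d1" "\<And>t x y. dist x (t, e c0 t) < d1 \<Longrightarrow> dist y (t, e c0 t) < d1 \<Longrightarrow>
    norm ((G ^^ N) y - (G ^^ N) x - iter_deriv G G' N (t, e c0 t) (y - x)) \<le> 1 * norm (y - x)"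
    by (rule strict_derivative_along_graph[OF C1_map_iterate[OF G_C1] iterate_shift[of G, OF G_shift] e_cont1[of UNIV c0] e_per zero_less_one], rule that)
  obtain d2 where d2: "0 < d2" "\<And>t x y. dist x (t, e c0 t) < d2 \<Longrightarrow> dist y (t, e c0 t) < d2 \<Longrightarrow>
    norm ((Gi ^^ N) y - (Gi ^^ N) x - iter_deriv Gi Gi' N (t, e c0 t) (y - x)) \<le> 1 * norm (y - x)"
    by (rule strict_derivative_along_graph[OF C1_map_iterate[OF Gi'] iterate_shift[of Gi, OF Gi_shift] e_cont1[of UNIV c0] e_per zero_less_one], rule that)
  have DG: "iter_deriv G G' N (t, e c0 t) x = x + real N *\<^sub>R (G' (t, e c0 t) x - x)" for t x
  proof -
    have "blinfun_apply (iter_deriv G G' N (t, e c0 t)) = blinfun_apply (G' (t, e c0 t)) ^^ N"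
      by (rule has_derivative_unique[OF C1_map_deriv[OF C1_map_iterate[OF G_C1]] iterate_derivative_at_fixed_point[OF G_C1 G_fixed]])
    then show ?thesis by (simp only: shear_iterate[OF G'_shear])
  qed
  have DGi: "iter_deriv Gi Gi' N (t, e c0 t) x = x - real N *\<^sub>R (G' (t, e c0 t) x - x)" for t x
  proof -
    have "blinfun_apply (iter_deriv Gi Gi' N (t, e c0 t)) = blinfun_apply (Gi' (t, e c0 t)) ^^ N"
      by (rule has_derivative_unique[OF C1_map_deriv[OF C1_map_iterate[OF Gi']] iterate_derivative_at_fixed_point[OF Gi' Gi_fixed]])
    then have "iter_deriv Gi Gi' N (t, e c0 t) x = x + real N *\<^sub>R (Gi' (t, e c0 t) x - x)"
      by (simp only: shear_iterate[OF Gi'_shear(2)[OF Gi']])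
    also have "Gi' (t, e c0 t) x - x = - (G' (t, e c0 t) x - x)" by (rule Gi'_shear(1)[OF Gi'])
    finally show ?thesis by (simp only: scaleR_minus_right diff_conv_add_uminus)
  qed
  let ?d = "min d1 d2 / 2"
  have d: "0 < ?d" using d1 d2 by simp
  obtain d3 where d3: "0 < d3" "\<And>c s t. \<bar>c - c0\<bar> < d3 \<Longrightarrow> \<bar>s - t\<bar> < d3 \<Longrightarrow> \<bar>e c s - e c0 t\<bar> < ?d"
    using e_convergent[OF d] by blast
  show ?thesis
  proof (rule that[of "min d3 ?d"])
    show "0 < min d3 ?d" using d3 d by simp
    fix c s t assume c: "\<bar>c - c0\<bar> < min d3 ?d" and st: "s \<le> t" "t - s < min d3 ?d"
    let ?z = "(s, e c0 s)" and ?x = "(s, e c s)" and ?y = "(t, e c t)"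
    let ?l = "a1 s * (t - s) + b s * (e c t - e c s)"
    have "\<bar>e c s - e c0 s\<bar> < ?d" "\<bar>e c t - e c0 s\<bar> < ?d" using d3(2)[of c s s] d3(2)[of c t s] c st by auto
    then have dz: "dist ?x ?z < 2 * ?d" "dist ?y ?z < 2 * ?d"
      using norm_Pair_le[of "s - s" "e c s - e c0 s"] norm_Pair_le[of "t - s" "e c t - e c0 s"] st d
      by (simp_all add: dist_norm)
    have dz1: "dist ?x ?z < d1" "dist ?y ?z < d1" "dist ?x ?z < d2" "dist ?y ?z < d2" using dz by auto
    have nn: "norm (?y - ?x) \<le> (t - s) + \<bar>e c t - e c s\<bar>"
      using norm_Pair_le[of "t - s" "e c t - e c s"] st by simp
    have l: "fst (G' ?z (?y - ?x) - (?y - ?x)) = ?l" using G'_fst[of s "t - s" "e c t - e c s"] by simp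
    note f = abs_fst_le_norm
    have A: "\<bar>fst ((G ^^ N) ?y) - fst ((G ^^ N) ?x) - ((t - s) + real N * ?l)\<bar> \<le> (t - s) + \<bar>e c t - e c s\<bar>"
    proof -
      have "\<bar>fst ((G ^^ N) ?y - (G ^^ N) ?x - iter_deriv G G' N ?z (?y - ?x))\<bar> \<le> 1 * norm (?y - ?x)"
        by (rule order_trans[OF f d1(2)[OF dz1(1,2)]])
      moreover have "fst ((G ^^ N) ?y - (G ^^ N) ?x - iter_deriv G G' N ?z (?y - ?x))
          = fst ((G ^^ N) ?y) - fst ((G ^^ N) ?x) - ((t - s) + real N * ?l)"
        unfolding DG l[symmetric] by simp
      ultimately show ?thesis using nn by linarith
    qed
    have B: "\<bar>fst ((Gi ^^ N) ?y) - fst ((Gi ^^ N) ?x) - ((t - s) - real N * ?l)\<bar> \<le> (t - s) + \<bar>e c t - e c s\<bar>"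
    proof -
      have "\<bar>fst ((Gi ^^ N) ?y - (Gi ^^ N) ?x - iter_deriv Gi Gi' N ?z (?y - ?x))\<bar> \<le> 1 * norm (?y - ?x)"
        by (rule order_trans[OF f d2(2)[OF dz1(3,4)]])
      moreover have "fst ((Gi ^^ N) ?y - (Gi ^^ N) ?x - iter_deriv Gi Gi' N ?z (?y - ?x))
          = fst ((Gi ^^ N) ?y) - fst ((Gi ^^ N) ?x) - ((t - s) - real N * ?l)"
        unfolding DGi l[symmetric] by simp
      ultimately show ?thesis using nn by linarith
    qed
    have "fst ((G ^^ N) ?x) \<le> fst ((G ^^ N) ?y)" "fst ((Gi ^^ N) ?x) \<le> fst ((Gi ^^ N) ?y)"
      using \<gamma>_iterate_less[of s t N c] Gi_iterate_less[of s t N c] st(1)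
      by (cases "s = t"; simp add: G_iterate_graph)+
    moreover have "\<bar>q\<bar> \<le> 2 * \<tau> + D"
      if "\<bar>P - P0 - (\<tau> + q)\<bar> \<le> \<tau> + D" "\<bar>Q - Q0 - (\<tau> - q)\<bar> \<le> \<tau> + D" "P0 \<le> P" "Q0 \<le> Q"
      for P P0 Q Q0 \<tau> D q :: real
      using that by linarith
    ultimately have "\<bar>real N * ?l\<bar> \<le> 2 * (t - s) + \<bar>e c t - e c s\<bar>" using A B by blast
    then show "real N * \<bar>?l\<bar> \<le> 2 * (t - s) + \<bar>e c t - e c s\<bar>" by (simp add: abs_mult)
  qed
qed

text \<open>The cone with \<open>N * m \<ge> 2\<close> bounds the slopes of all nearby leaves, so its width is \<open>O(1 / N)\<close> times a
  constant. The leaf \<open>c0\<close> lies in the same cone, and the difference of two leaves has small slope.\<close>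

lemma flat:
  assumes \<epsilon>: "0 < \<epsilon>"
  shows "\<exists>d>0. \<forall>c s t. \<bar>c - c0\<bar> < d \<longrightarrow> \<bar>s - t\<bar> < d \<longrightarrow>
      \<bar>(e c t - e c0 t) - (e c s - e c0 s)\<bar> \<le> \<epsilon> * \<bar>t - s\<bar>"
proof -
  obtain m where m: "\<And>t. m \<le> b t" "m \<in> range b" using periodic_bounded[OF b_cont b_per] by metis
  have m0: "0 < m" using m(2) b_pos by auto
  obtain A where A: "\<And>t. \<bar>a1 t\<bar> \<le> A" "0 \<le> A"
  proof -
    obtain l u where lu: "\<And>t. l \<le> a1 t" "\<And>t. a1 t \<le> u" using periodic_bounded[OF a1_cont a1_per] by metis
    have "\<bar>a1 t\<bar> \<le> max \<bar>l\<bar> \<bar>u\<bar>" for t using lu[of t] by linarith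
    then show ?thesis using that[of "max \<bar>l\<bar> \<bar>u\<bar>"] by simp
  qed
  \<comment> \<open>A Lipschitz constant of the leaves near \<open>c0\<close>.\<close>
  define L where "L = 2 * (2 + A) / m"
  have L: "0 \<le> L" using A m0 by (simp add: L_def)
  obtain N :: nat where N: "max (2 / m) (2 * (2 + L) / (m * \<epsilon>)) < real N" "1 \<le> real N"
    using reals_Archimedean2[of "max (max (2 / m) (2 * (2 + L) / (m * \<epsilon>))) 1"] by auto
  have N0: "0 < N" using N(2) by (cases N) auto
  have N1: "2 \<le> real N * m" using N(1) m0 by (simp add: field_simps)
  have N2: "2 * (2 + L) \<le> real N * m * \<epsilon>" using N(1) m0 \<epsilon> by (simp add: field_simps)
  obtain d where d: "0 < d" "\<And>c s t. \<bar>c - c0\<bar> < d \<Longrightarrow> s \<le> t \<Longrightarrow> t - s < d \<Longrightarrow>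
    real N * \<bar>a1 s * (t - s) + b s * (e c t - e c s)\<bar> \<le> 2 * (t - s) + \<bar>e c t - e c s\<bar>"
    using slope_cone[OF N0] by blast
  have lip: "real N * \<bar>a1 s * (t - s) + b s * (e c t - e c s)\<bar> \<le> (2 + L) * (t - s)"
    if c: "\<bar>c - c0\<bar> < d" "s \<le> t" "t - s < d" for c s t
  proof -
    let ?D = "e c t - e c s" and ?\<tau> = "t - s"
    have 0: "real N * \<bar>a1 s * ?\<tau> + b s * ?D\<bar> \<le> 2 * ?\<tau> + \<bar>?D\<bar>" by (rule d(2)[OF c])
    have "m * \<bar>?D\<bar> \<le> b s * \<bar>?D\<bar>" using m(1)[of s] by (intro mult_right_mono) auto
    also have "\<dots> = \<bar>b s * ?D\<bar>" using b_pos[of s] by (simp add: abs_mult)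
    also have "\<dots> \<le> \<bar>a1 s * ?\<tau> + b s * ?D\<bar> + \<bar>a1 s * ?\<tau>\<bar>" by linarith
    also have "\<bar>a1 s * ?\<tau>\<bar> \<le> A * ?\<tau>" using A(1)[of s] c by (simp add: abs_mult mult_right_mono)
    finally have "real N * (m * \<bar>?D\<bar>) \<le> real N * (\<bar>a1 s * ?\<tau> + b s * ?D\<bar> + A * ?\<tau>)"
      by (intro mult_left_mono) auto
    then have "real N * m * \<bar>?D\<bar> \<le> 2 * ?\<tau> + \<bar>?D\<bar> + real N * A * ?\<tau>" using 0 by (simp add: algebra_simps)
    moreover have "2 * \<bar>?D\<bar> \<le> real N * m * \<bar>?D\<bar>" using N1 by (intro mult_right_mono) auto
    moreover have "2 * ?\<tau> \<le> 2 * real N * ?\<tau>" using N(2) c by (intro mult_right_mono) auto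
    ultimately have "real N * m * \<bar>?D\<bar> \<le> 2 * (real N * (2 + A) * ?\<tau>)" by (simp add: algebra_simps)
    then have "real N * (m * \<bar>?D\<bar>) \<le> real N * (2 * (2 + A) * ?\<tau>)" by (simp add: algebra_simps)
    then have "m * \<bar>?D\<bar> \<le> 2 * (2 + A) * ?\<tau>" using N0 by simp
    then have "\<bar>?D\<bar> \<le> L * ?\<tau>" using m0 by (simp add: L_def field_simps)
    then show ?thesis using 0 by (simp add: algebra_simps)
  qed
  have main: "\<bar>(e c t - e c0 t) - (e c s - e c0 s)\<bar> \<le> \<epsilon> * \<bar>t - s\<bar>"
    if c: "\<bar>c - c0\<bar> < d" "s \<le> t" "t - s < d" for c s t
  proof -
    let ?D = "(e c t - e c0 t) - (e c s - e c0 s)"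
    have "b s * ?D = (a1 s * (t - s) + b s * (e c t - e c s)) - (a1 s * (t - s) + b s * (e c0 t - e c0 s))"
      by (simp add: algebra_simps)
    then have "\<bar>b s * ?D\<bar> \<le> \<bar>a1 s * (t - s) + b s * (e c t - e c s)\<bar> + \<bar>a1 s * (t - s) + b s * (e c0 t - e c0 s)\<bar>"
      by (simp only: abs_triangle_ineq4)
    then have "real N * \<bar>b s * ?D\<bar> \<le> real N * (\<bar>a1 s * (t - s) + b s * (e c t - e c s)\<bar> + \<bar>a1 s * (t - s) + b s * (e c0 t - e c0 s)\<bar>)"
      by (intro mult_left_mono) auto
    also have "\<dots> \<le> 2 * (2 + L) * (t - s)"
      using lip[OF c] lip[of c0 s t] c d(1) by (simp add: distrib_left distrib_right)
    also have "\<dots> \<le> real N * m * \<epsilon> * (t - s)" using N2 c by (intro mult_right_mono) auto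
    finally have "real N * \<bar>b s * ?D\<bar> \<le> real N * (m * \<epsilon> * (t - s))" by (simp add: mult.assoc)
    then have "b s * \<bar>?D\<bar> \<le> m * (\<epsilon> * (t - s))" using N0 b_pos[of s] by (simp add: abs_mult mult.assoc)
    moreover have "m * \<bar>?D\<bar> \<le> b s * \<bar>?D\<bar>" using m(1)[of s] by (intro mult_right_mono) auto
    ultimately have "m * \<bar>?D\<bar> \<le> m * (\<epsilon> * (t - s))" by linarith
    then show ?thesis using m0 c by simp
  qed
  have "\<bar>(e c t - e c0 t) - (e c s - e c0 s)\<bar> \<le> \<epsilon> * \<bar>t - s\<bar>" if c: "\<bar>c - c0\<bar> < d" "\<bar>s - t\<bar> < d" for c s t
    using main[of c s t] main[of c t s] c by (cases "s \<le> t") (auto simp: abs_minus_commute)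
  then show ?thesis using d(1) by blast
qed

text \<open>The strict derivative of \<open>G\<close>, applied to a vertical vector from the leaf \<open>c0\<close> to a nearby leaf.\<close>

lemma shear:
  assumes \<epsilon>: "0 < \<epsilon>"
  shows "\<exists>d>0. \<forall>c t. \<bar>c - c0\<bar> < d \<longrightarrow>
      \<bar>\<gamma> c t - t - b t * (e c t - e c0 t)\<bar> \<le> \<epsilon> * \<bar>e c t - e c0 t\<bar>"
proof -
  obtain d1 where d1: "0 < d1" "\<And>t x y. dist x (t, e c0 t) < d1 \<Longrightarrow> dist y (t, e c0 t) < d1 \<Longrightarrow>
    norm (G y - G x - G' (t, e c0 t) (y - x)) \<le> \<epsilon> * norm (y - x)"
    by (rule strict_derivative_along_graph[OF G_C1 G_shift e_cont1[of UNIV c0] e_per \<epsilon>], rule that)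
  obtain d where d: "0 < d" "\<And>c s t. \<bar>c - c0\<bar> < d \<Longrightarrow> \<bar>s - t\<bar> < d \<Longrightarrow> \<bar>e c s - e c0 t\<bar> < d1"
    using e_convergent[OF d1(1)] by blast
  have "\<bar>\<gamma> c t - t - b t * (e c t - e c0 t)\<bar> \<le> \<epsilon> * \<bar>e c t - e c0 t\<bar>" if c: "\<bar>c - c0\<bar> < d" for c t
  proof -
    let ?z = "(t, e c0 t)" and ?y = "(t, e c t)"
    have "dist ?y ?z < d1" using d(2)[OF c, of t t] d(1) by (simp add: dist_Pair_Pair dist_real_def)
    then have "norm (G ?y - G ?z - G' ?z (?y - ?z)) \<le> \<epsilon> * norm (?y - ?z)"
      using d1(1) by (intro d1(2)) simp_all
    moreover have "\<bar>fst (G ?y - G ?z - G' ?z (?y - ?z))\<bar> \<le> norm (G ?y - G ?z - G' ?z (?y - ?z))"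
      by (rule abs_fst_le_norm)
    moreover have "fst (G ?y - G ?z - G' ?z (?y - ?z)) = \<gamma> c t - t - b t * (e c t - e c0 t)"
      using G'_fst[of t 0 "e c t - e c0 t"] by (simp add: G_graph \<gamma>_id)
    ultimately show ?thesis by (simp add: norm_Pair)
  qed
  then show ?thesis using d(1) by blast
qed

lemma periodic_identity_leaf: "identity_leaf e \<gamma> c0 b"
  by (intro identity_leaf.intro \<gamma>_family identity_leaf_axioms.intro \<gamma>_id b_cont b_pos b_per shear flat)

end

end

section \<open>Differentiability of the area function across the leaves\<close>

context twist_plane
begin

definition area_deriv :: "real \<Rightarrow> (real \<Rightarrow> real) \<Rightarrow> bool"
  where "area_deriv c k \<longleftrightarrow> (\<forall>t. ((\<lambda>c. w t c) has_real_derivative k t) (at c))"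

lemma area_deriv_iff: "area_deriv c k \<longleftrightarrow> (\<forall>t. ((\<lambda>c'. v c c' t / (c' - c)) \<longlongrightarrow> k t) (at c))"
  by (simp add: area_deriv_def has_field_derivative_iff v_def)

lemma area_deriv_right: "area_deriv c k \<Longrightarrow> ((\<lambda>c'. v c c' t / (c' - c)) \<longlongrightarrow> k t) (at_right c)"
  unfolding area_deriv_iff by (meson filterlim_at_split)

lemma area_deriv_mono: assumes "area_deriv c k" shows "mono k"
proof (rule monoI)
  fix s t :: real assume st: "s \<le> t"
  show "k s \<le> k t"
  proof (rule tendsto_le[OF _ area_deriv_right[OF assms] area_deriv_right[OF assms]])
    have "\<forall>\<^sub>F c' in at_right c. c < c'" by (simp add: eventually_at_right_less)
    then show "\<forall>\<^sub>F c' in at_right c. v c c' s / (c' - c) \<le> v c c' t / (c' - c)"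
      by (rule eventually_mono) (use st in \<open>auto intro!: divide_right_mono v_le\<close>)
  qed simp
qed

lemma area_deriv_0: assumes "area_deriv c k" shows "k 0 = 0"
proof -
  have "w 0 = (\<lambda>c. 0)" by auto
  then have "((\<lambda>c::real. 0::real) has_real_derivative k 0) (at c)"
    using assms unfolding area_deriv_def by metis
  then show ?thesis using DERIV_unique[OF _ DERIV_const] by blast
qed

lemma area_deriv_per: assumes "area_deriv c k" shows "k (t + 1) = k t + 1"
proof -
  have "((\<lambda>c. w t c + c) has_real_derivative k t + 1) (at c)"
    using assms by (auto simp: area_deriv_def intro!: derivative_eq_intros)
  then have "((\<lambda>c. w (t + 1) c) has_real_derivative k t + 1) (at c)" by (simp add: w_per)
  then show ?thesis using assms DERIV_unique unfolding area_deriv_def by blast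
qed

text \<open>The limit of \<open>flux\<close> for \<open>c'\<close> tending to \<open>c\<close>. The argument \<open>g c' t\<close> varies with \<open>c'\<close> and is first
  replaced by a fixed point slightly to the right of \<open>g c t\<close>.\<close>

lemma area_deriv_flux:
  assumes k: "area_deriv c k" "continuous_on UNIV k" and st: "s \<le> t"
  shows "k t - k s \<le> k (g c t) - k (g c s)"
proof (rule field_le_epsilon)
  fix \<eta> :: real assume \<eta>: "0 < \<eta>"
  have "continuous (at (g c t)) k" using k(2) by (simp add: continuous_on_eq_continuous_at)
  then obtain r where r: "0 < r" "\<And>x. dist x (g c t) < r \<Longrightarrow> dist (k x) (k (g c t)) < \<eta>"
    using \<eta> unfolding continuous_at_eps_delta dist_real_def by blast
  have kr: "k (g c t + r / 2) \<le> k (g c t) + \<eta>"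
    using r(2)[of "g c t + r / 2"] r(1) by (simp add: dist_real_def abs_less_iff)
  obtain d where d: "0 < d" "\<And>c' x. \<bar>c' - c\<bar> < d \<Longrightarrow> \<bar>g c' x - g c x\<bar> < r / 2"
    using g.g_uniform[of "r / 2" c] r(1) by (metis half_gt_zero)
  have "k t - k s \<le> k (g c t + r / 2) - k (g c s)"
  proof (rule tendsto_le[OF _ tendsto_diff[OF area_deriv_right[OF k(1)] area_deriv_right[OF k(1)]]
        tendsto_diff[OF area_deriv_right[OF k(1)] area_deriv_right[OF k(1)]]])
    have "\<forall>\<^sub>F c' in at_right c. c < c' \<and> c' < c + d"
      using d(1) unfolding eventually_at_right_field by (intro exI[of _ "c + d"]) auto
    then show "\<forall>\<^sub>F c' in at_right c. v c c' t / (c' - c) - v c c' s / (c' - c)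
        \<le> v c c' (g c t + r / 2) / (c' - c) - v c c' (g c s) / (c' - c)"
    proof (rule eventually_mono)
      fix c' assume c': "c < c' \<and> c' < c + d"
      have "v c c' t - v c c' s \<le> v c c' (g c' t) - v c c' (g c s)" by (rule g.flux) (use c' st in auto)
      also have "\<dots> \<le> v c c' (g c t + r / 2) - v c c' (g c s)"
      proof (intro diff_right_mono v_le)
        show "g c' t \<le> g c t + r / 2" using d(2)[of c' t] c' by linarith
      qed (use c' in simp)
      finally show "v c c' t / (c' - c) - v c c' s / (c' - c)
        \<le> v c c' (g c t + r / 2) / (c' - c) - v c c' (g c s) / (c' - c)"
        unfolding diff_divide_distrib[symmetric] using c' by (intro divide_right_mono) auto
    qed
  qed simp
  then show "k t - k s \<le> k (g c t) - k (g c s) + \<eta>" using kr by simp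
qed

text \<open>By \<open>area_deriv_flux\<close> the function \<open>k \<circ> g c - k\<close> is monotone; being periodic, it is constant.\<close>

lemma area_deriv_semiconjugacy:
  assumes k: "area_deriv c k" "continuous_on UNIV k"
  obtains a where "\<And>t. k (g c t) = k t + a"
proof -
  let ?f = "\<lambda>t. k (g c t) - k t"
  have mono: "?f s \<le> ?f t" if "s \<le> t" for s t using area_deriv_flux[OF k that] by simp
  have per: "?f (t + 1) = ?f t" for t
    using area_deriv_per[OF k(1)] by (simp add: g.g_per)
  have fi: "?f (t + of_int m) = ?f t" for t m
    using degree_one_int[of "\<lambda>t. ?f t + t" t m] per by simp
  have "?f t = ?f 0" for t
  proof (rule antisym)
    have "t \<le> 0 + of_int \<lceil>t\<rceil>" by simp
    from mono[OF this] show "?f t \<le> ?f 0" by (simp only: fi)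
    have "0 + of_int \<lfloor>t\<rfloor> \<le> t" by simp
    from mono[OF this] show "?f 0 \<le> ?f t" by (simp only: fi)
  qed
  then show ?thesis using that[of "?f 0"] by (metis add.commute diff_add_cancel)
qed

text \<open>The last conclusion is continuity in \<open>c\<close> of the derivative, stated for whatever derivatives exist at
  nearby leaves. For irrational \<open>\<alpha>\<close> it comes from the two-leaf estimate \<open>irrational_leaf\<close>, for rational
  \<open>\<alpha>\<close> from the fact that these derivatives are semiconjugacies.\<close>

lemma area_deriv_at_leaf:
  fixes H :: "real \<Rightarrow> real"
  assumes H: "continuous_on UNIV H" "strict_mono H" "\<And>x. H (x + 1) = H x + 1"
    and conj: "\<And>x. g c0 (H x) = H (x + \<alpha>)"
  obtains h0 where "area_deriv c0 h0" "continuous_on UNIV h0" "strict_mono h0"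
    "\<And>\<epsilon>. 0 < \<epsilon> \<Longrightarrow> \<exists>d>0. \<forall>c k. \<bar>c - c0\<bar> < d \<longrightarrow> c \<noteq> c0 \<longrightarrow> area_deriv c k \<longrightarrow> continuous_on UNIV k \<longrightarrow>
       (\<forall>t. \<bar>k t - h0 t\<bar> \<le> \<epsilon>)"
proof -
  have deriv: "area_deriv c0 h0"
    if quot: "\<And>\<epsilon>. 0 < \<epsilon> \<Longrightarrow> \<exists>d>0. \<forall>c t. c \<noteq> c0 \<longrightarrow> \<bar>c - c0\<bar> < d \<longrightarrow> \<bar>v c0 c t / (c - c0) - h0 t\<bar> \<le> \<epsilon>" for h0
    unfolding area_deriv_iff LIM_def
  proof (intro allI impI)
    fix t \<epsilon> :: real assume "0 < \<epsilon>"
    then obtain d where "0 < d" "\<And>c t. c \<noteq> c0 \<Longrightarrow> \<bar>c - c0\<bar> < d \<Longrightarrow> \<bar>v c0 c t / (c - c0) - h0 t\<bar> \<le> \<epsilon> / 2"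
      using quot[of "\<epsilon> / 2"] by (meson half_gt_zero)
    with \<open>0 < \<epsilon>\<close> show "\<exists>d>0. \<forall>c. c \<noteq> c0 \<and> dist c c0 < d \<longrightarrow> dist (v c0 c t / (c - c0)) (h0 t) < \<epsilon>"
      unfolding dist_real_def by (metis field_sum_of_halves less_add_same_cancel1 half_gt_zero order_le_less_trans)
  qed
  show ?thesis
  proof (cases "\<alpha> \<in> \<rat>")
    case False
    obtain Hi where Hi: "\<And>y. H (Hi y) = y" "\<And>x. Hi (H x) = x" "continuous_on UNIV Hi" "strict_mono Hi" "\<And>y. Hi (y + 1) = Hi y + 1"
      by (rule degree_one_inverse[OF H], rule that)
    define h0 where "h0 = (\<lambda>t. Hi t - Hi 0)"
    have strict: "\<exists>d>0. \<forall>c1 c2 t. c1 < c2 \<longrightarrow> \<bar>c1 - c0\<bar> < d \<longrightarrow> \<bar>c2 - c0\<bar> < d \<longrightarrow> \<bar>v c1 c2 t / (c2 - c1) - h0 t\<bar> \<le> \<epsilon>"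
      if \<epsilon>: "0 < \<epsilon>" for \<epsilon>
    proof -
      obtain d where d: "0 < d" "\<And>c1 c2 x y. c1 < c2 \<Longrightarrow> \<bar>c1 - c0\<bar> < d \<Longrightarrow> \<bar>c2 - c0\<bar> < d \<Longrightarrow>
         \<bar>(v c1 c2 (H y) - v c1 c2 (H x)) / (c2 - c1) - (y - x)\<bar> \<le> \<epsilon>"
        by (rule g.irrational_leaf[OF H conj False \<epsilon>], rule that)
      have "\<bar>v c1 c2 t / (c2 - c1) - h0 t\<bar> \<le> \<epsilon>" if "c1 < c2" "\<bar>c1 - c0\<bar> < d" "\<bar>c2 - c0\<bar> < d" for c1 c2 t
        using d(2)[OF that, of "Hi t" "Hi 0"] by (simp add: Hi(1) h0_def)
      then show ?thesis using d(1) by blast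
    qed
    show ?thesis
    proof (rule that)
      show "area_deriv c0 h0"
      proof (rule deriv)
        fix \<epsilon> :: real assume "0 < \<epsilon>"
        then obtain d where d: "0 < d" "\<And>c1 c2 t. c1 < c2 \<Longrightarrow> \<bar>c1 - c0\<bar> < d \<Longrightarrow> \<bar>c2 - c0\<bar> < d \<Longrightarrow> \<bar>v c1 c2 t / (c2 - c1) - h0 t\<bar> \<le> \<epsilon>"
          using strict by blast
        have "\<bar>v c0 c t / (c - c0) - h0 t\<bar> \<le> \<epsilon>" if c: "c \<noteq> c0" "\<bar>c - c0\<bar> < d" for c t
        proof (cases "c0 < c")
          case True then show ?thesis using d(2)[of c0 c t] d(1) c by simp
        next
          case False
          have "v c0 c t / (c - c0) = v c c0 t / (c0 - c)"
            unfolding v_def by (metis minus_diff_eq minus_divide_divide)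
          then show ?thesis using d(2)[of c c0 t] d(1) c False by simp
        qed
        then show "\<exists>d>0. \<forall>c t. c \<noteq> c0 \<longrightarrow> \<bar>c - c0\<bar> < d \<longrightarrow> \<bar>v c0 c t / (c - c0) - h0 t\<bar> \<le> \<epsilon>"
          using d(1) by blast
      qed
      show "continuous_on UNIV h0" unfolding h0_def by (intro continuous_intros Hi(3))
      show "strict_mono h0" using Hi(4) by (simp add: h0_def strict_mono_def)
      fix \<epsilon> :: real assume "0 < \<epsilon>"
      then obtain d where d: "0 < d" "\<And>c1 c2 t. c1 < c2 \<Longrightarrow> \<bar>c1 - c0\<bar> < d \<Longrightarrow> \<bar>c2 - c0\<bar> < d \<Longrightarrow> \<bar>v c1 c2 t / (c2 - c1) - h0 t\<bar> \<le> \<epsilon>"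
        using strict by blast
      have "\<bar>k t - h0 t\<bar> \<le> \<epsilon>" if c: "\<bar>c - c0\<bar> < d" "area_deriv c k" for c k t
      proof (rule tendsto_upperbound)
        show "((\<lambda>c'. \<bar>v c c' t / (c' - c) - h0 t\<bar>) \<longlongrightarrow> \<bar>k t - h0 t\<bar>) (at_right c)"
          by (intro tendsto_intros area_deriv_right[OF c(2)])
        have "\<forall>\<^sub>F c' in at_right c. c < c' \<and> c' < c + (d - \<bar>c - c0\<bar>)"
          using c(1) unfolding eventually_at_right_field by (intro exI[of _ "c + (d - \<bar>c - c0\<bar>)"]) auto
        then show "\<forall>\<^sub>F c' in at_right c. \<bar>v c c' t / (c' - c) - h0 t\<bar> \<le> \<epsilon>"
        proof (rule eventually_mono)
          fix c' assume "c < c' \<and> c' < c + (d - \<bar>c - c0\<bar>)"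
          then have "c < c'" "\<bar>c' - c0\<bar> < d" by linarith+
          then show "\<bar>v c c' t / (c' - c) - h0 t\<bar> \<le> \<epsilon>" by (rule d(2)[OF _ c(1)])
        qed
      qed simp
      then show "\<exists>d>0. \<forall>c k. \<bar>c - c0\<bar> < d \<longrightarrow> c \<noteq> c0 \<longrightarrow> area_deriv c k \<longrightarrow> continuous_on UNIV k \<longrightarrow> (\<forall>t. \<bar>k t - h0 t\<bar> \<le> \<epsilon>)"
        using d(1) by blast
    qed
  next
    case True
    then obtain p q :: int where pq: "0 < q" "\<alpha> = of_int p / of_int q" by (rule Rats_cases') 
    define n where "n = nat q - 1"
    have n: "real (Suc n) = of_int q" using pq(1) by (simp add: n_def)
    have it: "(g c0 ^^ m) (H x) = H (x + real m * \<alpha>)" for m x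
      by (induction m) (simp_all add: conj algebra_simps)
    have per: "(g c0 ^^ Suc n) t = t + of_int p" for t
    proof -
      obtain x where x: "H x = t" using degree_one_surj[of H t] H by blast
      have "real (Suc n) * \<alpha> = of_int p" using pq n by simp
      then have "(g c0 ^^ Suc n) (H x) = H (x + of_int p)" by (simp only: it)
      then show ?thesis using degree_one_int[of H x p] H(3) x by simp
    qed
    interpret il: identity_leaf e "\<gamma> n p" c0 "b n c0" by (rule periodic_identity_leaf[OF per])
    show ?thesis
    proof (rule that)
      show "area_deriv c0 il.B"
      proof (rule deriv)
        fix \<epsilon> :: real assume "0 < \<epsilon>"
        then obtain d where "0 < d" "\<And>c t. c \<noteq> c0 \<Longrightarrow> \<bar>c - c0\<bar> < d \<Longrightarrow> \<bar>v c0 c t / (c - c0) - il.B t\<bar> \<le> \<epsilon>"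
          using il.area_derivative[of \<epsilon>] by blast
        then show "\<exists>d>0. \<forall>c t. c \<noteq> c0 \<longrightarrow> \<bar>c - c0\<bar> < d \<longrightarrow> \<bar>v c0 c t / (c - c0) - il.B t\<bar> \<le> \<epsilon>" by blast
      qed
      show "continuous_on UNIV il.B" by (rule il.B_cont)
      show "strict_mono il.B" using il.B_less by (simp add: strict_mono_def)
      fix \<epsilon> :: real assume \<epsilon>: "0 < \<epsilon>"
      obtain d where d: "0 < d" "\<And>c (h :: real \<Rightarrow> real) a t. c \<noteq> c0 \<Longrightarrow> \<bar>c - c0\<bar> < d \<Longrightarrow> mono h \<Longrightarrow> (\<And>t. h (t + 1) = h t + 1) \<Longrightarrow>
          h 0 = 0 \<Longrightarrow> (\<And>t. h (\<gamma> n p c t) = h t + a) \<Longrightarrow> \<bar>h t - il.B t\<bar> \<le> \<epsilon>"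
        by (fact il.semiconjugacy_limit[OF \<epsilon>])
      have "\<bar>k t - il.B t\<bar> \<le> \<epsilon>" if c: "\<bar>c - c0\<bar> < d" "c \<noteq> c0" "area_deriv c k" "continuous_on UNIV k" for c k t
      proof -
        obtain a where a: "\<And>t. k (g c t) = k t + a" by (rule area_deriv_semiconjugacy[OF c(3,4)], rule that)
        have ki: "k ((g c ^^ m) t) = k t + real m * a" for m t
          by (induction m) (simp_all add: a algebra_simps)
        have "k (\<gamma> n p c t) = k t + (real (Suc n) * a - of_int p)" for t
          using degree_one_int[of k "(g c ^^ Suc n) t" "- p"] area_deriv_per[OF c(3)] ki[of "Suc n" t]
          unfolding \<gamma>_def[OF per] by (simp del: funpow.simps)
        then show ?thesis
          by (rule d(2)[OF c(2,1) area_deriv_mono[OF c(3)] area_deriv_per[OF c(3)] area_deriv_0[OF c(3)]])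
      qed
      then show "\<exists>d>0. \<forall>c k. \<bar>c - c0\<bar> < d \<longrightarrow> c \<noteq> c0 \<longrightarrow> area_deriv c k \<longrightarrow> continuous_on UNIV k \<longrightarrow> (\<forall>t. \<bar>k t - il.B t\<bar> \<le> \<epsilon>)"
        using d(1) by blast
    qed
  qed
qed

text \<open>Every leaf is conjugated to a rotation, so the derivative exists at every leaf by
  \<open>area_deriv_at_leaf\<close>, and its continuity statement then applies to the derivatives at all nearby leaves.\<close>

theorem area_C1:
  assumes conj: "\<And>c. \<exists>(H :: real \<Rightarrow> real) \<alpha>. continuous_on UNIV H \<and> strict_mono H \<and> (\<forall>x. H (x + 1) = H x + 1) \<and> (\<forall>x. g c (H x) = H (x + \<alpha>))"
  obtains h where "\<And>t c. ((\<lambda>c. w t c) has_real_derivative h c t) (at c)"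
    "continuous_on UNIV (\<lambda>z::real \<times> real. h (snd z) (fst z))" "\<And>c. strict_mono (h c)" "\<And>c t. h c (t + 1) = h c t + 1"
proof -
  have "\<exists>h0. area_deriv c0 h0 \<and> continuous_on UNIV h0 \<and> strict_mono h0 \<and>
    (\<forall>\<epsilon>>0. \<exists>d>0. \<forall>c k. \<bar>c - c0\<bar> < d \<longrightarrow> c \<noteq> c0 \<longrightarrow> area_deriv c k \<longrightarrow> continuous_on UNIV k \<longrightarrow>
       (\<forall>t. \<bar>k t - h0 t\<bar> \<le> \<epsilon>))" for c0
  proof -
    obtain H :: "real \<Rightarrow> real" and \<alpha> where HH: "continuous_on UNIV H \<and> strict_mono H \<and> (\<forall>x. H (x + 1) = H x + 1) \<and> (\<forall>x. g c0 (H x) = H (x + \<alpha>))"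
      using conj[of c0] by blast
    note H = HH[THEN conjunct1] HH[THEN conjunct2, THEN conjunct1]
      HH[THEN conjunct2, THEN conjunct2, THEN conjunct1, THEN spec]
      HH[THEN conjunct2, THEN conjunct2, THEN conjunct2, THEN spec]
    obtain h0 where h0: "area_deriv c0 h0" "continuous_on UNIV h0" "strict_mono h0" and
      l: "\<And>\<epsilon>. 0 < \<epsilon> \<Longrightarrow> \<exists>d>0. \<forall>c k. \<bar>c - c0\<bar> < d \<longrightarrow> c \<noteq> c0 \<longrightarrow> area_deriv c k \<longrightarrow> continuous_on UNIV k \<longrightarrow>
       (\<forall>t. \<bar>k t - h0 t\<bar> \<le> \<epsilon>)"
      by (rule area_deriv_at_leaf[OF H], rule that)
    have "\<forall>\<epsilon>>0. \<exists>d>0. \<forall>c k. \<bar>c - c0\<bar> < d \<longrightarrow> c \<noteq> c0 \<longrightarrow> area_deriv c k \<longrightarrow> continuous_on UNIV k \<longrightarrow>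
       (\<forall>t. \<bar>k t - h0 t\<bar> \<le> \<epsilon>)"
      by (rule allI, rule impI, rule l)
    then show ?thesis by (intro exI[of _ h0] conjI h0)
  qed
  then obtain h where h: "\<And>c. area_deriv c (h c)" "\<And>c. continuous_on UNIV (h c)" "\<And>c. strict_mono (h c)"
    and lim: "\<And>c0 \<epsilon>. 0 < \<epsilon> \<Longrightarrow> \<exists>d>0. \<forall>c k. \<bar>c - c0\<bar> < d \<longrightarrow> c \<noteq> c0 \<longrightarrow> area_deriv c k \<longrightarrow> continuous_on UNIV k \<longrightarrow>
       (\<forall>t. \<bar>k t - h c0 t\<bar> \<le> \<epsilon>)" by metis
  show ?thesis
  proof (rule that[of h])
    show "((\<lambda>c. w t c) has_real_derivative h c t) (at c)" for t c using h(1) by (simp add: area_deriv_def)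
    show "strict_mono (h c)" for c by (rule h(3))
    show "h c (t + 1) = h c t + 1" for c t by (rule area_deriv_per[OF h(1)])
    show "continuous_on UNIV (\<lambda>z::real \<times> real. h (snd z) (fst z))"
      unfolding continuous_on_iff
    proof (intro ballI allI impI)
      fix z :: "real \<times> real" and \<epsilon> :: real assume \<epsilon>: "0 < \<epsilon>"
      obtain t0 c0 where z: "z = (t0, c0)" by (cases z)
      obtain d1 where d1: "0 < d1" "\<And>c t. \<bar>c - c0\<bar> < d1 \<Longrightarrow> c \<noteq> c0 \<Longrightarrow> \<bar>h c t - h c0 t\<bar> \<le> \<epsilon> / 2"
        using lim[of "\<epsilon> / 2" c0] \<epsilon> h(1,2) by (meson half_gt_zero)
      obtain d2 where d2: "0 < d2" "\<And>t. dist t t0 < d2 \<Longrightarrow> dist (h c0 t) (h c0 t0) < \<epsilon> / 2"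
        using h(2)[of c0] \<epsilon> unfolding continuous_on_iff by (metis UNIV_I half_gt_zero)
      have "dist (h (snd y) (fst y)) (h (snd z) (fst z)) < \<epsilon>" if y: "dist y z < min d1 d2" for y
      proof -
        have "\<bar>snd y - c0\<bar> < d1" "dist (fst y) t0 < d2"
          using dist_fst_le[of y z] dist_snd_le[of y z] y by (auto simp: z dist_real_def)
        then have "\<bar>h (snd y) (fst y) - h c0 (fst y)\<bar> \<le> \<epsilon> / 2" "dist (h c0 (fst y)) (h c0 t0) < \<epsilon> / 2"
          using d1(2)[of "snd y" "fst y"] d2(2)[of "fst y"] \<epsilon> by (cases "snd y = c0"; simp)+
        then show ?thesis unfolding z dist_real_def fst_conv snd_conv by linarith
      qed
      then show "\<exists>d>0. \<forall>y\<in>UNIV. dist y z < d \<longrightarrow> dist (h (snd y) (fst y)) (h (snd z) (fst z)) < \<epsilon>"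
        using d1(1) d2(1) by (intro exI[of _ "min d1 d2"]) auto
    qed
  qed
qed

end

section \<open>Smoothing a generating function\<close>

lemma C1_total_derivative:
  fixes f p q :: "real \<Rightarrow> real \<Rightarrow> real"
  assumes p: "\<And>t c. ((\<lambda>t. f t c) has_real_derivative p t c) (at t)"
    and q: "\<And>t c. (f t has_real_derivative q t c) (at c)"
    and cont: "continuous_on UNIV (\<lambda>z. q (fst z) (snd z))"
  shows "((\<lambda>z. f (fst z) (snd z)) has_derivative (\<lambda>u. p (fst z) (snd z) * fst u + q (fst z) (snd z) * snd u)) (at z)"
proof -
  obtain t c where z: "z = (t, c)" by (cases z)
  have "((\<lambda>(t, c). f t c) has_derivative (\<lambda>(u1, u2). (\<lambda>h. p t c * h) u1 + blinfun_mult_right (q t c) u2)) (at (t, c) within UNIV \<times> UNIV)"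
  proof (rule has_derivative_partialsI)
    show "((\<lambda>t. f t c) has_derivative (\<lambda>h. p t c * h)) (at t within UNIV)"
      using p[of c t] by (simp add: has_field_derivative_def)
    show "(f t has_derivative blinfun_apply (blinfun_mult_right (q t c))) (at c within UNIV)" for t c
      using q[of t c] by (simp add: has_field_derivative_def blinfun_mult_right.rep_eq)
    have "continuous_on UNIV (\<lambda>z. blinfun_mult_right (q (fst z) (snd z)))"
      by (rule bounded_linear.continuous_on[OF bounded_linear_blinfun_mult_right cont])
    then show "continuous (at (t, c) within UNIV \<times> UNIV) (\<lambda>(t, c). blinfun_mult_right (q t c))"
      by (simp add: continuous_on_eq_continuous_at case_prod_unfold UNIV_Times_UNIV)
  qed auto
  then show ?thesis
    by (simp add: z case_prod_unfold blinfun_mult_right.rep_eq UNIV_Times_UNIV)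
qed

lemma C1_jointly_continuous:
  fixes f p q :: "real \<Rightarrow> real \<Rightarrow> real"
  assumes "\<And>t c. ((\<lambda>t. f t c) has_real_derivative p t c) (at t)"
    and "\<And>t c. (f t has_real_derivative q t c) (at c)"
    and "continuous_on UNIV (\<lambda>z. q (fst z) (snd z))"
  shows "continuous_on UNIV (\<lambda>z. f (fst z) (snd z))"
  by (rule continuous_at_imp_continuous_on)
    (use has_derivative_continuous[OF C1_total_derivative[OF assms]] in blast)

text \<open>On a fixed interval of integration, parameters can be treated by the theorems on continuity and
  differentiation under the integral sign.\<close>

lemma primitive_rescaled:
  assumes "continuous_on UNIV f"
  shows "primitive f t = integral {0..1} (\<lambda>x. t * f (t * x))"
proof -
  have "((\<lambda>x. t * f (t * x)) has_integral primitive f (t * 1) - primitive f (t * 0)) {0..1}"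
  proof (rule fundamental_theorem_of_calculus)
    fix x :: real
    have "((\<lambda>x. primitive f (t * x)) has_real_derivative f (t * x) * t) (at x)"
      by (rule DERIV_chain2[OF primitive_deriv[OF assms]]) (auto intro!: derivative_eq_intros)
    then show "((\<lambda>x. primitive f (t * x)) has_vector_derivative t * f (t * x)) (at x within {0..1})"
      by (simp add: has_real_derivative_iff_has_vector_derivative[symmetric] mult.commute has_field_derivative_at_within)
  qed simp
  then have "integral {0..1} (\<lambda>x. t * f (t * x)) = primitive f (t * 1) - primitive f (t * 0)"
    by (rule integral_unique)
  then show ?thesis by (simp only: mult_1_right mult_zero_right primitive_0 diff_0_right)
qed

context
  fixes f :: "real \<Rightarrow> real \<Rightarrow> real"
  assumes f: "continuous_on UNIV (\<lambda>z. f (fst z) (snd z))"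
begin

lemma section_continuous: "continuous_on UNIV (f c)"
  using continuous_on_compose2[OF f, of UNIV "\<lambda>x. (c, x)"] by (simp add: continuous_intros)

lemma primitive_param_continuous:
  "continuous_on UNIV (\<lambda>z. primitive (f (fst z)) (snd z))"
proof -
  have "continuous_on (UNIV \<times> cbox 0 1) (\<lambda>(z, x). snd z * f (fst z) (snd z * x))"
  proof -
    have "continuous_on (UNIV \<times> cbox 0 1) (\<lambda>y::(real \<times> real) \<times> real. (fst (fst y), snd (fst y) * snd y))"
      by (intro continuous_intros)
    from continuous_on_compose2[OF f this] show ?thesis
      unfolding case_prod_unfold by (intro continuous_intros) simp_all
  qed
  from integral_continuous_on_param[OF this] show ?thesis
    by (simp only: primitive_rescaled[OF section_continuous] cbox_interval)
qed

lemma primitive_param_deriv: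
  assumes d: "\<And>c x. ((\<lambda>c. f c x) has_real_derivative f' c x) (at c)"
    and f': "continuous_on UNIV (\<lambda>z. f' (fst z) (snd z))"
  shows "((\<lambda>c. primitive (f c) t) has_real_derivative primitive (f' c) t) (at c)"
proof -
  have c': "continuous_on UNIV (f' c)" for c
    using continuous_on_compose2[OF f', of UNIV "\<lambda>x. (c, x)"] by (simp add: continuous_intros)
  show ?thesis
    unfolding primitive_rescaled[OF section_continuous] primitive_rescaled[OF c'] cbox_interval[symmetric]
  proof (rule leibniz_rule_field_derivative[where U = UNIV])
    show "((\<lambda>c. t * f c (t * x)) has_real_derivative t * f' c (t * x)) (at c within UNIV)" for c x
      by (intro DERIV_cmult d)
    show "(\<lambda>x. t * f c (t * x)) integrable_on cbox 0 1" for c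
      by (intro integrable_continuous continuous_intros continuous_on_compose2[OF section_continuous]) auto
    show "continuous_on (UNIV \<times> cbox 0 1) (\<lambda>(c, x). t * f' c (t * x))"
    proof -
      have "continuous_on (UNIV \<times> cbox 0 1) (\<lambda>y::real \<times> real. (fst y, t * snd y))"
        by (intro continuous_intros)
      from continuous_on_compose2[OF f' this] show ?thesis
        unfolding case_prod_unfold by (intro continuous_intros) simp_all
    qed
  qed auto
qed

end

text \<open>\<open>mat2 a b c d\<close> is the linear map with rows \<open>(a, b)\<close> and \<open>(c, d)\<close>.\<close>

definition mat2 :: "real \<Rightarrow> real \<Rightarrow> real \<Rightarrow> real \<Rightarrow> ((real \<times> real) \<Rightarrow>\<^sub>L (real \<times> real))"
  where "mat2 a b c d = Blinfun (\<lambda>u. (a * fst u + b * snd u, c * fst u + d * snd u))"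

lemma mat2_apply: "mat2 a b c d u = (a * fst u + b * snd u, c * fst u + d * snd u)"
  unfolding mat2_def
  by (subst bounded_linear_Blinfun_apply)
    (auto intro!: bounded_linear_Pair bounded_linear_add bounded_linear_const_mult bounded_linear_fst bounded_linear_snd)

lemma mat2_continuous:
  fixes a :: "real \<times> real \<Rightarrow> real"
  assumes "continuous_on S a" "continuous_on S b" "continuous_on S c" "continuous_on S d"
  shows "continuous_on S (\<lambda>z. mat2 (a z) (b z) (c z) (d z))"
  by (rule continuous_on_blinfun_componentwise)
    (auto simp: mat2_apply Basis_prod_def intro!: continuous_intros assms)

text \<open>The inverse function theorem for a global bijection.\<close>

lemma plane_inverse_derivative:
  fixes P Pi :: "real \<times> real \<Rightarrow> real \<times> real"
  assumes P: "\<And>z. (P has_derivative mat2 (a z) (b z) (c z) (d z)) (at z)"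
    and cont: "continuous_on UNIV a" "continuous_on UNIV b" "continuous_on UNIV c" "continuous_on UNIV d"
    and det: "\<And>z. a z * d z - b z * c z \<noteq> 0"
    and inv: "\<And>z. P (Pi z) = z" "\<And>z. Pi (P z) = z"
  obtains Pi' where "\<And>z. (Pi has_derivative blinfun_apply (Pi' z)) (at z)" "continuous_on UNIV Pi'"
proof -
  have cP: "continuous_on UNIV P"
    by (rule continuous_at_imp_continuous_on) (use has_derivative_continuous[OF P] in blast)
  have "continuous_on (P ` UNIV) Pi" by (rule continuous_on_inverse_open[OF open_UNIV cP]) (auto simp: inv)
  moreover have "P ` UNIV = UNIV" using inv(1) by (metis surj_def)
  ultimately have cPi: "continuous_on UNIV Pi" by simp
  let ?D = "\<lambda>z. a z * d z - b z * c z"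
  let ?M = "\<lambda>z. mat2 (d z / ?D z) (- b z / ?D z) (- c z / ?D z) (a z / ?D z)"
  show ?thesis
  proof (rule that[of "\<lambda>z. ?M (Pi z)"])
    show "(Pi has_derivative blinfun_apply (?M (Pi z))) (at z)" for z
    proof (rule has_derivative_inverse_basic[where g = Pi and y = z and T = UNIV, OF P])
      show "bounded_linear (blinfun_apply (?M (Pi z)))" by (rule blinfun.bounded_linear_right)
      have "(d y * x - b y * u) / ?D y = (d y / ?D y) * x + (- b y / ?D y) * u" for x y u
        by (simp add: diff_divide_distrib)
      show "blinfun_apply (?M (Pi z)) \<circ> blinfun_apply (mat2 (a (Pi z)) (b (Pi z)) (c (Pi z)) (d (Pi z))) = id"
      proof
        fix u :: "real \<times> real"
        let ?y = "Pi z"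
        have "d ?y * (a ?y * fst u + b ?y * snd u) - b ?y * (c ?y * fst u + d ?y * snd u) = ?D ?y * fst u"
          "a ?y * (c ?y * fst u + d ?y * snd u) - c ?y * (a ?y * fst u + b ?y * snd u) = ?D ?y * snd u"
          by (simp_all add: algebra_simps)
        then have "(d ?y * (a ?y * fst u + b ?y * snd u) - b ?y * (c ?y * fst u + d ?y * snd u)) / ?D ?y = fst u"
          "(a ?y * (c ?y * fst u + d ?y * snd u) - c ?y * (a ?y * fst u + b ?y * snd u)) / ?D ?y = snd u"
          using det[of ?y] by simp_all
        then show "(blinfun_apply (?M ?y) \<circ> blinfun_apply (mat2 (a ?y) (b ?y) (c ?y) (d ?y))) u = id u"
          by (simp add: mat2_apply prod_eq_iff diff_divide_distrib)
      qed
      show "continuous (at z) Pi" using cPi by (simp add: continuous_on_eq_continuous_at)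
    qed (auto simp: inv)
    show "continuous_on UNIV (\<lambda>z. ?M (Pi z))"
      by (intro mat2_continuous continuous_intros continuous_on_compose2[OF cont(1) cPi]
          continuous_on_compose2[OF cont(2) cPi] continuous_on_compose2[OF cont(3) cPi]
          continuous_on_compose2[OF cont(4) cPi]) (use det in auto)
  qed
qed

text \<open>The coordinates \<open>(x, c)\<close> and \<open>(t, r)\<close> with \<open>x = h c t\<close> and \<open>r = e c t\<close> are related by the
  generating function \<open>w\<close>, of which \<open>e\<close> and \<open>h\<close> are the partial derivatives. The last two axioms are
  uniform in \<open>t\<close>, so that averaging in \<open>t\<close> preserves them.\<close>

locale generating_function =
  fixes w e h :: "real \<Rightarrow> real \<Rightarrow> real"
  assumes w_t: "((\<lambda>t. w t c) has_real_derivative e c t) (at t)"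
    and w_c: "(w t has_real_derivative h c t) (at c)"
    and e_cont: "continuous_on UNIV (\<lambda>z::real \<times> real. e (snd z) (fst z))"
    and h_cont: "continuous_on UNIV (\<lambda>z::real \<times> real. h (snd z) (fst z))"
    and w_per: "w (t + 1) c = w t c + c"
    and e_per: "e c (t + 1) = e c t"
    and h_per: "h c (t + 1) = h c t + 1"
    and e_less: "c1 < c2 \<Longrightarrow> e c1 t < e c2 t"
    and h_mono: "strict_mono (h c)"
    and e_above: "\<exists>c. \<forall>t. r \<le> e c t" and e_below: "\<exists>c. \<forall>t. e c t \<le> r"
begin

text \<open>Primitives of \<open>w\<close> in \<open>t\<close>, in \<open>c\<close>, and in both. They turn averages of \<open>w\<close> into differences, whose
  derivatives are immediate.\<close>

definition U where "U t c = primitive (\<lambda>\<tau>. w \<tau> c) t"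
definition V where "V t c = primitive (w t) c"
definition Q where "Q t c = primitive (U t) c"

lemma w_cont: "continuous_on UNIV (\<lambda>z. w (fst z) (snd z))"
proof (rule C1_jointly_continuous[OF w_t w_c])
  show "continuous_on UNIV (\<lambda>z::real \<times> real. h (snd z) (fst z))" by (rule h_cont)
qed

lemma swap_continuous:
  assumes "continuous_on UNIV (\<lambda>z::real \<times> real. f (fst z) (snd z))"
  shows "continuous_on UNIV (\<lambda>z::real \<times> real. f (snd z) (fst z))"
  using continuous_on_compose2[OF assms, of UNIV "\<lambda>z. (snd z, fst z)"] by (simp add: continuous_intros)

lemma swap_continuous':
  assumes "continuous_on UNIV (\<lambda>z::real \<times> real. f (snd z) (fst z))"
  shows "continuous_on UNIV (\<lambda>z::real \<times> real. f (fst z) (snd z))"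
  using continuous_on_compose2[OF assms, of UNIV "\<lambda>z. (snd z, fst z)"] by (simp add: continuous_intros)

lemma w_cont_t: "continuous_on UNIV (\<lambda>t. w t c)" and w_cont_c: "continuous_on UNIV (w t)"
  using continuous_on_compose2[OF w_cont, of UNIV "\<lambda>t. (t, c)"] continuous_on_compose2[OF w_cont, of UNIV "\<lambda>c. (t, c)"]
  by (simp_all add: continuous_intros)

definition U_c where "U_c t c = primitive (h c) t"
definition V_t where "V_t t c = primitive (\<lambda>\<kappa>. e \<kappa> t) c"

lemma U_t: "((\<lambda>t. U t c) has_real_derivative w t c) (at t)"
  unfolding U_def by (rule primitive_deriv[OF w_cont_t])

lemma U_deriv_c: "(U t has_real_derivative U_c t c) (at c)"
  unfolding U_def[abs_def] U_c_def
  by (rule primitive_param_deriv[where f = "\<lambda>c \<tau>. w \<tau> c"])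
    (use w_c swap_continuous[OF w_cont] swap_continuous'[OF h_cont] in auto)

lemma U_c_cont: "continuous_on UNIV (\<lambda>z. U_c (fst z) (snd z))"
  unfolding U_c_def
  using swap_continuous[OF primitive_param_continuous[of h, OF swap_continuous'[OF h_cont]]] by simp

lemma V_c: "(V t has_real_derivative w t c) (at c)"
  unfolding V_def[abs_def] using primitive_deriv[OF w_cont_c] by simp

lemma V_deriv_t: "((\<lambda>t. V t c) has_real_derivative V_t t c) (at t)"
  unfolding V_def V_t_def
  by (rule primitive_param_deriv[where f = w]) (use w_t w_cont swap_continuous[OF e_cont] e_cont in auto)

lemma V_t_cont: "continuous_on UNIV (\<lambda>z. V_t (fst z) (snd z))"
  unfolding V_t_def by (rule primitive_param_continuous[where f = "\<lambda>t \<kappa>. e \<kappa> t"]) (rule e_cont)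

lemma U_cont: "continuous_on UNIV (\<lambda>z. U (fst z) (snd z))"
  by (rule C1_jointly_continuous[OF U_t U_deriv_c U_c_cont])

lemma U_cont_c: "continuous_on UNIV (U t)"
  using continuous_on_compose2[OF U_cont, of UNIV "\<lambda>c. (t, c)"] by (simp add: continuous_intros)

lemma Q_c: "(Q t has_real_derivative U t c) (at c)"
  unfolding Q_def[abs_def] using primitive_deriv[OF U_cont_c] by simp

lemma Q_t: "((\<lambda>t. Q t c) has_real_derivative V t c) (at t)"
  unfolding Q_def V_def
  by (rule primitive_param_deriv[where f = U and f' = w]) (use U_t U_cont w_cont in auto)

lemma zero_deriv_constant:
  fixes f :: "real \<Rightarrow> real"
  assumes "\<And>x. (f has_real_derivative 0) (at x)"
  shows "f x = f y"
  using DERIV_isconst_all[of f x y] assms by blast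

lemma V_per: "V (t + 1) c - V t c = c\<^sup>2 / 2"
proof -
  have "((\<lambda>c. V (t + 1) c - V t c - c\<^sup>2 / 2) has_real_derivative 0) (at c)" for c
    by (auto intro!: derivative_eq_intros V_c simp: w_per)
  from zero_deriv_constant[OF this, of c 0] show ?thesis by (simp add: V_def)
qed

lemma U_per: "U (t + 1) c - U t c - t * c = U 1 c"
proof -
  have "((\<lambda>t. U (t + 1) c - U t c - t * c) has_real_derivative 0) (at t)" for t
    using DERIV_shift[of "\<lambda>t. U t c" "w (t + 1) c" t 1] U_t[of c "t + 1"]
    by (auto intro!: derivative_eq_intros U_t simp: w_per)
  from zero_deriv_constant[OF this, of t 0] show ?thesis by (simp add: U_def)
qed

lemma Q_per: "Q (t + 1) c - Q t c - t * c\<^sup>2 / 2 = Q 1 c - Q 0 c"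
proof -
  have "((\<lambda>t. Q (t + 1) c - Q t c - t * c\<^sup>2 / 2) has_real_derivative 0) (at t)" for t
    using DERIV_shift[of "\<lambda>t. Q t c" "V (t + 1) c" t 1] Q_t[of c "t + 1"] V_per[of t c]
    by (auto intro!: derivative_eq_intros Q_t simp: algebra_simps)
  from zero_deriv_constant[OF this, of t 0] show ?thesis by simp
qed

text \<open>The mean of \<open>w\<close> over a square of side \<open>2 * s\<close> is the normalised second difference of \<open>Q\<close>, and
  likewise for its partial derivatives.\<close>

definition mean2 :: "real \<Rightarrow> (real \<Rightarrow> real \<Rightarrow> real) \<Rightarrow> real \<Rightarrow> real \<Rightarrow> real"
  where "mean2 s f t c = (f (t + s) (c + s) - f (t + s) (c - s) - f (t - s) (c + s) + f (t - s) (c - s)) / (4 * s\<^sup>2)"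

lemma mean2_t:
  assumes "\<And>t c. ((\<lambda>t. f t c) has_real_derivative f' t c) (at t)"
  shows "((\<lambda>t. mean2 s f t c) has_real_derivative mean2 s f' t c) (at t)"
proof -
  have "((\<lambda>t. f (t + a) b) has_real_derivative f' (t + a) b) (at t)" for a b
    using DERIV_shift[of "\<lambda>t. f t b" "f' (t + a) b" t a] assms[of b "t + a"] by simp
  from this[of s "c + s"] this[of s "c - s"] this[of "- s" "c + s"] this[of "- s" "c - s"]
  show ?thesis unfolding mean2_def
    by (intro DERIV_cdivide DERIV_add DERIV_diff) simp_all
qed

lemma mean2_c:
  assumes "\<And>t c. (f t has_real_derivative f' t c) (at c)"
  shows "(mean2 s f t has_real_derivative mean2 s f' t c) (at c)"
proof -
  have "((\<lambda>c. f b (c + a)) has_real_derivative f' b (c + a)) (at c)" for a b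
    using DERIV_shift[of "\<lambda>c. f b c" "f' b (c + a)" c a] assms[of b "c + a"] by simp
  from this[of "t + s" s] this[of "t + s" "- s"] this[of "t - s" s] this[of "t - s" "- s"]
  show ?thesis unfolding mean2_def[abs_def]
    by (intro DERIV_cdivide DERIV_add DERIV_diff) simp_all
qed

lemma mean2_cont:
  assumes "continuous_on UNIV (\<lambda>z. f (fst z) (snd z))" "s \<noteq> 0"
  shows "continuous_on UNIV (\<lambda>z. mean2 s f (fst z) (snd z))"
proof -
  have "continuous_on UNIV (\<lambda>z::real \<times> real. f (fst z + a) (snd z + b))" for a b
    using continuous_on_compose2[OF assms(1), of UNIV "\<lambda>z. (fst z + a, snd z + b)"] by (simp add: continuous_intros)
  from this[of s s] this[of s "- s"] this[of "- s" s] this[of "- s" "- s"]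
  show ?thesis unfolding mean2_def using assms(2) by (intro continuous_intros) auto
qed

text \<open>\<open>W s\<close> is the smoothed generating function, \<open>R s\<close> and \<open>X s\<close> are its partial derivatives with respect
  to \<open>t\<close> and \<open>c\<close>, and \<open>J s\<close> is its mixed second derivative.\<close>

definition "X s = mean2 s U"
definition "R s = mean2 s V"
definition "W s = mean2 s Q"
definition "J s = mean2 s w"

lemma W_per: assumes "0 < s" shows "W s (t + 1) c = W s t c + c"
proof -
  have 1: "Q (t + 1 + a) b = Q (t + a) b + (t + a) * b\<^sup>2 / 2 + (Q 1 b - Q 0 b)" for a b
    using Q_per[of "t + a" b] by (simp add: algebra_simps)
  have "W s (t + 1) c - W s t c = ((t + s) * (c + s)\<^sup>2 / 2 - (t + s) * (c - s)\<^sup>2 / 2 - (t - s) * (c + s)\<^sup>2 / 2 + (t - s) * (c - s)\<^sup>2 / 2) / (4 * s\<^sup>2)"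
    using 1[of s "c + s"] 1[of s "c - s"] 1[of "- s" "c + s"] 1[of "- s" "c - s"]
    by (simp add: W_def mean2_def diff_divide_distrib[symmetric])
  also have "\<dots> = ((t + s) * (2 * c * s) - (t - s) * (2 * c * s)) / (4 * s\<^sup>2)"
  proof -
    have "(c + s)\<^sup>2 / 2 - (c - s)\<^sup>2 / 2 = 2 * c * s" by (simp add: power2_eq_square field_simps)
    then have sq: "(c + s)\<^sup>2 / 2 = 2 * c * s + (c - s)\<^sup>2 / 2" by simp
    show ?thesis unfolding times_divide_eq_right[symmetric] sq by (simp add: distrib_left)
  qed
  also have "\<dots> = (4 * s\<^sup>2 * c) / (4 * s\<^sup>2)" by (simp add: power2_eq_square algebra_simps)
  also have "\<dots> = c" using assms by simp
  finally show ?thesis by simp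
qed

lemma X_per: assumes "0 < s" shows "X s (t + 1) c = X s t c + 1"
proof -
  have 1: "U (t + 1 + a) b = U (t + a) b + (t + a) * b + U 1 b" for a b
    using U_per[of "t + a" b] by (simp add: algebra_simps)
  have "X s (t + 1) c - X s t c = ((t + s) * (c + s) - (t + s) * (c - s) - (t - s) * (c + s) + (t - s) * (c - s)) / (4 * s\<^sup>2)"
    using 1[of s "c + s"] 1[of s "c - s"] 1[of "- s" "c + s"] 1[of "- s" "c - s"]
    by (simp add: X_def mean2_def diff_divide_distrib[symmetric])
  also have "\<dots> = (4 * s\<^sup>2) / (4 * s\<^sup>2)" by (simp add: power2_eq_square algebra_simps)
  also have "\<dots> = 1" using assms by simp
  finally show ?thesis by simp
qed

lemma R_per: "R s (t + 1) c = R s t c"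
proof -
  have 1: "V (t + 1 + a) b = V (t + a) b + b\<^sup>2 / 2" for a b
    using V_per[of "t + a" b] by (simp add: algebra_simps)
  show ?thesis
    using 1[of s "c + s"] 1[of s "c - s"] 1[of "- s" "c + s"] 1[of "- s" "c - s"]
    by (simp add: R_def mean2_def)
qed

text \<open>The leaves are strictly ordered, so the increment of \<open>w\<close> across leaves is strictly increasing in \<open>t\<close>.\<close>

lemma J_pos: assumes s: "0 < s" shows "0 < J s t c"
proof -
  let ?f = "\<lambda>t. w t (c + s) - w t (c - s)"
  have "?f (t - s) < ?f (t + s)"
  proof (rule DERIV_pos_imp_increasing[where f = ?f])
    fix x
    show "\<exists>y. (?f has_real_derivative y) (at x) \<and> 0 < y"
      using w_t e_less[of "c - s" "c + s" x] s
      by (intro exI[of _ "e (c + s) x - e (c - s) x"]) (auto intro!: DERIV_diff)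
  qed (use s in simp)
  then show ?thesis using s by (simp add: J_def mean2_def)
qed

text \<open>Two applications of the mean value theorem to the second difference, as \<open>e\<close> is the mixed second
  derivative of \<open>V\<close>; likewise for \<open>X\<close> below.\<close>

lemma R_mean:
  assumes s: "0 < s"
  obtains \<tau> \<kappa> where "\<bar>\<tau> - t\<bar> < s" "\<bar>\<kappa> - c\<bar> < s" "R s t c = e \<kappa> \<tau>"
proof -
  have lt: "c - s < c + s" "t - s < t + s" using s by auto
  obtain \<kappa> where \<kappa>: "c - s < \<kappa>" "\<kappa> < c + s"
    "(V (t + s) (c + s) - V (t - s) (c + s)) - (V (t + s) (c - s) - V (t - s) (c - s)) = (c + s - (c - s)) * (w (t + s) \<kappa> - w (t - s) \<kappa>)"
    using MVT2[OF lt(1), of "\<lambda>c. V (t + s) c - V (t - s) c" "\<lambda>c. w (t + s) c - w (t - s) c"] DERIV_diff[OF V_c V_c] by blast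
  obtain \<tau> where \<tau>: "t - s < \<tau>" "\<tau> < t + s" "w (t + s) \<kappa> - w (t - s) \<kappa> = (t + s - (t - s)) * e \<kappa> \<tau>"
    using MVT2[OF lt(2) w_t] by blast
  have "V (t + s) (c + s) - V (t + s) (c - s) - V (t - s) (c + s) + V (t - s) (c - s) = 4 * s\<^sup>2 * e \<kappa> \<tau>"
    using \<kappa>(3) \<tau>(3) by (simp add: power2_eq_square)
  then have "R s t c = e \<kappa> \<tau>" using s by (simp add: R_def mean2_def)
  then show ?thesis using \<kappa> \<tau> by (intro that) auto
qed

lemma X_mean:
  assumes s: "0 < s"
  obtains \<tau> \<kappa> where "\<bar>\<tau> - t\<bar> < s" "\<bar>\<kappa> - c\<bar> < s" "X s t c = h \<kappa> \<tau>"
proof -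
  have lt: "c - s < c + s" "t - s < t + s" using s by auto
  obtain \<tau> where \<tau>: "t - s < \<tau>" "\<tau> < t + s"
    "(U (t + s) (c + s) - U (t + s) (c - s)) - (U (t - s) (c + s) - U (t - s) (c - s)) = (t + s - (t - s)) * (w \<tau> (c + s) - w \<tau> (c - s))"
    using MVT2[OF lt(2), of "\<lambda>t. U t (c + s) - U t (c - s)" "\<lambda>t. w t (c + s) - w t (c - s)"] DERIV_diff[OF U_t U_t] by blast
  obtain \<kappa> where \<kappa>: "c - s < \<kappa>" "\<kappa> < c + s" "w \<tau> (c + s) - w \<tau> (c - s) = (c + s - (c - s)) * h \<kappa> \<tau>"
    using MVT2[OF lt(1) w_c] by blast
  have "U (t + s) (c + s) - U (t + s) (c - s) - U (t - s) (c + s) + U (t - s) (c - s) = 4 * s\<^sup>2 * h \<kappa> \<tau>"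
    using \<kappa>(3) \<tau>(3) by (simp add: power2_eq_square)
  then have "X s t c = h \<kappa> \<tau>" using s by (simp add: X_def mean2_def)
  then show ?thesis using \<kappa> \<tau> by (intro that) auto
qed

lemma uniform_means:
  assumes \<epsilon>: "0 < \<epsilon>"
  obtains d where "0 < d" "\<And>s t c. 0 < s \<Longrightarrow> s < d \<Longrightarrow> \<bar>c\<bar> \<le> M \<Longrightarrow> \<bar>R s t c - e c t\<bar> < \<epsilon> \<and> \<bar>X s t c - h c t\<bar> < \<epsilon>"
proof -
  obtain d1 where d1: "0 < d1" "\<And>s t c' c. \<bar>c\<bar> \<le> M \<Longrightarrow> \<bar>s - t\<bar> < d1 \<Longrightarrow> \<bar>c' - c\<bar> < d1 \<Longrightarrow> \<bar>e c' s - e c t\<bar> < \<epsilon>"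
  proof -
    have p: "(\<lambda>z::real \<times> real. e (snd z) (fst z)) (t + 1, c) = (\<lambda>z::real \<times> real. e (snd z) (fst z)) (t, c)" for t c
      by (simp add: e_per)
    show ?thesis
      by (rule periodic_uniformly_continuous_strip[OF e_cont p \<epsilon>, of M]) (rule that, simp_all)
  qed
  \<comment> \<open>Unlike \<open>h c t\<close>, the difference \<open>h c t - t\<close> is periodic.\<close>
  have hc: "continuous_on UNIV (\<lambda>z::real \<times> real. h (snd z) (fst z) - fst z)" by (intro continuous_intros h_cont)
  obtain d2 where d2: "0 < d2" "\<And>s t c' c. \<bar>c\<bar> \<le> M \<Longrightarrow> \<bar>s - t\<bar> < d2 \<Longrightarrow> \<bar>c' - c\<bar> < d2 \<Longrightarrow> \<bar>(h c' s - s) - (h c t - t)\<bar> < \<epsilon> / 2"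
  proof -
    have p: "(\<lambda>z::real \<times> real. h (snd z) (fst z) - fst z) (t + 1, c) = (\<lambda>z::real \<times> real. h (snd z) (fst z) - fst z) (t, c)" for t c
      by (simp add: h_per)
    show ?thesis
      by (rule periodic_uniformly_continuous_strip[OF hc p half_gt_zero[OF \<epsilon>], of M]) (rule that, simp_all)
  qed
  show ?thesis
  proof (rule that[of "min (min d1 d2) (\<epsilon> / 2)"])
    show "0 < min (min d1 d2) (\<epsilon> / 2)" using d1 d2 \<epsilon> by simp
    fix s t c assume s: "0 < s" "s < min (min d1 d2) (\<epsilon> / 2)" and c: "\<bar>c\<bar> \<le> M"
    obtain \<tau> \<kappa> where 1: "\<bar>\<tau> - t\<bar> < s" "\<bar>\<kappa> - c\<bar> < s" "R s t c = e \<kappa> \<tau>" by (rule R_mean[OF s(1)])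
    obtain \<tau>' \<kappa>' where 2: "\<bar>\<tau>' - t\<bar> < s" "\<bar>\<kappa>' - c\<bar> < s" "X s t c = h \<kappa>' \<tau>'" by (rule X_mean[OF s(1)])
    have "\<bar>R s t c - e c t\<bar> < \<epsilon>" using d1(2)[OF c, of \<tau> t \<kappa>] 1 s by simp
    moreover have "\<bar>(h \<kappa>' \<tau>' - \<tau>') - (h c t - t)\<bar> < \<epsilon> / 2" using d2(2)[OF c, of \<tau>' t \<kappa>'] 2 s by simp
    then have "\<bar>X s t c - h c t\<bar> < \<epsilon>" using 2 s by linarith
    ultimately show "\<bar>R s t c - e c t\<bar> < \<epsilon> \<and> \<bar>X s t c - h c t\<bar> < \<epsilon>" by blast
  qed
qed

text \<open>The map \<open>(x, c) \<mapsto> (t, r)\<close> is the inverse of \<open>A s\<close> followed by \<open>B s\<close>. Each of the two changes one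
  coordinate only, monotonically, and both have Jacobian \<open>J s\<close>.\<close>

definition A :: "real \<Rightarrow> real \<times> real \<Rightarrow> real \<times> real" where "A s z = (X s (fst z) (snd z), snd z)"
definition B :: "real \<Rightarrow> real \<times> real \<Rightarrow> real \<times> real" where "B s z = (fst z, R s (fst z) (snd z))"

context
  fixes s :: real
  assumes s: "0 < s"
begin

lemma X_deriv: "((\<lambda>z. X s (fst z) (snd z)) has_derivative
    (\<lambda>u. J s (fst z) (snd z) * fst u + mean2 s U_c (fst z) (snd z) * snd u)) (at z)"
  unfolding X_def J_def
  by (rule C1_total_derivative[OF mean2_t[OF U_t] mean2_c[OF U_deriv_c] mean2_cont[OF U_c_cont]]) (use s in simp)

lemma R_deriv: "((\<lambda>z. R s (fst z) (snd z)) has_derivative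
    (\<lambda>u. mean2 s V_t (fst z) (snd z) * fst u + J s (fst z) (snd z) * snd u)) (at z)"
  unfolding R_def J_def
  by (rule C1_total_derivative[OF mean2_t[OF V_deriv_t] mean2_c[OF V_c] mean2_cont[OF w_cont]]) (use s in simp)

lemma W_deriv: "((\<lambda>z. W s (fst z) (snd z)) has_derivative
    (\<lambda>u. R s (fst z) (snd z) * fst u + X s (fst z) (snd z) * snd u)) (at z)"
  unfolding R_def X_def W_def
  by (rule C1_total_derivative[OF mean2_t[OF Q_t] mean2_c[OF Q_c] mean2_cont[OF U_cont]]) (use s in simp)

lemma conts: "continuous_on UNIV (\<lambda>z. J s (fst z) (snd z))" "continuous_on UNIV (\<lambda>z. mean2 s U_c (fst z) (snd z))"
  "continuous_on UNIV (\<lambda>z. mean2 s V_t (fst z) (snd z))"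
  unfolding J_def using mean2_cont[OF w_cont] mean2_cont[OF U_c_cont] mean2_cont[OF V_t_cont] s by auto

lemma A_deriv: "(A s has_derivative mat2 (J s (fst z) (snd z)) (mean2 s U_c (fst z) (snd z)) 0 1) (at z)"
proof -
  have "(A s has_derivative (\<lambda>u. (J s (fst z) (snd z) * fst u + mean2 s U_c (fst z) (snd z) * snd u, snd u))) (at z)"
    unfolding A_def[abs_def] by (intro has_derivative_Pair X_deriv has_derivative_snd has_derivative_ident)
  then show ?thesis by (rule has_derivative_eq_rhs) (auto simp: mat2_apply)
qed

lemma B_deriv: "(B s has_derivative mat2 1 0 (mean2 s V_t (fst z) (snd z)) (J s (fst z) (snd z))) (at z)"
proof -
  have "(B s has_derivative (\<lambda>u. (fst u, mean2 s V_t (fst z) (snd z) * fst u + J s (fst z) (snd z) * snd u))) (at z)"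
    unfolding B_def[abs_def] by (intro has_derivative_Pair R_deriv has_derivative_fst has_derivative_ident)
  then show ?thesis by (rule has_derivative_eq_rhs) (auto simp: mat2_apply)
qed

lemma X_t: "((\<lambda>t. X s t c) has_real_derivative J s t c) (at t)"
  unfolding X_def J_def by (rule mean2_t) (rule U_t)

lemma R_c: "(R s t has_real_derivative J s t c) (at c)"
  unfolding R_def J_def by (rule mean2_c) (rule V_c)

lemma X_less: "t < t' \<Longrightarrow> X s t c < X s t' c"
  by (rule DERIV_pos_imp_increasing[where f = "\<lambda>t. X s t c"]) (use X_t J_pos[OF s] in blast)+

lemma R_less: "c < c' \<Longrightarrow> R s t c < R s t c'"
  by (rule DERIV_pos_imp_increasing[where f = "R s t"]) (use R_c J_pos[OF s] in blast)+

lemma X_onto: "\<exists>t. X s t c = x"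
proof (rule degree_one_surj)
  show "continuous_on UNIV (\<lambda>t. X s t c)"
    by (rule continuous_at_imp_continuous_on) (use DERIV_isCont[OF X_t] in blast)
  show "X s (t + 1) c = X s t c + 1" for t by (rule X_per[OF s])
qed

lemma R_onto: "\<exists>c. R s t c = r"
proof -
  have cont: "continuous_on UNIV (R s t)"
    by (rule continuous_at_imp_continuous_on) (use DERIV_isCont[OF R_c] in blast)
  obtain c1 where c1: "\<And>t. e c1 t \<le> r" using e_below by blast
  obtain c2 where c2: "\<And>t. r \<le> e c2 t" using e_above by blast
  obtain \<tau>1 \<kappa>1 where 1: "\<bar>\<tau>1 - t\<bar> < s" "\<bar>\<kappa>1 - (c1 - s)\<bar> < s" "R s t (c1 - s) = e \<kappa>1 \<tau>1" by (rule R_mean[OF s])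
  obtain \<tau>2 \<kappa>2 where 2: "\<bar>\<tau>2 - t\<bar> < s" "\<bar>\<kappa>2 - (c2 + s)\<bar> < s" "R s t (c2 + s) = e \<kappa>2 \<tau>2" by (rule R_mean[OF s])
  have "R s t (c1 - s) \<le> r" 
  proof -
    have "e \<kappa>1 \<tau>1 < e c1 \<tau>1" by (rule e_less) (use 1(2) in linarith)
    then show ?thesis using c1[of \<tau>1] 1(3) by simp
  qed
  moreover have "r \<le> R s t (c2 + s)" 
  proof -
    have "e c2 \<tau>2 < e \<kappa>2 \<tau>2" by (rule e_less) (use 2(2) in linarith)
    then show ?thesis using c2[of \<tau>2] 2(3) by simp
  qed
  moreover have "c1 - s \<le> c2 + s"
  proof (rule ccontr)
    assume "\<not> ?thesis"
    then have "R s t (c2 + s) < R s t (c1 - s)" by (intro R_less) simp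
    then show False using calculation by simp
  qed
  ultimately show ?thesis using IVT'[of "R s t" "c1 - s" r "c2 + s"] cont continuous_on_subset by blast
qed

lemma A_inverse:
  obtains Ai Ai' where "\<And>z. A s (Ai z) = z" "\<And>z. Ai (A s z) = z"
    "\<And>z. (Ai has_derivative blinfun_apply (Ai' z)) (at z)" "continuous_on UNIV Ai'"
proof -
  obtain f where f: "\<And>c x. X s (f c x) c = x" using X_onto by metis
  let ?Ai = "\<lambda>z. (f (snd z) (fst z), snd z)"
  have 1: "A s (?Ai z) = z" for z by (simp add: A_def f)
  have inj: "z = z'" if "A s z = A s z'" for z z'
    using that X_less[of "fst z" "fst z'" "snd z"] X_less[of "fst z'" "fst z" "snd z"]
    by (cases "fst z" "fst z'" rule: linorder_cases) (auto simp: A_def prod_eq_iff)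
  have 2: "?Ai (A s z) = z" for z by (rule inj) (rule 1)
  have det: "J s (fst z) (snd z) * 1 - mean2 s U_c (fst z) (snd z) * 0 \<noteq> 0" for z
    using J_pos[OF s] by (simp add: less_imp_neq[symmetric])
  show ?thesis
    by (rule plane_inverse_derivative[OF A_deriv conts(1,2) continuous_on_const continuous_on_const det 1 2])
      (rule that[OF 1 2])
qed

lemma B_inverse:
  obtains Bi Bi' where "\<And>z. B s (Bi z) = z" "\<And>z. Bi (B s z) = z"
    "\<And>z. (Bi has_derivative blinfun_apply (Bi' z)) (at z)" "continuous_on UNIV Bi'"
proof -
  obtain f where f: "\<And>t r. R s t (f t r) = r" using R_onto by metis
  let ?Bi = "\<lambda>z. (fst z, f (fst z) (snd z))"
  have 1: "B s (?Bi z) = z" for z by (simp add: B_def f)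
  have inj: "z = z'" if "B s z = B s z'" for z z'
    using that R_less[of "snd z" "snd z'" "fst z"] R_less[of "snd z'" "snd z" "fst z"]
    by (cases "snd z" "snd z'" rule: linorder_cases) (auto simp: B_def prod_eq_iff)
  have 2: "?Bi (B s z) = z" for z by (rule inj) (rule 1)
  have det: "1 * J s (fst z) (snd z) - 0 * mean2 s V_t (fst z) (snd z) \<noteq> 0" for z
    using J_pos[OF s] by (simp add: less_imp_neq[symmetric])
  show ?thesis
    by (rule plane_inverse_derivative[OF B_deriv continuous_on_const continuous_on_const conts(3,1) det 1 2])
      (rule that[OF 1 2])
qed

lemma A_shift: "A s (z + (1, 0)) = A s z + (1, 0)"
  by (simp add: A_def X_per[OF s])

lemma B_shift: "B s (z + (1, 0)) = B s z + (1, 0)"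
  by (simp add: B_def R_per)

end

end

lemma descend_function:
  fixes f :: "real \<times> real \<Rightarrow> 'a"
  assumes "\<And>z. f (z + (1, 0)) = f z"
  obtains S :: "annulus \<Rightarrow> 'a" where "S \<circ> annulus_proj = f"
proof -
  have step: "f (z + (of_int k, 0)) = f z" for z k
  proof (induction k rule: int_induct[where k = 0])
    case base then show ?case by (simp flip: zero_prod_def)
  next
    case (step1 i) then show ?case using assms[of "z + (of_int i, 0)"] by (simp add: add.assoc)
  next
    case (step2 i) then show ?case using assms[of "z + (of_int (i - 1), 0)"] by (simp add: add.assoc)
  qed
  define S where "S = (\<lambda>p. f (SOME z. annulus_proj z = p))"
  have "S (annulus_proj z) = f z" for z
  proof -
    have "annulus_proj (SOME y. annulus_proj y = annulus_proj z) = annulus_proj z"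
      by (rule someI[of "\<lambda>y. annulus_proj y = annulus_proj z" z]) simp
    then obtain k :: int where "z = (SOME y. annulus_proj y = annulus_proj z) + (of_int k, 0)"
      using annulus_proj_eq_iff by blast
    then show ?thesis unfolding S_def by (metis step)
  qed
  then have "S \<circ> annulus_proj = f" by (intro ext) (simp only: comp_apply)
  then show ?thesis by (rule that)
qed

lemma plane_homeo_inverse:
  fixes P :: "real \<times> real \<Rightarrow> real \<times> real"
  assumes cont: "continuous_on UNIV P" and inj: "\<And>y z. P y = P z \<Longrightarrow> y = z" and onto: "\<And>z. \<exists>y. P y = z"
  obtains Pi where "continuous_on UNIV Pi" "\<And>z. P (Pi z) = z" "\<And>z. Pi (P z) = z"
proof -
  obtain Pi where 1: "\<And>z. P (Pi z) = z" using onto by metis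
  have 2: "Pi (P z) = z" for z using inj[of "Pi (P z)" z] 1 by simp
  have "continuous_on (P ` UNIV) Pi" by (rule continuous_on_inverse_open[OF open_UNIV cont]) (auto simp: 2)
  moreover have "P ` UNIV = UNIV" using 1 by (metis surj_def)
  ultimately show ?thesis using that[OF _ 1 2] by simp
qed

lemma C1_map_imp_C1: "C1_map P P' \<Longrightarrow> C1 P"
  unfolding C1_map_def C1_def by blast

section \<open>The exact symplectic homeomorphism of a generating function\<close>

context generating_function
begin

text \<open>In terms of \<open>(t, c)\<close>, the pullback of the Liouville form minus the form itself is \<open>r dt - c dx\<close>. As
  \<open>dw = r dt + x dc\<close>, this is \<open>d (w - c x)\<close>; and \<open>w - c x\<close> is periodic, because a full turn adds \<open>c\<close> to
  \<open>w\<close> and \<open>1\<close> to \<open>x\<close>.\<close>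

lemma smoothed_exact_diffeo:
  assumes s: "0 < s"
  obtains \<phi> P where "exact_symplectic_diffeo \<phi>" "is_lift \<phi> P" "\<And>z. P (A s z) = B s z"
    "\<And>z. \<exists>y. A s y = z"
proof -
  obtain Ai Ai' where Ai: "\<And>z. A s (Ai z) = z" "\<And>z. Ai (A s z) = z"
    "\<And>z. (Ai has_derivative blinfun_apply (Ai' z)) (at z)" "continuous_on UNIV Ai'"
    by (rule A_inverse[OF s], rule that)
  obtain Bi Bi' where Bi: "\<And>z. B s (Bi z) = z" "\<And>z. Bi (B s z) = z"
    "\<And>z. (Bi has_derivative blinfun_apply (Bi' z)) (at z)" "continuous_on UNIV Bi'"
    by (rule B_inverse[OF s], rule that)
  let ?A' = "\<lambda>z. mat2 (J s (fst z) (snd z)) (mean2 s U_c (fst z) (snd z)) 0 1"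
  let ?B' = "\<lambda>z. mat2 1 0 (mean2 s V_t (fst z) (snd z)) (J s (fst z) (snd z))"
  have CA: "C1_map (A s) ?A'" unfolding C1_map_def
    using A_deriv[OF s] by (auto intro!: mat2_continuous conts[OF s] continuous_on_const)
  have CB: "C1_map (B s) ?B'" unfolding C1_map_def
    using B_deriv[OF s] by (auto intro!: mat2_continuous conts[OF s] continuous_on_const)
  have CAi: "C1_map Ai Ai'" and CBi: "C1_map Bi Bi'" using Ai Bi by (simp_all add: C1_map_def)
  define P where "P = B s \<circ> Ai"
  define P' where "P' = (\<lambda>z. ?B' (Ai z) o\<^sub>L Ai' z)"
  have CP: "C1_map P P'" unfolding P_def P'_def by (rule C1_map_comp[OF CB CAi])
  have CPi: "C1_map (A s \<circ> Bi) (\<lambda>z. ?A' (Bi z) o\<^sub>L Bi' z)" by (rule C1_map_comp[OF CA CBi])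
  have Ai_shift: "Ai (z + (1, 0)) = Ai z + (1, 0)" for z
    using A_shift[OF s, of "Ai z"] Ai(2)[of "Ai z + (1, 0)"] by (simp add: Ai(1))
  obtain \<phi> where \<phi>: "is_lift \<phi> P" "is_lift (inv \<phi>) (A s \<circ> Bi)" "annulus_homeo \<phi>"
  proof (rule descend_homeo[of P "A s \<circ> Bi"])
    show "continuous_on UNIV P" "continuous_on UNIV (A s \<circ> Bi)"
      by (rule C1_map_continuous[OF CP] C1_map_continuous[OF CPi])+
    show "P (z + (1, 0)) = P z + (1, 0)" for z by (simp add: P_def Ai_shift B_shift[OF s])
  qed (simp_all add: P_def Ai Bi)
  have diffeo: "annulus_C1_diffeo \<phi>"
    unfolding annulus_C1_diffeo_def annulus_C1_def
    using \<phi> C1_map_imp_C1[OF CP] C1_map_imp_C1[OF CPi] by (auto simp: annulus_homeo_iff)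
  have sndAi: "snd (Ai z) = snd z" for z using arg_cong[OF Ai(1)[of z], of snd] by (simp add: A_def)
  have XAi: "X s (fst (Ai z)) (snd (Ai z)) = fst z" for z using arg_cong[OF Ai(1)[of z], of fst] by (simp add: A_def)
  define T where "T = (\<lambda>z. W s (fst (Ai z)) (snd (Ai z)) - fst z * snd z)"
  have "T (z + (1, 0)) = T z" for z
    using W_per[OF s, of "fst (Ai z)" "snd z"] by (simp add: T_def Ai_shift sndAi distrib_right)
  then obtain S :: "annulus \<Rightarrow> real" where S: "S \<circ> annulus_proj = T" using descend_function by blast
  have Tder: "(T has_derivative (\<lambda>u. liouville_form (P z) (P' z u) - liouville_form z u)) (at z)" for z
  proof -
    have snd_Ai': "snd (Ai' z u) = snd u" for u
    proof -
      have "((\<lambda>z. snd (Ai z)) has_derivative (\<lambda>u. snd (Ai' z u))) (at z)" by (intro has_derivative_snd Ai(3))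
      then have "(snd has_derivative (\<lambda>u. snd (Ai' z u))) (at z)" by (simp add: sndAi)
      moreover have "(snd has_derivative snd) (at z)" by (rule has_derivative_snd[OF has_derivative_ident, unfolded])
      ultimately have "(\<lambda>u. snd (Ai' z u)) = snd" by (rule has_derivative_unique)
      then show ?thesis by (rule fun_cong)
    qed
    have "((\<lambda>z. W s (fst (Ai z)) (snd (Ai z))) has_derivative
        (\<lambda>u. R s (fst (Ai z)) (snd (Ai z)) * fst (Ai' z u) + X s (fst (Ai z)) (snd (Ai z)) * snd (Ai' z u))) (at z)"
      by (rule has_derivative_compose[OF Ai(3) W_deriv[OF s]])
    moreover have "((\<lambda>z. fst z * snd z) has_derivative (\<lambda>u. fst z * snd u + fst u * snd z)) (at z)"
      by (intro has_derivative_mult has_derivative_fst has_derivative_snd has_derivative_ident)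
    ultimately have "(T has_derivative (\<lambda>u. (R s (fst (Ai z)) (snd (Ai z)) * fst (Ai' z u)
        + X s (fst (Ai z)) (snd (Ai z)) * snd (Ai' z u)) - (fst z * snd u + fst u * snd z))) (at z)"
      unfolding T_def by (rule has_derivative_diff)
    moreover have "fst (P' z u) = fst (Ai' z u)" for u by (simp add: P'_def blinfun_compose.rep_eq mat2_apply)
    moreover have "snd (P z) = R s (fst (Ai z)) (snd (Ai z))" by (simp add: P_def B_def)
    ultimately show ?thesis
      by (elim has_derivative_eq_rhs) (simp add: fun_eq_iff liouville_form_def XAi snd_Ai' algebra_simps)
  qed
  have "exact_symplectic_diffeo \<phi>"
    unfolding exact_symplectic_diffeo_def
  proof (intro conjI diffeo allI impI)
    fix F assume F: "is_lift \<phi> F"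
    obtain k :: int where k: "\<And>z. F z = P z + (of_int k, 0)" using lift_unique[OF \<phi>(1) F] by blast
    then have Fe: "F = (\<lambda>z. P z + (of_int k, 0))" by auto
    have "frechet_derivative F (at z) = blinfun_apply (P' z)" for z
      unfolding Fe by (rule frechet_derivative_at[symmetric], rule has_derivative_add_const, rule C1_map_deriv[OF CP])
    then show "\<exists>S. \<forall>z. ((S \<circ> annulus_proj) has_derivative
        (\<lambda>u. liouville_form (F z) (frechet_derivative F (at z) u) - liouville_form z u)) (at z)"
      using Tder by (intro exI[of _ S]) (simp add: S k liouville_form_def)
  qed
  moreover have "P (A s z) = B s z" for z by (simp add: P_def Ai)
  ultimately show ?thesis using that \<phi>(1) Ai(1) by blast
qed

text \<open>The limits of \<open>A s\<close> and \<open>B s\<close> for \<open>s\<close> tending to \<open>0\<close>.\<close>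

definition A0 :: "real \<times> real \<Rightarrow> real \<times> real" where "A0 z = (h (snd z) (fst z), snd z)"
definition B0 :: "real \<times> real \<Rightarrow> real \<times> real" where "B0 z = (fst z, e (snd z) (fst z))"

lemma A0_inverse:
  obtains Ai where "continuous_on UNIV Ai" "\<And>z. A0 (Ai z) = z" "\<And>z. Ai (A0 z) = z"
proof (rule plane_homeo_inverse[of A0])
  show "continuous_on UNIV A0" unfolding A0_def by (intro continuous_intros h_cont)
  show "y = z" if "A0 y = A0 z" for y z
    using that h_mono[of "snd z"] by (auto simp: A0_def prod_eq_iff strict_mono_eq)
  have hc: "continuous_on UNIV (h c)" for c
    using continuous_on_compose2[OF h_cont, of UNIV "\<lambda>t. (t, c)"] by (simp add: continuous_intros)
  show "\<exists>y. A0 y = z" for z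
  proof -
    obtain t where "h (snd z) t = fst z" using degree_one_surj[OF hc h_per] by blast
    then show ?thesis by (intro exI[of _ "(t, snd z)"]) (simp add: A0_def)
  qed
qed (rule that)

lemma B0_inverse:
  obtains Bi where "continuous_on UNIV Bi" "\<And>z. B0 (Bi z) = z" "\<And>z. Bi (B0 z) = z"
proof (rule plane_homeo_inverse[of B0])
  show "continuous_on UNIV B0" unfolding B0_def by (intro continuous_intros e_cont)
  show "y = z" if "B0 y = B0 z" for y z
    using that e_less[of "snd y" "snd z" "fst z"] e_less[of "snd z" "snd y" "fst z"]
    by (cases "snd y" "snd z" rule: linorder_cases) (auto simp: B0_def prod_eq_iff)
  have ec: "continuous_on UNIV (\<lambda>c. e c t)" for t
    using continuous_on_compose2[OF e_cont, of UNIV "\<lambda>c. (t, c)"] by (simp add: continuous_intros)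
  show "\<exists>y. B0 y = z" for z
  proof -
    obtain c1 where c1: "\<And>t. e c1 t \<le> snd z" using e_below by blast
    obtain c2 where c2: "\<And>t. snd z \<le> e c2 t" using e_above by blast
    have "\<exists>c. e c (fst z) = snd z"
    proof (cases "c1 \<le> c2")
      case True
      then show ?thesis using IVT'[of "\<lambda>c. e c (fst z)" c1 "snd z" c2] c1 c2 continuous_on_subset[OF ec] by blast
    next
      case False
      then have "e c2 (fst z) < e c1 (fst z)" by (intro e_less) simp
      then show ?thesis using c1[of "fst z"] c2[of "fst z"] by simp
    qed
    then obtain c where "e c (fst z) = snd z" by blast
    then show ?thesis by (intro exI[of _ "(fst z, c)"]) (simp add: B0_def)
  qed
qed (rule that)

lemma A0_shift: "A0 (z + (1, 0)) = A0 z + (1, 0)" by (simp add: A0_def h_per)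
lemma B0_shift: "B0 (z + (1, 0)) = B0 z + (1, 0)" by (simp add: B0_def e_per)

text \<open>The smoothed map takes \<open>(X s t c, c)\<close> to \<open>(t, R s t c)\<close> and the limit map takes \<open>(h c t, c)\<close> to
  \<open>(t, e c t)\<close>. So the convergence of \<open>X s\<close> and \<open>R s\<close> gives the convergence of the maps, where the
  difference of the arguments is absorbed by the uniform continuity of the limit map alone.\<close>

theorem exact_symplectic_homeo_of_generating_function:
  obtains \<Phi> where "exact_symplectic_homeo \<Phi>" "\<And>t c. \<Phi> (to_circle (h c t), c) = (to_circle t, e c t)"
proof -
  obtain Ai where Ai: "continuous_on UNIV Ai" "\<And>z. A0 (Ai z) = z" "\<And>z. Ai (A0 z) = z" by (rule A0_inverse, rule that)
  obtain Bi where Bi: "continuous_on UNIV Bi" "\<And>z. B0 (Bi z) = z" "\<And>z. Bi (B0 z) = z" by (rule B0_inverse, rule that)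
  have cA: "continuous_on UNIV A0" unfolding A0_def by (intro continuous_intros h_cont)
  have cB: "continuous_on UNIV B0" unfolding B0_def by (intro continuous_intros e_cont)
  define P where "P = B0 \<circ> Ai"
  have Ai_shift: "Ai (z + (1, 0)) = Ai z + (1, 0)" for z
    using A0_shift[of "Ai z"] Ai(3)[of "Ai z + (1, 0)"] by (simp add: Ai(2))
  have P_shift: "P (z + (1, 0)) = P z + (1, 0)" for z by (simp add: P_def Ai_shift B0_shift)
  have cP: "continuous_on UNIV P" unfolding P_def
    by (intro continuous_on_compose Ai(1) continuous_on_subset[OF cB]) simp
  obtain \<Phi> where \<Phi>: "is_lift \<Phi> P" "annulus_homeo \<Phi>"
  proof (rule descend_homeo[of P "A0 \<circ> Bi"])
    show "continuous_on UNIV (A0 \<circ> Bi)"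
      by (intro continuous_on_compose Bi(1) continuous_on_subset[OF cA]) simp
  qed (simp_all add: cP P_shift, simp_all add: P_def Ai Bi)
  have PA: "P (A0 z) = B0 z" for z by (simp add: P_def Ai)
  have "\<exists>\<phi> P. exact_symplectic_diffeo \<phi> \<and> is_lift \<phi> P \<and> (\<forall>z. P (A (1 / real (Suc n)) z) = B (1 / real (Suc n)) z)
      \<and> (\<forall>z. \<exists>y. A (1 / real (Suc n)) y = z)" for n
    by (rule smoothed_exact_diffeo[of "1 / real (Suc n)"]) (simp, blast)
  then have "\<exists>\<phi>P. exact_symplectic_diffeo (fst \<phi>P) \<and> is_lift (fst \<phi>P) (snd \<phi>P) \<and>
      (\<forall>z. snd \<phi>P (A (1 / real (Suc n)) z) = B (1 / real (Suc n)) z) \<and> (\<forall>z. \<exists>y. A (1 / real (Suc n)) y = z)" for n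
    unfolding split_paired_Ex by simp
  then obtain \<phi>P where \<phi>P: "\<And>n. exact_symplectic_diffeo (fst (\<phi>P n)) \<and> is_lift (fst (\<phi>P n)) (snd (\<phi>P n)) \<and>
      (\<forall>z. snd (\<phi>P n) (A (1 / real (Suc n)) z) = B (1 / real (Suc n)) z) \<and> (\<forall>z. \<exists>y. A (1 / real (Suc n)) y = z)"
    by (rule that[OF someI_ex])
  define \<phi> where "\<phi> = (\<lambda>n. fst (\<phi>P n))"
  define Pn where "Pn = (\<lambda>n. snd (\<phi>P n))"
  have \<phi>: "exact_symplectic_diffeo (\<phi> n)" "is_lift (\<phi> n) (Pn n)"
    "Pn n (A (1 / real (Suc n)) z) = B (1 / real (Suc n)) z" "\<exists>y. A (1 / real (Suc n)) y = z" for n z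
    using \<phi>P[of n] unfolding \<phi>_def Pn_def by blast+
  have "compact_open_limit \<phi> \<Phi>"
    unfolding compact_open_limit_def
  proof (intro allI impI uniform_limitI)
    fix K :: "annulus set" and \<epsilon> :: real assume K: "compact K" and \<epsilon>: "0 < \<epsilon>"
    have "bounded (snd ` K)" by (intro compact_imp_bounded compact_continuous_image K continuous_intros)
    then obtain M where M: "\<And>p. p \<in> K \<Longrightarrow> \<bar>snd p\<bar> \<le> M" unfolding bounded_iff by (metis imageI real_norm_def)
    have f1: "continuous_on UNIV (\<lambda>z. fst (P z) - fst z)" and f2: "continuous_on UNIV (\<lambda>z. snd (P z))"
      by (intro continuous_intros cP)+
    have p1: "fst (P (t + 1, c)) - fst (t + 1, c) = fst (P (t, c)) - fst (t, c)"
      and p2: "snd (P (t + 1, c)) = snd (P (t, c))" for t c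
      using P_shift[of "(t, c)"] by simp_all
    have \<epsilon>8: "0 < \<epsilon> / 8" and \<epsilon>4: "0 < \<epsilon> / 4" using \<epsilon> by simp_all
    obtain d1 where d1: "0 < d1" "\<And>s t c' c. \<bar>c\<bar> \<le> M \<Longrightarrow> \<bar>s - t\<bar> < d1 \<Longrightarrow> \<bar>c' - c\<bar> < d1 \<Longrightarrow>
        \<bar>(fst (P (s, c')) - fst (s, c')) - (fst (P (t, c)) - fst (t, c))\<bar> < \<epsilon> / 8"
      by (fact periodic_uniformly_continuous_strip[OF f1 p1 \<epsilon>8, of M])
    obtain d2 where d2: "0 < d2" "\<And>s t c' c. \<bar>c\<bar> \<le> M \<Longrightarrow> \<bar>s - t\<bar> < d2 \<Longrightarrow> \<bar>c' - c\<bar> < d2 \<Longrightarrow>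
        \<bar>snd (P (s, c')) - snd (P (t, c))\<bar> < \<epsilon> / 4"
      by (fact periodic_uniformly_continuous_strip[OF f2 p2 \<epsilon>4, of M])
    let ?\<mu> = "min (min d1 d2) (\<epsilon> / 8)"
    have \<mu>: "0 < ?\<mu>" using d1 d2 \<epsilon> by simp
    obtain d where d: "0 < d" "\<And>s t c. 0 < s \<Longrightarrow> s < d \<Longrightarrow> \<bar>c\<bar> \<le> M \<Longrightarrow> \<bar>R s t c - e c t\<bar> < ?\<mu> \<and> \<bar>X s t c - h c t\<bar> < ?\<mu>"
      by (rule uniform_means[OF \<mu>, of M], rule that)
    obtain N :: nat where N: "1 / real (Suc N) < d" using d(1) nat_approx_posE by blast
    have "dist (\<phi> n p) (\<Phi> p) < \<epsilon>" if n: "N \<le> n" and p: "p \<in> K" for n p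
    proof -
      let ?s = "1 / real (Suc n)"
      have "?s \<le> 1 / real (Suc N)" using n by (intro divide_left_mono) auto
      then have s: "0 < ?s" "?s < d" using N by auto
      obtain z where z: "annulus_proj z = p" using surj_annulus_proj by (metis surjD)
      obtain y where y: "A ?s y = z" using \<phi>(4) by blast
      obtain t c where tc: "y = (t, c)" by (cases y)
      have zx: "z = (X ?s t c, c)" using y by (simp add: tc A_def)
      have c: "\<bar>c\<bar> \<le> M" using M[OF p] z zx by (metis snd_annulus_proj snd_conv)
      have m: "\<bar>R ?s t c - e c t\<bar> < ?\<mu>" "\<bar>X ?s t c - h c t\<bar> < ?\<mu>" using d(2)[OF s c, of t] by auto
      have Pn: "Pn n z = (t, R ?s t c)" using \<phi>(3)[of n y] by (simp only: y) (simp add: tc B_def)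
      have P0: "P (h c t, c) = (t, e c t)" using PA[of "(t, c)"] by (simp add: A0_def B0_def)
      have a: "\<bar>h c t - X ?s t c\<bar> < d1" "\<bar>h c t - X ?s t c\<bar> < d2" "\<bar>c - c\<bar> < d1" "\<bar>c - c\<bar> < d2"
        using m(2) d1(1) d2(1) by auto
      have "\<bar>(t - h c t) - (fst (P z) - X ?s t c)\<bar> < \<epsilon> / 8"
        using d1(2)[OF c a(1,3)] P0 zx by simp
      then have 1: "\<bar>fst (Pn n z) - fst (P z)\<bar> < \<epsilon> / 4"
        using m(2) unfolding Pn fst_conv min_less_iff_conj by linarith
      have "\<bar>e c t - snd (P z)\<bar> < \<epsilon> / 4" using d2(2)[OF c a(2,4)] P0 zx by simp
      then have 2: "\<bar>snd (Pn n z) - snd (P z)\<bar> < \<epsilon> / 2"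
        using m(1) \<epsilon> unfolding Pn snd_conv min_less_iff_conj by linarith
      have "dist (\<phi> n p) (\<Phi> p) = dist (annulus_proj (Pn n z)) (annulus_proj (P z))"
        using is_lift_apply[OF \<phi>(2), of n z] is_lift_apply[OF \<Phi>(1), of z] z by simp
      also have "\<dots> \<le> dist (Pn n z) (P z)" by (rule dist_annulus_proj_le)
      also have "\<dots> \<le> \<bar>fst (Pn n z) - fst (P z)\<bar> + \<bar>snd (Pn n z) - snd (P z)\<bar>"
        by (simp add: dist_prod_def dist_real_def sqrt_sum_squares_le_sum_abs)
      also have "\<dots> < \<epsilon>" using 1 2 \<epsilon> by linarith
      finally show ?thesis .
    qed
    then show "\<forall>\<^sub>F n in sequentially. \<forall>p\<in>K. dist (\<phi> n p) (\<Phi> p) < \<epsilon>"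
      unfolding eventually_sequentially by blast
  qed
  then have "exact_symplectic_homeo \<Phi>" using \<Phi>(2) \<phi>(1) by (auto simp: exact_symplectic_homeo_def)
  moreover have "\<Phi> (to_circle (h c t), c) = (to_circle t, e c t)" for t c
    using is_lift_apply[OF \<Phi>(1), of "(h c t, c)"] PA[of "(t, c)"] by (simp add: A0_def B0_def)
  ultimately show ?thesis by (rule that)
qed

end

section \<open>From the annulus to the plane\<close>

text \<open>Two leaves are disjoint graphs, so one lies above the other, and the normalisation by the mean tells
  which. The leaf through \<open>(t, r)\<close> depends continuously and periodically on \<open>t\<close>, so for fixed \<open>r\<close> these
  leaves stay between two leaves.\<close>

lemma foliation_leaf_family:
  assumes fol: "C0_foliation \<eta>"
  defines "e \<equiv> \<lambda>c t. \<eta> c (to_circle t)"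
  shows "leaf_family e" "\<exists>c. e c t = r" "\<exists>c. \<forall>t. r \<le> e c t" "\<exists>c. \<forall>t. e c t \<le> r"
proof -
  let ?Q = "\<lambda>(\<theta>, c). (\<theta>, \<eta> c \<theta>)"
  have Q: "bij ?Q" "continuous_on UNIV ?Q" "continuous_on UNIV (inv ?Q)"
    using fol annulus_homeo_iff unfolding C0_foliation_def by blast+
  have e_cont: "continuous_on UNIV (\<lambda>z::real \<times> real. e (snd z) (fst z))"
  proof -
    have "continuous_on UNIV (\<lambda>z. snd (?Q (annulus_proj z)))"
      by (intro continuous_on_snd continuous_on_compose2[OF Q(2) continuous_on_annulus_proj]) auto
    also have "(\<lambda>z. snd (?Q (annulus_proj z))) = (\<lambda>z. e (snd z) (fst z))"
      by (auto simp: e_def)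
    finally show ?thesis .
  qed
  have ec: "continuous_on S (e c)" for S c
    using continuous_on_compose2[OF e_cont, of S "\<lambda>t. (t, c)"] by (simp add: continuous_intros)
  have ne: "e c1 t \<noteq> e c2 t" if "c1 \<noteq> c2" for c1 c2 t
    using injD[OF bij_is_inj[OF Q(1)], of "(to_circle t, c1)" "(to_circle t, c2)"] that by (auto simp: e_def)
  have mean: "integral {0..1} (e c) = c" for c
    using fol by (simp add: C0_foliation_def e_def)
  have less: "e c1 t < e c2 t" if c: "c1 < c2" for c1 c2 t
  proof (rule ccontr)
    assume "\<not> e c1 t < e c2 t"
    then have t: "e c2 t - e c1 t < 0" using ne[of c1 c2 t] c by simp
    have neg: "e c2 x - e c1 x < 0" for x
    proof (rule ccontr)
      assume "\<not> ?thesis"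
      then have x: "0 < e c2 x - e c1 x" using ne[of c1 c2 x] c by simp
      have "connected ((\<lambda>x. e c2 x - e c1 x) ` UNIV)"
        by (intro connected_continuous_image continuous_intros ec) auto
      then have "0 \<in> (\<lambda>x. e c2 x - e c1 x) ` UNIV"
        using t x connectedD_interval[of "(\<lambda>x. e c2 x - e c1 x) ` UNIV" "e c2 t - e c1 t" "e c2 x - e c1 x" 0] by force
      then show False using ne[of c2 c1] c by auto
    qed
    have "integral {0..1} (e c2) \<le> integral {0..1} (e c1)"
      using neg by (intro integral_le integrable_continuous_real ec) (auto intro: less_imp_le)
    then show False using c mean by simp
  qed
  show "leaf_family e"
    by unfold_locales (use e_cont less mean in \<open>auto simp: e_def\<close>)
  have le: "e c1 t \<le> e c2 t" if "c1 \<le> c2" for c1 c2 t using less[of c1 c2 t] that by (cases "c1 = c2") auto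
  show "\<exists>c. e c t = r"
  proof -
    obtain p where "?Q p = (to_circle t, r)" using bij_is_surj[OF Q(1)] by (metis surjD)
    then show ?thesis by (cases p) (auto simp: e_def)
  qed
  define k where "k = (\<lambda>t. snd (inv ?Q (to_circle t, r)))"
  have ek: "e (k t) t = r" for t
  proof -
    have "?Q (inv ?Q (to_circle t, r)) = (to_circle t, r)" by (rule surj_f_inv_f[OF bij_is_surj[OF Q(1)]])
    then show ?thesis by (cases "inv ?Q (to_circle t, r)") (auto simp: e_def k_def)
  qed
  have kc: "continuous_on UNIV k"
  proof -
    have "continuous_on UNIV (\<lambda>t. (to_circle t, r))" by (intro continuous_intros continuous_on_to_circle)
    from continuous_on_compose2[OF Q(3) this] show ?thesis unfolding k_def by (intro continuous_on_snd) simp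
  qed
  have "k (t + 1) = k t" for t by (simp add: k_def)
  then obtain l u where lu: "\<And>t. l \<le> k t" "\<And>t. k t \<le> u" using periodic_bounded[OF kc] by metis
  show "\<exists>c. \<forall>t. r \<le> e c t" using le[OF lu(2)] ek by (metis)
  show "\<exists>c. \<forall>t. e c t \<le> r" using le[OF lu(1)] ek by (metis)
qed

text \<open>The derivative of the increasing fibre map is nonnegative, and it is not \<open>0\<close> because the inverse is
  differentiable.\<close>

lemma twist_derivative_pos:
  assumes tw: "twist f" and F: "is_lift f F" and der: "(F has_derivative blinfun_apply D) (at z)"
  shows "0 < fst (D (0, 1))"
proof -
  obtain \<theta> r where z: "z = (\<theta>, r)" by (cases z)
  let ?p = "\<lambda>r. fst (F (\<theta>, r))"
  have mono: "strict_mono ?p" and C: "C1_diffeo ?p" using tw F by (auto simp: twist_def)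
  have "((\<lambda>r. F (\<theta>, r)) has_derivative (\<lambda>h. D (0, h))) (at r)"
    by (rule has_derivative_compose[where f = "\<lambda>r. (\<theta>, r)", OF _ der[unfolded z]])
      (auto intro!: derivative_eq_intros)
  from has_derivative_fst[OF this]
  have dp: "(?p has_real_derivative fst (D (0, 1))) (at r)"
    unfolding has_field_derivative_def
  proof (rule has_derivative_eq_rhs, intro ext)
    fix h show "fst (D (0, h)) = fst (D (0, 1)) * h"
      by (subst blinfun_plane_apply) simp
  qed
  have "\<not> fst (D (0, 1)) < 0"
  proof
    assume "fst (D (0, 1)) < 0"
    then obtain d where "0 < d" "\<And>h. 0 < h \<Longrightarrow> h < d \<Longrightarrow> ?p (r + h) < ?p r"
      using DERIV_neg_dec_right[OF dp] by blast
    then have "?p (r + d / 2) < ?p r" by simp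
    moreover have "?p r < ?p (r + d / 2)" using strict_monoD[OF mono, of r "r + d / 2"] \<open>0 < d\<close> by simp
    ultimately show False by simp
  qed
  moreover have "fst (D (0, 1)) \<noteq> 0"
  proof
    assume 0: "fst (D (0, 1)) = 0"
    have b: "bij ?p" using C by (simp add: C1_diffeo_def)
    obtain q' where q': "\<And>x. (inv ?p has_derivative blinfun_apply (q' x)) (at x)"
      using C by (auto simp: C1_diffeo_def C1_def)
    have "(inv ?p \<circ> ?p has_derivative blinfun_apply (q' (?p r)) \<circ> (*) (fst (D (0, 1)))) (at r)"
      by (rule diff_chain_at[where f = ?p and g = "inv ?p" and x = r, OF dp[unfolded has_field_derivative_def] q'])
    moreover have "inv ?p \<circ> ?p = (\<lambda>x. x)" using b by (auto simp: bij_is_inj inv_f_f fun_eq_iff)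
    ultimately have "blinfun_apply (q' (?p r)) \<circ> (*) (fst (D (0, 1))) = (\<lambda>x. x)"
      using has_derivative_unique[OF _ has_derivative_ident] by metis
    from fun_cong[OF this, of 1] show False by (simp add: 0 blinfun.zero_right)
  qed
  ultimately show ?thesis by simp
qed

lemma twist_plane_of_foliation:
  assumes f: "symplectic_twist_diffeo f" and fol: "C0_foliation \<eta>" and inv_fol: "invariant_foliation f \<eta>"
  defines "e \<equiv> \<lambda>c t. \<eta> c (to_circle t)"
  obtains F Fi F' Fi' where "is_lift f F" "twist_plane e F Fi F' Fi'"
proof -
  have sf: "symplectic_diffeo f" and iso: "isotopic_to_id f" and tw: "twist f"
    using f by (auto simp: symplectic_twist_diffeo_def)
  obtain F where F: "is_lift f F" by (rule symplectic_diffeo_has_lift[OF sf])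
  obtain F' where F': "C1_symplectic F F'" by (rule symplectic_diffeo_lift[OF sf F])
  obtain Fi where Fi: "is_lift (inv f) Fi" "\<And>z. F (Fi z) = z" "\<And>z. Fi (F z) = z"
    by (rule symplectic_diffeo_lift_inverse[OF sf F], rule that)
  have Cf: "annulus_C1 (inv f)" using sf by (simp add: symplectic_diffeo_def annulus_C1_diffeo_def)
  obtain Fi' where "\<And>z. (Fi has_derivative blinfun_apply (Fi' z)) (at z)" "continuous_on UNIV Fi'"
    by (rule C1_lift[OF Cf Fi(1)], rule that)
  then have CFi: "C1_map Fi Fi'" by (simp add: C1_map_def)
  have leaf: "snd (F (t, e c t)) = e c (fst (F (t, e c t)))" for t c
  proof -
    have "(to_circle t, e c t) \<in> leaf \<eta> c" by (auto simp: leaf_def e_def)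
    then have "f (to_circle t, e c t) \<in> leaf \<eta> c" using inv_fol by (auto simp: invariant_foliation_def)
    moreover have "f (to_circle t, e c t) = annulus_proj (F (t, e c t))"
      using is_lift_apply[OF F, of "(t, e c t)"] by simp
    ultimately show ?thesis
      by (cases "F (t, e c t)") (auto simp: leaf_def e_def)
  qed
  have "twist_plane e F Fi F' Fi'"
  proof (intro twist_plane.intro twist_plane_axioms.intro)
    show "leaf_family e" "\<exists>c. e c t = r" for t r unfolding e_def by (rule foliation_leaf_family[OF fol])+
    show "0 < fst (F' z (0, 1))" for z
      by (rule twist_derivative_pos[OF tw F, where z = z]) (use F' in \<open>simp add: C1_symplectic_def\<close>)
    show "r < r' \<Longrightarrow> fst (F (t, r)) < fst (F (t, r'))" for r r' t
      using tw F by (auto simp: twist_def strict_mono_def)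
  qed (fact F' CFi Fi leaf isotopic_to_id_lift_shift[OF iso F])+
  then show ?thesis using that F by blast
qed

text \<open>A conjugacy of a leaf to a rotation lifts; composing it with a reflection if necessary makes
  the lift increasing.\<close>

lemma lifted_conjugacy:
  assumes fol: "C0_foliation \<eta>" and conj: "conj_to_rotation_on (leaf \<eta> c) f" and F: "is_lift f F"
  defines "e \<equiv> \<lambda>c t. \<eta> c (to_circle t)"
  shows "\<exists>(H :: real \<Rightarrow> real) a. continuous_on UNIV H \<and> strict_mono H \<and> (\<forall>x. H (x + 1) = H x + 1) \<and>
    (\<forall>x. fst (F (H x, e c (H x))) = H (x + a))"
proof -
  obtain h :: "circle \<Rightarrow> annulus" and h' \<alpha> where hom: "homeomorphism UNIV (leaf \<eta> c) h h'" and "\<forall>\<theta>. f (h \<theta>) = h (\<theta> + \<alpha>)"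
    using conj unfolding conj_to_rotation_on_def by blast
  then have rot: "f (h \<theta>) = h (\<theta> + \<alpha>)" for \<theta> by blast
  have hh: "h' (h \<theta>) = \<theta>" "p \<in> leaf \<eta> c \<Longrightarrow> h (h' p) = p" "h \<theta> \<in> leaf \<eta> c" for \<theta> p
    using hom by (auto simp: homeomorphism_def)
  have hc: "continuous_on UNIV h" "continuous_on (leaf \<eta> c) h'" using hom by (auto simp: homeomorphism_def)
  have lf: "h \<theta> = (fst (h \<theta>), \<eta> c (fst (h \<theta>)))" for \<theta> using hh(3)[of \<theta>] by (auto simp: leaf_def)
  have lm: "(\<theta>, \<eta> c \<theta>) \<in> leaf \<eta> c" for \<theta> by (auto simp: leaf_def)
  have \<eta>c: "continuous_on UNIV (\<eta> c)" using fol by (simp add: C0_foliation_def)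
  define k :: "annulus \<Rightarrow> annulus" where "k = (\<lambda>p. (fst (h (fst p)), snd p))"
  define k' :: "annulus \<Rightarrow> annulus" where "k' = (\<lambda>p. (h' (fst p, \<eta> c (fst p)), snd p))"
  have kk: "k (k' p) = p" "k' (k p) = p" for p
    by (simp_all add: k_def k'_def hh(2)[OF lm] lf[symmetric] hh(1))
  have ck: "continuous_on UNIV k" unfolding k_def
    by (intro continuous_on_Pair continuous_on_fst continuous_on_snd continuous_on_id
        continuous_on_compose2[OF hc(1)]) auto
  have ck': "continuous_on UNIV k'" unfolding k'_def
    by (intro continuous_on_Pair continuous_on_snd continuous_on_id continuous_on_compose2[OF hc(2)]
        continuous_on_fst continuous_on_compose2[OF \<eta>c]) (auto simp: lm)
  have bk: "bij k" using kk by (metis bijI')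
  have "inv k = k'" using kk by (metis inv_equality ext)
  then have "annulus_homeo k" using bk ck ck' by (simp add: annulus_homeo_iff)
  moreover obtain K where K: "is_lift k K" by (rule lift_exists[OF ck])
  ultimately obtain K' where K': "is_lift (inv k) K'" "\<And>z. K (K' z) = z" "\<And>z. K' (K z) = z"
    by (rule annulus_homeo_lift, intro that)
  obtain d :: int where d: "\<And>z. K (z + (1, 0)) = K z + (of_int d, 0)" by (rule lift_degree[OF K], rule that)
  obtain d' :: int where d': "\<And>z. K' (z + (1, 0)) = K' z + (of_int d', 0)" by (rule lift_degree[OF K'(1)], rule that)
  define H0 where "H0 = (\<lambda>x. fst (K (x, 0)))"
  have KH: "K (x, 0) = (H0 x, 0)" for x
  proof -
    have "snd (annulus_proj (K (x, 0))) = 0" by (simp add: is_lift_apply[OF K] k_def)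
    then show ?thesis by (simp add: H0_def prod_eq_iff snd_annulus_proj)
  qed
  have H0c: "to_circle (H0 x) = fst (h (to_circle x))" for x
    using is_lift_apply[OF K, of "(x, 0)"] by (simp add: KH k_def)
  have H0cont: "continuous_on UNIV H0"
    unfolding H0_def using continuous_on_compose2[OF is_lift_continuous[OF K], of UNIV "\<lambda>x. (x, 0)"]
    by (intro continuous_on_fst) (simp add: continuous_intros)
  have H0inj: "inj H0" by (rule injI) (metis K'(3) KH fst_conv)
  have H0d: "H0 (x + 1) = H0 x + of_int d" for x using d[of "(x, 0)"] by (simp add: KH)
  have "d = 1 \<or> d = -1"
  proof -
    have K'd: "K' (z + (of_int m, 0)) = K' z + (of_int (m * d'), 0)" for z m
    proof (induction m rule: int_induct[where k = 0])
      case base then show ?case by (simp flip: zero_prod_def)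
    next
      case (step1 i)
      then show ?case using d'[of "z + (of_int i, 0)"] by (simp add: add.assoc algebra_simps)
    next
      case (step2 i)
      then show ?case using d'[of "z + (of_int (i - 1), 0)"]
        by (simp add: prod_eq_iff add.assoc) (simp add: algebra_simps)
    qed
    have "K' (K (0 + (1, 0))) = K' (K 0) + (of_int (d * d'), 0)" by (simp only: d K'd)
    then have "d * d' = 1" by (simp add: K'(3) prod_eq_iff) (metis of_int_eq_1_iff of_int_mult)
    then show ?thesis by (metis zmult_eq_1_iff)
  qed
  define \<sigma> :: real where "\<sigma> = of_int d"
  have \<sigma>: "\<sigma> = 1 \<or> \<sigma> = -1" using \<open>d = 1 \<or> d = -1\<close> by (auto simp: \<sigma>_def)
  define H where "H = (\<lambda>x. H0 (\<sigma> * x))"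
  have Hcont: "continuous_on UNIV H"
    unfolding H_def by (intro continuous_on_compose2[OF H0cont] continuous_intros) auto
  have Hinj: "inj H"
    by (rule injI) (use \<sigma> in \<open>auto simp: H_def dest!: injD[OF H0inj]\<close>)
  have H1: "H (x + 1) = H x + 1" for x
    using \<sigma>
  proof
    assume "\<sigma> = 1" then show ?thesis using H0d[of x] by (simp add: H_def \<sigma>_def)
  next
    assume "\<sigma> = -1" then show ?thesis using H0d[of "- x - 1"] by (simp add: H_def \<sigma>_def)
  qed
  have Hmono: "strict_mono H" by (rule strict_mono_lift[OF Hcont Hinj H1])
  obtain a where a: "\<alpha> = to_circle a" using surj_to_circle by (metis surjD)
  have int: "fst (F (H x, e c (H x))) - H (x + \<sigma> * a) \<in> \<int>" for x
  proof -
    have hx: "h (to_circle (\<sigma> * x)) = (to_circle (H x), e c (H x))"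
      using lf[of "to_circle (\<sigma> * x)"] by (simp add: H0c[symmetric] H_def e_def)
    have "to_circle (fst (F (H x, e c (H x)))) = fst (f (h (to_circle (\<sigma> * x))))"
      using is_lift_apply[OF F, of "(H x, e c (H x))"] by (simp add: hx) (metis fst_annulus_proj)
    also have "\<dots> = fst (h (to_circle (\<sigma> * x + a)))" by (simp add: rot a to_circle_add)
    also have "\<dots> = to_circle (H0 (\<sigma> * x + a))" by (simp add: H0c)
    also have "H0 (\<sigma> * x + a) = H (x + \<sigma> * a)" using \<sigma> by (auto simp: H_def algebra_simps)
    finally show ?thesis by (simp add: to_circle_eq_iff)
  qed
  have econt: "continuous_on UNIV (e c)"
    unfolding e_def by (intro continuous_on_compose2[OF \<eta>c] continuous_on_to_circle) auto
  let ?D = "\<lambda>x. fst (F (H x, e c (H x))) - H (x + \<sigma> * a)"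
  have "continuous_on UNIV ?D"
    by (intro continuous_intros continuous_on_compose2[OF is_lift_continuous[OF F]] Hcont
        continuous_on_compose2[OF econt Hcont] continuous_on_compose2[OF Hcont]) auto
  then have "?D x = ?D 0" for x
    by (intro integer_valued_imp_constant[of UNIV ?D]) (use int in auto)
  moreover obtain m :: int where "?D 0 = of_int m" using int[of 0] by (metis Ints_cases)
  ultimately have "fst (F (H x, e c (H x))) = H (x + \<sigma> * a) + of_int m" for x by (metis diff_eq_eq add.commute)
  then have "fst (F (H x, e c (H x))) = H (x + (\<sigma> * a + of_int m))" for x
    using degree_one_int[of H "x + \<sigma> * a" m] H1 by (simp add: add.assoc)
  then show ?thesis using Hcont Hmono H1 by blast
qed

text \<open>The conjugacies on the leaves are what makes the area function differentiable across the leaves, hence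
  a generating function.\<close>

lemma straightening_homeo:
  assumes f: "symplectic_twist_diffeo f" and fol: "C0_foliation \<eta>" and inv_fol: "invariant_foliation f \<eta>"
    and conj: "\<forall>L\<in>leaves \<eta>. conj_to_rotation_on L f"
  obtains \<Phi> where "exact_symplectic_homeo \<Phi>" "\<And>c. \<Phi> ` leaf standard_foliation c = leaf \<eta> c"
proof -
  define e where "e = (\<lambda>c t. \<eta> c (to_circle t))"
  obtain F Fi F' Fi' where F: "is_lift f F" and tp: "twist_plane e F Fi F' Fi'"
    unfolding e_def by (rule twist_plane_of_foliation[OF f fol inv_fol])
  interpret twist_plane e F Fi F' Fi' by (rule tp)
  have "\<exists>(H :: real \<Rightarrow> real) a. continuous_on UNIV H \<and> strict_mono H \<and> (\<forall>x. H (x + 1) = H x + 1) \<and> (\<forall>x. g c (H x) = H (x + a))" for c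
  proof -
    have "conj_to_rotation_on (leaf \<eta> c) f" using conj by (auto simp: leaves_def)
    from lifted_conjugacy[OF fol this F] show ?thesis unfolding g_def unfolding e_def .
  qed
  then obtain h where h: "\<And>t c. ((\<lambda>c. w t c) has_real_derivative h c t) (at c)"
    "continuous_on UNIV (\<lambda>z::real \<times> real. h (snd z) (fst z))" "\<And>c. strict_mono (h c)" "\<And>c t. h c (t + 1) = h c t + 1"
    by (rule area_C1, intro that)
  interpret gf: generating_function w e h
  proof unfold_locales
    show "\<exists>c. \<forall>t. r \<le> e c t" "\<exists>c. \<forall>t. e c t \<le> r" for r
      unfolding e_def by (rule foliation_leaf_family[OF fol])+
  qed (fact w_deriv h e_cont w_per e_per e_less)+
  obtain \<Phi> where \<Phi>: "exact_symplectic_homeo \<Phi>" "\<And>t c. \<Phi> (to_circle (h c t), c) = (to_circle t, e c t)"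
    by (rule gf.exact_symplectic_homeo_of_generating_function, rule that)
  have "\<Phi> ` leaf standard_foliation c = leaf \<eta> c" for c
  proof
    have hc: "continuous_on UNIV (h c)"
      using continuous_on_compose2[OF h(2), of UNIV "\<lambda>t. (t, c)"] by (simp add: continuous_intros)
    show "\<Phi> ` leaf standard_foliation c \<subseteq> leaf \<eta> c"
    proof (rule image_subsetI)
      fix p assume "p \<in> leaf standard_foliation c"
      then obtain x where x: "p = (to_circle x, c)"
        using surj_to_circle by (auto simp: leaf_def standard_foliation_def dest: surjD)
      obtain t where "h c t = x" using degree_one_surj[OF hc h(4)] by blast
      then show "\<Phi> p \<in> leaf \<eta> c" using \<Phi>(2)[of c t] by (auto simp: x leaf_def e_def)
    qed
    show "leaf \<eta> c \<subseteq> \<Phi> ` leaf standard_foliation c"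
    proof
      fix p assume "p \<in> leaf \<eta> c"
      then obtain \<theta> where \<theta>: "p = (\<theta>, \<eta> c \<theta>)" by (auto simp: leaf_def)
      obtain t where "\<theta> = to_circle t" using surj_to_circle by (metis surjD)
      then have t: "p = (to_circle t, e c t)" by (simp add: \<theta> e_def)
      have "(to_circle (h c t), c) \<in> leaf standard_foliation c" by (auto simp: leaf_def standard_foliation_def)
      then show "p \<in> \<Phi> ` leaf standard_foliation c" using \<Phi>(2)[of c t] t by (metis imageI)
    qed
  qed
  then show ?thesis using that \<Phi>(1) by blast
qed

lemma standard_leaf_iff: "p \<in> leaf standard_foliation c \<longleftrightarrow> snd p = c"
  by (cases p) (auto simp: leaf_def standard_foliation_def)

lemma straightened_dynamics:
  assumes f: "symplectic_twist_diffeo f" and \<Phi>: "symplectic_homeo \<Phi>"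
    and inv_fol: "invariant_foliation f \<eta>" and leaves: "(`) \<Phi> ` leaves standard_foliation = leaves \<eta>"
  obtains \<rho> where "continuous_on UNIV \<rho>" "\<And>x c. (inv \<Phi> \<circ> f \<circ> \<Phi>) (x, c) = (x + to_circle (\<rho> c), c)"
proof (rule symplectic_homeo_conjugates_to_rotations[OF \<Phi>])
  show "symplectic_diffeo f" "isotopic_to_id f" using f by (auto simp: symplectic_twist_diffeo_def)
  show "snd ((inv \<Phi> \<circ> f \<circ> \<Phi>) (x, c)) = c" for x c
  proof -
    have b: "bij \<Phi>" using \<Phi> by (simp add: symplectic_homeo_def annulus_homeo_iff)
    have "\<Phi> ` leaf standard_foliation c \<in> leaves \<eta>"
      unfolding leaves[symmetric] by (rule imageI) (simp add: leaves_def)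
    then obtain c' where c': "\<Phi> ` leaf standard_foliation c = leaf \<eta> c'" by (auto simp: leaves_def)
    have "\<Phi> (x, c) \<in> leaf \<eta> c'" using c' standard_leaf_iff[of "(x, c)" c] by auto
    then have "f (\<Phi> (x, c)) \<in> leaf \<eta> c'" using inv_fol by (auto simp: invariant_foliation_def)
    then obtain p where p: "p \<in> leaf standard_foliation c" "f (\<Phi> (x, c)) = \<Phi> p" using c' by (metis imageE)
    then show ?thesis using b by (simp add: standard_leaf_iff bij_is_inj)
  qed
qed (rule that)

theorem corollary1p4:
  fixes f :: "annulus \<Rightarrow> annulus"
  assumes "symplectic_twist_diffeo f"
  shows "(integrable_with_rotations f \<longleftrightarrow>
           (\<exists>\<eta>. C0_foliation \<eta> \<and> invariant_foliation f \<eta> \<and> exact_symplectically_standard \<eta>))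
         \<and> (integrable_with_rotations f \<longrightarrow> C0_Arnold_Liouville f)"
proof (intro conjI impI iffI)
  have straight: "\<exists>\<eta> \<Phi>. C0_foliation \<eta> \<and> invariant_foliation f \<eta> \<and> exact_symplectic_homeo \<Phi>
      \<and> (`) \<Phi> ` leaves standard_foliation = leaves \<eta>" if int: "integrable_with_rotations f"
  proof -
    obtain \<eta> where \<eta>: "C0_foliation \<eta>" "invariant_foliation f \<eta>" "\<forall>L\<in>leaves \<eta>. conj_to_rotation_on L f"
      using int by (auto simp: integrable_with_rotations_def)
    obtain \<Phi> where "exact_symplectic_homeo \<Phi>" "\<And>c. \<Phi> ` leaf standard_foliation c = leaf \<eta> c"
      by (rule straightening_homeo[OF assms \<eta>], rule that)
    then show ?thesis using \<eta> by (intro exI[of _ \<eta>] exI[of _ \<Phi>]) (simp add: leaves_def image_image)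
  qed
  {
    assume "integrable_with_rotations f"
    then show "\<exists>\<eta>. C0_foliation \<eta> \<and> invariant_foliation f \<eta> \<and> exact_symplectically_standard \<eta>"
      using straight unfolding exact_symplectically_standard_def by blast
  }
  {
    assume "integrable_with_rotations f"
    then obtain \<eta> \<Phi> where \<eta>: "invariant_foliation f \<eta>" "exact_symplectic_homeo \<Phi>"
      "(`) \<Phi> ` leaves standard_foliation = leaves \<eta>" using straight by blast
    have \<Phi>: "symplectic_homeo \<Phi>" by (rule exact_symplectic_homeo_imp[OF \<eta>(2)])
    obtain \<rho> where \<rho>: "continuous_on UNIV \<rho>" "\<And>x c. (inv \<Phi> \<circ> f \<circ> \<Phi>) (x, c) = (x + to_circle (\<rho> c), c)"
      by (rule straightened_dynamics[OF assms \<Phi> \<eta>(1,3)], rule that)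
    have "(inv \<Phi> \<circ> f \<circ> \<Phi>) ` leaf standard_foliation c = leaf standard_foliation c" for c
    proof
      show "(inv \<Phi> \<circ> f \<circ> \<Phi>) ` leaf standard_foliation c \<subseteq> leaf standard_foliation c"
        by (rule image_subsetI) (metis \<rho>(2) prod.collapse snd_conv standard_leaf_iff)
      show "leaf standard_foliation c \<subseteq> (inv \<Phi> \<circ> f \<circ> \<Phi>) ` leaf standard_foliation c"
      proof
        fix p assume "p \<in> leaf standard_foliation c"
        then have p: "p = (fst p, c)" by (simp add: standard_leaf_iff prod_eq_iff)
        have "(inv \<Phi> \<circ> f \<circ> \<Phi>) (fst p - to_circle (\<rho> c), c) = p" by (subst p) (simp only: \<rho>(2) diff_add_cancel)
        moreover have "(fst p - to_circle (\<rho> c), c) \<in> leaf standard_foliation c" by (simp add: standard_leaf_iff)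
        ultimately show "p \<in> (inv \<Phi> \<circ> f \<circ> \<Phi>) ` leaf standard_foliation c" by (metis imageI)
      qed
    qed
    then show "C0_Arnold_Liouville f"
      unfolding C0_Arnold_Liouville_def invariant_foliation_def using \<Phi> \<rho> by blast
  }
  assume "\<exists>\<eta>. C0_foliation \<eta> \<and> invariant_foliation f \<eta> \<and> exact_symplectically_standard \<eta>"
  then obtain \<eta> \<Phi> where \<eta>: "C0_foliation \<eta>" "invariant_foliation f \<eta>" "exact_symplectic_homeo \<Phi>"
    "(`) \<Phi> ` leaves standard_foliation = leaves \<eta>" by (auto simp: exact_symplectically_standard_def)
  have \<Phi>: "symplectic_homeo \<Phi>" by (rule exact_symplectic_homeo_imp[OF \<eta>(3)])
  then have b: "bij \<Phi>" "continuous_on UNIV \<Phi>" "continuous_on UNIV (inv \<Phi>)"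
    by (simp_all add: symplectic_homeo_def annulus_homeo_iff)
  obtain \<rho> where \<rho>: "\<And>x c. (inv \<Phi> \<circ> f \<circ> \<Phi>) (x, c) = (x + to_circle (\<rho> c), c)"
    by (rule straightened_dynamics[OF assms \<Phi> \<eta>(2,4)], rule that)
  have "conj_to_rotation_on L f" if L: "L \<in> leaves \<eta>" for L
  proof -
    have "L \<in> (`) \<Phi> ` leaves standard_foliation" using L \<eta>(4) by simp
    then obtain c where c: "L = \<Phi> ` leaf standard_foliation c" by (auto simp: leaves_def)
    have "homeomorphism UNIV L (\<lambda>\<theta>. \<Phi> (\<theta>, c)) (\<lambda>p. fst (inv \<Phi> p))"
      unfolding homeomorphism_def
    proof (intro conjI ballI)
      show "continuous_on UNIV (\<lambda>\<theta>. \<Phi> (\<theta>, c))"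
        by (intro continuous_on_compose2[OF b(2)] continuous_intros) auto
      show "continuous_on L (\<lambda>p. fst (inv \<Phi> p))"
        by (intro continuous_on_fst continuous_on_subset[OF b(3)]) auto
      show "(\<lambda>\<theta>. \<Phi> (\<theta>, c)) ` UNIV = L"
        unfolding c by (auto simp: leaf_def standard_foliation_def)
      show "fst (inv \<Phi> (\<Phi> (\<theta>, c))) = \<theta>" for \<theta> using b(1) by (simp add: bij_is_inj)
      then show "(\<lambda>p. fst (inv \<Phi> p)) ` L = UNIV"
        unfolding c by (auto simp: leaf_def standard_foliation_def image_iff) metis
      show "\<Phi> (fst (inv \<Phi> p), c) = p" if "p \<in> L" for p
        using that b(1) unfolding c by (auto simp: leaf_def standard_foliation_def bij_is_inj)
    qed
    moreover have "f (\<Phi> (\<theta>, c)) = \<Phi> (\<theta> + to_circle (\<rho> c), c)" for \<theta>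
      using \<rho>[of \<theta> c] b(1) by (metis bij_inv_eq_iff comp_apply)
    ultimately show ?thesis unfolding conj_to_rotation_on_def by blast
  qed
  then show "integrable_with_rotations f" unfolding integrable_with_rotations_def using \<eta>(1,2) by blast
qed

end
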